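(* Let $X$ be a proper geodesic metric space with a convergence boundary $\partial X$, let $\Gamma<\mathrm{Isom}(X)$ be a non-elementary discrete subgroup, and assume that $\Gamma\curvearrowright X$ has purely exponential growth with a contracting element. Let $\{\mu_x\}_{x\in X}$ be a nontrivial $\omega_\Gamma$-dimensional $\Gamma$-equivariant quasi-conformal density on $\partial X$ with $\mu_o$ a probability measure. Let $H$ be an infinite normal subgroup of $\Gamma$. Then $\mu_o(\Lambda^{\mathrm{hor}}(Ho))=\mu_o(\Lambda^{\mathrm{Hor}}(Ho))=1$, where $\Lambda^{\mathrm{hor}}(Ho)$ and $\Lambda^{\mathrm{Hor}}(Ho)$ are the small and big horospheric limit sets of $Ho$.
   Context: Fix $o\in X$. Contracting: a closed $Z\subseteq X$ is $C$-contracting if $\mathrm{diam}(\pi_Z(x)\cup\pi_Z(y))\le C$ whenever $d(x,y)\le d(x,Z)$, where $\pi_Z$ is the nearest-point projection (set). An isometry $g$ is contracting if $n\mapsto g^no$ is a quasi-isometric embedding of $\mathbb Z$ with contracting image. A group is elementary if finite or virtually $\mathbb Z$. $N_\Gamma(o,n)=\{go:g\in\Gamma,d(o,go)\le n\}$, $\omega_\Gamma=\limsup_n\frac1n\log\sharp N_\Gamma(o,n)$. Purely exponential growth: $\sharp N_\Gamma(o,n)\asymp e^{n\omega_\Gamma}$ for all $n\ge0$ (up to a bounded multiplicative constant). Convergence boundary: a metrizable compactification $\overline X=X\cup\partial X$ with $X$ open and dense, to which the action of $\mathrm{Isom}(X)$ extends by homeomorphisms, with an $\mathrm{Isom}(X)$-invariant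 partition $[\cdot]$ of $\partial X$ ($[\xi]$ is the class of $\xi$; $[A]=\bigcup_{\xi\in A}[\xi]$). A sequence tends (accumulates) to $[\xi]$ if its limit (all its accumulation points) lie in $[\xi]$; subsets or points $A_n$ are escaping if $d(o,A_n)\to\infty$. Required: (A) any contracting geodesic ray $\gamma$ accumulates into a closed class $[\xi]$, and any $y_n\in X$ with $\pi_\gamma(y_n)$ escaping tends to $[\xi]$. (B) for any escaping sequence of $C$-contracting quasi-geodesics $X_n$ ($C$ fixed), and any $o$, some subsequence of the cones $\Omega_o(X_n)=\{y\in X:\text{some geodesic }[o,y]\text{ meets }X_n\}$ accumulates to a class $[\xi]$, i.e. any convergent sequence $y_n\in\Omega_o(X_n)$ tends to a point of $[\xi]$. (C) the set $\mathcal C$ of non-pinched points is nonempty, where $\xi$ is non-pinched if for all sequences $x_n,y_n\in X$ converging to $[\xi]$ the segments $[x_n,y_n]$ are escaping; and for $\xi\in\mathcal C$, $[\cdot]$ is closed on $U=\Gamma[\xi]$: if $x_n,y_n\in U$, $[x_n]=[y_n]$, $x_n\to\xi'$, $y_n\to\eta'$, then $[\xi']=[\eta']$. Busemann quasi-cocycles and horoballs: it is assumed that there is $\mathcal C^{\mathrm{hor}}\subseteq\mathcal C$ and functions $B_\xi:X\times X\to\mathbb R$ ($\xi\in\mathcal C^{\mathrm{hor}}$) with $\limsup_{z\to[\xi]}|B_\xi(x,y)-(d(x,z)-d(y,z))|\le\epsilon$ for all $x,y\in X$, where $\epsilon$ may depend on $[\xi]$. Put $B_{[\xi]}(x,y)=\limsup_{z\to[\xi]}(d(x,z)-d(y,z))$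 and $\mathcal{HB}([\xi],L)=\{y\in X:B_{[\xi]}(y,o)\le L\}$. $\Lambda(Ho)$ is the set of accumulation points of $Ho$ in $\partial X$. A point $\xi\in[\Lambda(Ho)]\cap\mathcal C^{\mathrm{hor}}$ is a big (resp. small) horospheric limit point if some (resp. any) horoball $\mathcal{HB}([\xi],L)$ contains infinitely many $h_no\in Ho$ (tending to $[\xi]$); $\Lambda^{\mathrm{Hor}}(Ho)$ (resp. $\Lambda^{\mathrm{hor}}(Ho)$) is the set of these. Nontrivial $\omega$-dimensional $\Gamma$-equivariant quasi-conformal density on $\partial X$: finite positive Radon measures $\mu_x$ on $\partial X$ with $g_\star\mu_x=\mu_{gx}$ ($g\in\Gamma$); for some $\lambda\ge1$, $\lambda^{-1}e^{-\omega B_\xi(x,y)}\le\frac{d\mu_x}{d\mu_y}(\xi)\le\lambda e^{-\omega B_\xi(x,y)}$ for $\mu_y$-a.e. $\xi$; and $\mu_o$ is supported on $\mathcal C$. *)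

theory Defs
  imports "HOL-Analysis.Analysis" "HOL-Algebra.Elementary_Groups"
begin

section \<open>Geodesics and contracting sets\<close>

definition geodesic_segment :: "'a::metric_space \<Rightarrow> 'a \<Rightarrow> 'a set \<Rightarrow> bool" where
  "geodesic_segment x y S \<longleftrightarrow>
     (\<exists>\<gamma>::real \<Rightarrow> 'a. \<gamma> 0 = x \<and> \<gamma> (dist x y) = y \<and> S = \<gamma> ` {0..dist x y} \<and>
        (\<forall>s\<in>{0..dist x y}. \<forall>t\<in>{0..dist x y}. dist (\<gamma> s) (\<gamma> t) = \<bar>s - t\<bar>))"

definition geodesic_ray :: "(real \<Rightarrow> 'a::metric_space) \<Rightarrow> bool" where
  "geodesic_ray \<gamma> \<longleftrightarrow> (\<forall>s\<ge>0. \<forall>t\<ge>0. dist (\<gamma> s) (\<gamma> t) = \<bar>s - t\<bar>)"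

definition qi_embedding_on ::
  "real \<Rightarrow> real \<Rightarrow> real set \<Rightarrow> (real \<Rightarrow> 'a::metric_space) \<Rightarrow> bool" where
  "qi_embedding_on k c I f \<longleftrightarrow> k \<ge> 1 \<and> c \<ge> 0 \<and>
     (\<forall>s\<in>I. \<forall>t\<in>I. dist s t / k - c \<le> dist (f s) (f t) \<and> dist (f s) (f t) \<le> k * dist s t + c)"

text \<open>Quasi-geodesics are treated as subsets: images of arbitrary (bounded or unbounded)
  nonempty real intervals, not required to be continuous. In particular the image of a
  quasi-isometric embedding of the integers is one, by precomposing with the floor function.\<close>
definition quasi_geodesic :: "real \<Rightarrow> real \<Rightarrow> 'a::metric_space set \<Rightarrow> bool" where
  "quasi_geodesic k c Z \<longleftrightarrow>
     (\<exists>(I::real set) f. is_interval I \<and> I \<noteq> {} \<and> qi_embedding_on k c I f \<and> Z = f ` I)"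

definition nearest_proj :: "'a::metric_space set \<Rightarrow> 'a \<Rightarrow> 'a set" where
  "nearest_proj Z x = {z \<in> Z. dist x z = infdist x Z}"

definition contracting_set :: "real \<Rightarrow> 'a::metric_space set \<Rightarrow> bool" where
  "contracting_set C Z \<longleftrightarrow> closed Z \<and>
     (\<forall>x y. dist x y \<le> infdist x Z \<longrightarrow> diameter (nearest_proj Z x \<union> nearest_proj Z y) \<le> C)"

definition escaping :: "'a::metric_space \<Rightarrow> (nat \<Rightarrow> 'a set) \<Rightarrow> bool" where
  "escaping p A \<longleftrightarrow> filterlim (\<lambda>n. infdist p (A n)) at_top sequentially"

section \<open>Groups of isometries\<close>

definition isom_group :: "('a::metric_space \<Rightarrow> 'a) monoid" where
  "isom_group = \<lparr>carrier = {g. surj g \<and> (\<forall>x y. dist (g x) (g y) = dist x y)},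
                 mult = (\<lambda>g h. g \<circ> h), one = id\<rparr>"

text \<open>The integers, with their metric, are the subset \<open>\<int>\<close> of the reals.\<close>
definition contracting_isometry :: "'a::metric_space \<Rightarrow> ('a \<Rightarrow> 'a) \<Rightarrow> bool" where
  "contracting_isometry p g \<longleftrightarrow> g \<in> carrier isom_group \<and>
     (\<exists>k c. qi_embedding_on k c \<int> (\<lambda>t. (g [^]\<^bsub>isom_group\<^esub> \<lfloor>t\<rfloor>) p)) \<and>
     (\<exists>C. contracting_set C (range (\<lambda>n::int. (g [^]\<^bsub>isom_group\<^esub> n) p)))"

definition virtually_Z :: "('g, 'm) monoid_scheme \<Rightarrow> bool" where
  "virtually_Z G \<longleftrightarrow>
     (\<exists>K. subgroup K G \<and> finite (rcosets\<^bsub>G\<^esub> K) \<and> G\<lparr>carrier := K\<rparr> \<cong> integer_group)"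

definition elementary_group :: "('g, 'm) monoid_scheme \<Rightarrow> bool" where
  "elementary_group G \<longleftrightarrow> finite (carrier G) \<or> virtually_Z G"

text \<open>\<^const>\<open>discrete\<close> refers to the function topology, i.e. pointwise convergence; on a
  group of isometries this is the compact-open topology.\<close>
definition discrete_isometry_group :: "('a::metric_space \<Rightarrow> 'a) set \<Rightarrow> bool" where
  "discrete_isometry_group \<Gamma> \<longleftrightarrow> subgroup \<Gamma> isom_group \<and> discrete \<Gamma>"

definition orbit_of :: "('a \<Rightarrow> 'a) set \<Rightarrow> 'a \<Rightarrow> 'a set" where
  "orbit_of H p = (\<lambda>h. h p) ` H"

definition orbit_ball :: "('a::metric_space \<Rightarrow> 'a) set \<Rightarrow> 'a \<Rightarrow> nat \<Rightarrow> 'a set" where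
  "orbit_ball \<Gamma> p n = {g p |g. g \<in> \<Gamma> \<and> dist p (g p) \<le> real n}"

definition growth_rate :: "('a::metric_space \<Rightarrow> 'a) set \<Rightarrow> 'a \<Rightarrow> real" where
  "growth_rate \<Gamma> p =
     real_of_ereal (limsup (\<lambda>n. ereal (ln (real (card (orbit_ball \<Gamma> p n))) / real n)))"

text \<open>The bounds force the limit superior in \<^const>\<open>growth_rate\<close> to be finite, so the
  truncation there is harmless.\<close>
definition purely_exponential_growth :: "('a::metric_space \<Rightarrow> 'a) set \<Rightarrow> 'a \<Rightarrow> bool" where
  "purely_exponential_growth \<Gamma> p \<longleftrightarrow>
     (\<exists>c\<ge>1. \<forall>n. exp (real n * growth_rate \<Gamma> p) / c \<le> real (card (orbit_ball \<Gamma> p n)) \<and>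
                 real (card (orbit_ball \<Gamma> p n)) \<le> c * exp (real n * growth_rate \<Gamma> p))"

section \<open>Compactifications and convergence boundaries\<close>

text \<open>The compactification is a type \<^typ>\<open>'b\<close> with an embedding \<open>\<iota>\<close>. Its metric is only
  used through the topology, so the class \<^class>\<open>metric_space\<close> expresses metrizability.\<close>
definition compactification :: "('a::metric_space \<Rightarrow> 'b::metric_space) \<Rightarrow> bool" where
  "compactification \<iota> \<longleftrightarrow> compact (UNIV :: 'b set) \<and> embedding_map euclidean euclidean \<iota> \<and>
     open (range \<iota>) \<and> closure (range \<iota>) = UNIV"

definition boundary :: "('a \<Rightarrow> 'b) \<Rightarrow> 'b set" where
  "boundary \<iota> = - range \<iota>"

definition extends_isometry ::
  "('a \<Rightarrow> 'b::topological_space) \<Rightarrow> ('a \<Rightarrow> 'a) \<Rightarrow> ('b \<Rightarrow> 'b) \<Rightarrow> bool" where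
  "extends_isometry \<iota> g \<phi> \<longleftrightarrow> continuous_on UNIV \<phi> \<and> (\<forall>x. \<phi> (\<iota> x) = \<iota> (g x))"

text \<open>A continuous extension is unique, as the image of \<open>\<iota>\<close> is dense.\<close>
definition bd_ext :: "('a \<Rightarrow> 'b::topological_space) \<Rightarrow> ('a \<Rightarrow> 'a) \<Rightarrow> 'b \<Rightarrow> 'b" where
  "bd_ext \<iota> g = (THE \<phi>. extends_isometry \<iota> g \<phi>)"

text \<open>The partition \<open>[\<cdot>]\<close> is an equivalence relation \<open>R\<close> on the boundary; \<open>[\<xi>]\<close> is
  \<open>R `` {\<xi>}\<close> and \<open>[A]\<close> is \<open>R `` A\<close>.\<close>
definition isom_invariant_partition ::
  "('a::metric_space \<Rightarrow> 'b::metric_space) \<Rightarrow> 'b rel \<Rightarrow> bool" where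
  "isom_invariant_partition \<iota> R \<longleftrightarrow> equiv (boundary \<iota>) R \<and>
     (\<forall>g\<in>carrier isom_group.
        (\<exists>\<phi> \<psi>. homeomorphism UNIV UNIV \<phi> \<psi> \<and> extends_isometry \<iota> g \<phi>) \<and>
        (\<forall>\<xi>\<in>boundary \<iota>. bd_ext \<iota> g ` (R `` {\<xi>}) = R `` {bd_ext \<iota> g \<xi>}))"

text \<open>Convergence of a sequence of \<open>X\<close> to a class: it need not converge to a single point, but
  every accumulation point lies in the class.\<close>
definition tends_to_class ::
  "('a \<Rightarrow> 'b::topological_space) \<Rightarrow> 'b set \<Rightarrow> (nat \<Rightarrow> 'a) \<Rightarrow> bool" where
  "tends_to_class \<iota> A x \<longleftrightarrow>
     (\<forall>r \<eta>. strict_mono r \<longrightarrow> (\<lambda>n. \<iota> (x (r n))) \<longlonglongrightarrow> \<eta> \<longrightarrow> \<eta> \<in> A)"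

definition cone :: "'a::metric_space \<Rightarrow> 'a set \<Rightarrow> 'a set" where
  "cone q Z = {y. \<exists>S. geodesic_segment q y S \<and> S \<inter> Z \<noteq> {}}"

definition non_pinched ::
  "'a::metric_space \<Rightarrow> ('a \<Rightarrow> 'b::metric_space) \<Rightarrow> 'b rel \<Rightarrow> 'b set" where
  "non_pinched p \<iota> R = {\<xi> \<in> boundary \<iota>. \<forall>x y S.
     tends_to_class \<iota> (R `` {\<xi>}) x \<longrightarrow> tends_to_class \<iota> (R `` {\<xi>}) y \<longrightarrow>
     (\<forall>n. geodesic_segment (x n) (y n) (S n)) \<longrightarrow> escaping p S}"

definition assumption_A ::
  "'a::metric_space \<Rightarrow> ('a \<Rightarrow> 'b::metric_space) \<Rightarrow> 'b rel \<Rightarrow> bool" where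
  "assumption_A p \<iota> R \<longleftrightarrow>
     (\<forall>\<gamma> C. geodesic_ray \<gamma> \<longrightarrow> contracting_set C (\<gamma> ` {0..}) \<longrightarrow>
        (\<exists>\<xi>\<in>boundary \<iota>. closed (R `` {\<xi>}) \<and>
           (\<forall>t. filterlim t at_top sequentially \<longrightarrow>
                tends_to_class \<iota> (R `` {\<xi>}) (\<lambda>n. \<gamma> (t n))) \<and>
           (\<forall>y. escaping p (\<lambda>n. nearest_proj (\<gamma> ` {0..}) (y n)) \<longrightarrow>
                tends_to_class \<iota> (R `` {\<xi>}) y)))"

definition assumption_B ::
  "'a::metric_space \<Rightarrow> ('a \<Rightarrow> 'b::metric_space) \<Rightarrow> 'b rel \<Rightarrow> bool" where
  "assumption_B p \<iota> R \<longleftrightarrow>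
     (\<forall>C k c Z q. escaping p Z \<longrightarrow> (\<forall>n. quasi_geodesic k c (Z n) \<and> contracting_set C (Z n)) \<longrightarrow>
        (\<exists>r. strict_mono r \<and> (\<exists>\<xi>\<in>boundary \<iota>. \<forall>y \<eta>.
           (\<forall>n. y n \<in> cone q (Z (r n))) \<longrightarrow> (\<lambda>n. \<iota> (y n)) \<longlonglongrightarrow> \<eta> \<longrightarrow> \<eta> \<in> R `` {\<xi>})))"

definition assumption_C ::
  "'a::metric_space \<Rightarrow> ('a \<Rightarrow> 'b::metric_space) \<Rightarrow> 'b rel \<Rightarrow> ('a \<Rightarrow> 'a) set \<Rightarrow> bool" where
  "assumption_C p \<iota> R \<Gamma> \<longleftrightarrow> non_pinched p \<iota> R \<noteq> {} \<and>
     (\<forall>\<xi>\<in>non_pinched p \<iota> R. \<forall>x y \<xi>' \<eta>'.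
        (\<forall>n. x n \<in> (\<Union>g\<in>\<Gamma>. bd_ext \<iota> g ` (R `` {\<xi>}))) \<longrightarrow>
        (\<forall>n. y n \<in> (\<Union>g\<in>\<Gamma>. bd_ext \<iota> g ` (R `` {\<xi>}))) \<longrightarrow>
        (\<forall>n::nat. R `` {x n} = R `` {y n}) \<longrightarrow> x \<longlonglongrightarrow> \<xi>' \<longrightarrow> y \<longlonglongrightarrow> \<eta>' \<longrightarrow>
        R `` {\<xi>'} = R `` {\<eta>'})"

definition convergence_boundary ::
  "'a::metric_space \<Rightarrow> ('a \<Rightarrow> 'b::metric_space) \<Rightarrow> 'b rel \<Rightarrow> ('a \<Rightarrow> 'a) set \<Rightarrow> bool" where
  "convergence_boundary p \<iota> R \<Gamma> \<longleftrightarrow> compactification \<iota> \<and> isom_invariant_partition \<iota> R \<and>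
     assumption_A p \<iota> R \<and> assumption_B p \<iota> R \<and> assumption_C p \<iota> R \<Gamma>"

section \<open>Busemann quasi-cocycles and horospheric limit points\<close>

text \<open>The filter of \<open>z \<rightarrow> A\<close> with \<open>z\<close> in \<open>X\<close>: a limit superior along it is the supremum of
  the limits superior over all sequences of \<open>X\<close> that converge to a point of \<open>A\<close>.\<close>
definition toward_class :: "('a \<Rightarrow> 'b::topological_space) \<Rightarrow> 'b set \<Rightarrow> 'a filter" where
  "toward_class \<iota> A = (SUP \<eta>\<in>A. filtercomap \<iota> (nhds \<eta>))"

definition busemann_quasi_cocycle ::
  "'a::metric_space \<Rightarrow> ('a \<Rightarrow> 'b::metric_space) \<Rightarrow> 'b rel \<Rightarrow> 'b set \<Rightarrow>
    ('b \<Rightarrow> 'a \<Rightarrow> 'a \<Rightarrow> real) \<Rightarrow> bool" where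
  "busemann_quasi_cocycle p \<iota> R Chor B \<longleftrightarrow> Chor \<subseteq> non_pinched p \<iota> R \<and>
     (\<exists>\<epsilon> :: 'b set \<Rightarrow> real. \<forall>\<xi>\<in>Chor. \<forall>x y.
        Limsup (toward_class \<iota> (R `` {\<xi>}))
          (\<lambda>z. ereal \<bar>B \<xi> x y - (dist x z - dist y z)\<bar>) \<le> ereal (\<epsilon> (R `` {\<xi>})))"

definition class_busemann ::
  "('a::metric_space \<Rightarrow> 'b::metric_space) \<Rightarrow> 'b set \<Rightarrow> 'a \<Rightarrow> 'a \<Rightarrow> ereal" where
  "class_busemann \<iota> A x y = Limsup (toward_class \<iota> A) (\<lambda>z. ereal (dist x z - dist y z))"

definition horoball ::
  "'a::metric_space \<Rightarrow> ('a \<Rightarrow> 'b::metric_space) \<Rightarrow> 'b set \<Rightarrow> real \<Rightarrow> 'a set" where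
  "horoball p \<iota> A L = {y. class_busemann \<iota> A y p \<le> ereal L}"

definition limit_set ::
  "'a::metric_space \<Rightarrow> ('a \<Rightarrow> 'b::metric_space) \<Rightarrow> ('a \<Rightarrow> 'a) set \<Rightarrow> 'b set" where
  "limit_set p \<iota> H = {\<xi> \<in> boundary \<iota>. \<xi> islimpt \<iota> ` orbit_of H p}"

definition horoball_accumulates ::
  "'a::metric_space \<Rightarrow> ('a \<Rightarrow> 'b::metric_space) \<Rightarrow> ('a \<Rightarrow> 'a) set \<Rightarrow> 'b set \<Rightarrow> real \<Rightarrow> bool" where
  "horoball_accumulates p \<iota> H A L \<longleftrightarrow>
     (\<exists>x :: nat \<Rightarrow> 'a. inj x \<and> range x \<subseteq> orbit_of H p \<inter> horoball p \<iota> A L \<and> tends_to_class \<iota> A x)"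

definition big_horospheric_limit_set ::
  "'a::metric_space \<Rightarrow> ('a \<Rightarrow> 'b::metric_space) \<Rightarrow> 'b rel \<Rightarrow> 'b set \<Rightarrow> ('a \<Rightarrow> 'a) set \<Rightarrow> 'b set" where
  "big_horospheric_limit_set p \<iota> R Chor H =
     {\<xi> \<in> R `` limit_set p \<iota> H \<inter> Chor. \<exists>L. horoball_accumulates p \<iota> H (R `` {\<xi>}) L}"

definition small_horospheric_limit_set ::
  "'a::metric_space \<Rightarrow> ('a \<Rightarrow> 'b::metric_space) \<Rightarrow> 'b rel \<Rightarrow> 'b set \<Rightarrow> ('a \<Rightarrow> 'a) set \<Rightarrow> 'b set" where
  "small_horospheric_limit_set p \<iota> R Chor H =
     {\<xi> \<in> R `` limit_set p \<iota> H \<inter> Chor. \<forall>L. horoball_accumulates p \<iota> H (R `` {\<xi>}) L}"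

section \<open>Quasi-conformal densities\<close>

abbreviation boundary_borel :: "('a \<Rightarrow> 'b::topological_space) \<Rightarrow> 'b measure" where
  "boundary_borel \<iota> \<equiv> restrict_space borel (boundary \<iota>)"

text \<open>The boundary is a compact metrizable space, so every finite Borel measure on it is Radon.
  Since \<open>B \<xi>\<close> is a Busemann function only for \<open>\<xi> \<in> Chor\<close>, the almost-everywhere bounds on the
  Radon-Nikodym derivative include that almost every \<open>\<xi>\<close> is in \<open>Chor\<close>.\<close>
definition quasi_conformal_density ::
  "'a::metric_space \<Rightarrow> ('a \<Rightarrow> 'b::metric_space) \<Rightarrow> 'b rel \<Rightarrow> 'b set \<Rightarrow> ('b \<Rightarrow> 'a \<Rightarrow> 'a \<Rightarrow> real) \<Rightarrow>
    ('a \<Rightarrow> 'a) set \<Rightarrow> real \<Rightarrow> ('a \<Rightarrow> 'b measure) \<Rightarrow> bool" where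
  "quasi_conformal_density p \<iota> R Chor B \<Gamma> \<omega> \<mu> \<longleftrightarrow>
     (\<forall>x. finite_measure (\<mu> x) \<and> sets (\<mu> x) = sets (boundary_borel \<iota>)) \<and>
     (\<forall>g\<in>\<Gamma>. \<forall>x. distr (\<mu> x) (boundary_borel \<iota>) (bd_ext \<iota> g) = \<mu> (g x)) \<and>
     (\<exists>k\<ge>1. \<forall>x y. absolutely_continuous (\<mu> y) (\<mu> x) \<and>
        (AE \<xi> in \<mu> y. \<xi> \<in> Chor \<and>
           ennreal (exp (- \<omega> * B \<xi> x y) / k) \<le> RN_deriv (\<mu> y) (\<mu> x) \<xi> \<and>
           RN_deriv (\<mu> y) (\<mu> x) \<xi> \<le> ennreal (k * exp (- \<omega> * B \<xi> x y)))) \<and>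
     (AE \<xi> in \<mu> p. \<xi> \<in> non_pinched p \<iota> R)"

end

(*
A quasi-conformal density gives mass at least a constant times exp (- omega * |g|) to the shadow
of g p seen from p, and pure exponential growth provides, in every annulus of a fixed width, at
least a constant times exp (omega * n) elements g. Shadows are cut out by projecting to the axis
of a contracting element, translated by g; non-pinching makes those of one annulus overlap boundedly often, so
every invariant set of positive measure is met by the shadows of all large annuli in a definite
mass. For the set T of points at which the densities of h p, h in H, are bounded, this replaces a
Lebesgue density theorem: some shadow lies, up to an arbitrarily small proportion, in
a set where the densities are bounded by a given constant. Conjugating by g, which preserves H,
transports the shadow back to a fixed one, in which a fixed long element of H has large density
on a definite proportion. Hence T is null. The same mass estimate shows that almost every point
is conical, and at conical points every infinite sequence of orbit points in a horoball tends to
the class of the point, by assumption (B) applied to two-point sets.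
*)
theory Submission
  imports Defs
begin

section \<open>Geodesics and projections to a contracting line\<close>

text \<open>The error of the Busemann quasi-cocycle may depend on the class, so no estimate of the
  densities is uniform on the boundary. The measure-theoretic argument therefore runs on an
  invariant set \<open>Z\<close> where one constant \<open>m\<close> serves, and it is applied to a
  sequence of such sets that exhausts almost every point. Shadows are closures of translates of the
  set of points that project to the axis far from \<open>p\<close>, in either direction. Two
  translates of one such shadow cover the boundary, so it meets every invariant set of positive
  measure in positive measure; all mass estimates start from this. The price is that the shadow of
  \<open>g\<close> is a shadow as seen from \<open>p\<close> only if \<open>ginv g p\<close>
  projects near \<open>p\<close>. Pure exponential growth makes the elements that fail this a small
  proportion of every ball, and a conjugation inside the normal subgroup repairs those of
  \<open>H\<close>.\<close>

lemma infdist_attained: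
  fixes A :: "'a::metric_space set"
  assumes proper: "\<forall>(x::'a) r. compact (cball x r)" and A: "closed A" "A \<noteq> {}"
  obtains y where "y \<in> A" "infdist x A = dist x y"
proof -
  obtain a where a: "a \<in> A" using A by blast
  have cpt: "compact (cball x (dist x a) \<inter> A)"
    using proper A by (simp add: compact_Int_closed)
  obtain y where y: "y \<in> cball x (dist x a) \<inter> A"
    "\<And>z. z \<in> cball x (dist x a) \<inter> A \<Longrightarrow> dist x y \<le> dist x z"
    using continuous_attains_inf[OF cpt, of "dist x"] a by (force intro!: continuous_intros)
  have "dist x y \<le> dist x z" if "z \<in> A" for z
    using y(2)[of z] y(2)[of a] a that by (cases "dist x z \<le> dist x a") auto
  hence "dist x y \<le> infdist x A"
    using A by (auto simp: infdist_def intro!: cINF_greatest)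
  moreover have "infdist x A \<le> dist x y" using y by (intro infdist_le) auto
  ultimately show ?thesis using that y by auto
qed

lemma geodesic_segment_sym:
  assumes "geodesic_segment x y S"
  shows "geodesic_segment y x S"
proof -
  obtain \<gamma> where g: "\<gamma> 0 = x" "\<gamma> (dist x y) = y" "S = \<gamma> ` {0..dist x y}"
    "\<forall>s\<in>{0..dist x y}. \<forall>t\<in>{0..dist x y}. dist (\<gamma> s) (\<gamma> t) = \<bar>s - t\<bar>"
    using assms unfolding geodesic_segment_def by auto
  let ?d = "\<lambda>t. \<gamma> (dist x y - t)"
  have "?d ` {0..dist x y} = \<gamma> ` ((\<lambda>t. dist x y - t) ` {0..dist x y})"
    by (simp only: image_image)
  also have "(\<lambda>t. dist x y - t) ` {0..dist x y} = {0..dist x y}"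
    by (simp add: image_diff_atLeastAtMost)
  finally have "S = ?d ` {0..dist y x}" using g by (simp add: dist_commute)
  moreover have "\<forall>s\<in>{0..dist y x}. \<forall>t\<in>{0..dist y x}. dist (?d s) (?d t) = \<bar>s - t\<bar>"
    using g(4) by (auto simp: dist_commute)
  ultimately show ?thesis
    unfolding geodesic_segment_def using g by (intro exI[of _ ?d]) (auto simp: dist_commute)
qed

lemma geodesic_segment_image:
  assumes S: "geodesic_segment x y S" and iso: "\<And>u v. dist (g u) (g v) = dist u v"
  shows "geodesic_segment (g x) (g y) (g ` S)"
proof -
  obtain \<gamma> where g: "\<gamma> 0 = x" "\<gamma> (dist x y) = y" "S = \<gamma> ` {0..dist x y}"
    "\<forall>s\<in>{0..dist x y}. \<forall>t\<in>{0..dist x y}. dist (\<gamma> s) (\<gamma> t) = \<bar>s - t\<bar>"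
    using S unfolding geodesic_segment_def by auto
  show ?thesis unfolding geodesic_segment_def
    by (rule exI[of _ "g \<circ> \<gamma>"]) (use g iso in \<open>auto simp: image_comp\<close>)
qed

lemma geodesic_segment_dist_add:
  assumes S: "geodesic_segment x y S" and "u \<in> S"
  shows "dist x y = dist x u + dist u y"
proof -
  obtain \<gamma> where g: "\<gamma> 0 = x" "\<gamma> (dist x y) = y" "S = \<gamma> ` {0..dist x y}"
    "\<forall>s\<in>{0..dist x y}. \<forall>t\<in>{0..dist x y}. dist (\<gamma> s) (\<gamma> t) = \<bar>s - t\<bar>"
    using S unfolding geodesic_segment_def by auto
  obtain t where t: "t \<in> {0..dist x y}" "u = \<gamma> t" using assms g by auto
  have "dist (\<gamma> 0) (\<gamma> t) = t" "dist (\<gamma> t) (\<gamma> (dist x y)) = dist x y - t"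
    using g(4) t(1) by auto
  thus ?thesis using g t by simp
qed

lemma geodesic_segment_dist_diff:
  assumes S: "geodesic_segment x y S" and "u \<in> S" "v \<in> S"
  shows "dist u v = \<bar>dist x u - dist x v\<bar>"
proof -
  obtain \<gamma> where g: "\<gamma> 0 = x" "\<gamma> (dist x y) = y" "S = \<gamma> ` {0..dist x y}"
    "\<forall>s\<in>{0..dist x y}. \<forall>t\<in>{0..dist x y}. dist (\<gamma> s) (\<gamma> t) = \<bar>s - t\<bar>"
    using S unfolding geodesic_segment_def by auto
  obtain t t' where t: "t \<in> {0..dist x y}" "u = \<gamma> t" "t' \<in> {0..dist x y}" "v = \<gamma> t'"
    using assms g by auto
  have "dist (\<gamma> 0) (\<gamma> t) = t" "dist (\<gamma> 0) (\<gamma> t') = t'" "dist (\<gamma> t) (\<gamma> t') = \<bar>t - t'\<bar>"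
    using g(4) t by auto
  thus ?thesis using g t by simp
qed

text \<open>The line is indexed by the integers because it will be an orbit of the contracting
  element; it need not be a geodesic. The normalisation \<open>C \<ge> 1\<close>, obtained by
  enlarging the constant, allows steps of length \<open>2 * C\<close> along a path.\<close>

locale contracting_line =
  fixes a :: "int \<Rightarrow> 'a::metric_space" and k c C :: real
  assumes proper: "\<forall>(x::'a) r. compact (cball x r)"
    and contracting: "contracting_set C (range a)"
    and C_ge1: "C \<ge> 1" and k_ge1: "k \<ge> 1" and c_ge0: "c \<ge> 0"
    and qi_lower: "\<bar>real_of_int (i - j)\<bar> / k - c \<le> dist (a i) (a j)"
    and qi_upper: "dist (a i) (a j) \<le> k * \<bar>real_of_int (i - j)\<bar> + c"
begin

text \<open>Indices rather than points: \<open>a\<close> need not be injective, and the distance to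
  the centre \<open>a 0\<close> will be read off the index.\<close>

definition P :: "'a \<Rightarrow> int set" where
  "P x = {i. dist x (a i) = infdist x (range a)}"

lemma closed_range: "closed (range a)"
  using contracting by (simp add: contracting_set_def)

lemma P_nonempty: obtains i where "i \<in> P x"
proof -
  obtain y where "y \<in> range a" "infdist x (range a) = dist x y"
    using infdist_attained[OF proper closed_range, of x] by auto
  thus ?thesis using that unfolding P_def by auto
qed

lemma P_point: "i \<in> P (a i)" "j \<in> P (a i) \<Longrightarrow> a j = a i"
  by (auto simp: P_def)

lemma proj_close:
  assumes "dist x y \<le> dist x (a i)" "i \<in> P x" "j \<in> P y"
  shows "dist (a i) (a j) \<le> C"
proof -
  let ?Z = "range a"
  have le: "diameter (nearest_proj ?Z x \<union> nearest_proj ?Z y) \<le> C"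
    using assms contracting unfolding contracting_set_def P_def by auto
  \<comment> \<open>\<open>diameter\<close> bounds distances only in bounded sets, so boundedness
    comes first.\<close>
  have "nearest_proj ?Z x \<subseteq> cball x (infdist x ?Z)" for x
    by (auto simp: nearest_proj_def)
  hence "bounded (nearest_proj ?Z x)" for x
    by (rule bounded_subset[OF bounded_cball])
  hence b: "bounded (nearest_proj ?Z x \<union> nearest_proj ?Z y)" by auto
  have "a i \<in> nearest_proj ?Z x" "a j \<in> nearest_proj ?Z y"
    using assms by (auto simp: nearest_proj_def P_def)
  thus ?thesis using diameter_bounded_bound[OF b, of "a i" "a j"] le by auto
qed

text \<open>A step of length at most \<open>2 * C\<close> that starts at distance at least
  \<open>2 * C\<close> from the line moves the projection by at most \<open>C\<close>. The choice of
  \<open>2 * C\<close> instead of \<open>C\<close> gives the ratio one half.\<close>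

lemma proj_close_steps:
  fixes \<gamma> :: "real \<Rightarrow> 'a"
  assumes iso: "\<And>u v. u \<in> {s..t} \<Longrightarrow> v \<in> {s..t} \<Longrightarrow> dist (\<gamma> u) (\<gamma> v) = \<bar>u - v\<bar>"
    and far: "\<And>u. u \<in> {s..<t} \<Longrightarrow> infdist (\<gamma> u) (range a) \<ge> 2 * C"
    and "s \<le> t" "t - s \<le> 2 * C * real (Suc n)" "i \<in> P (\<gamma> s)" "j \<in> P (\<gamma> t)"
  shows "dist (a i) (a j) \<le> C * real (Suc n)"
  using assms
proof (induction n arbitrary: s i)
  case 0
  show ?case
  proof (cases "s = t")
    case True
    thus ?thesis using proj_close[of "\<gamma> s" "\<gamma> s" i j] 0 by simp
  next
    case False
    hence "2 * C \<le> infdist (\<gamma> s) (range a)" using 0 by auto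
    moreover have "dist (\<gamma> s) (\<gamma> t) = t - s" using 0 by auto
    ultimately show ?thesis using proj_close[of "\<gamma> s" "\<gamma> t" i j] 0 by (auto simp: P_def)
  qed
next
  case (Suc n)
  show ?case
  proof (cases "t - s \<le> 2 * C * real (Suc n)")
    case True
    have "dist (a i) (a j) \<le> C * real (Suc n)"
      using Suc.IH[OF Suc.prems(1,2) Suc.prems(3) True Suc.prems(5,6)] by simp
    thus ?thesis using C_ge1 by (auto simp: algebra_simps)
  next
    case False
    define u where "u = s + 2 * C"
    have "2 * C \<le> 2 * C * real (Suc n)" using C_ge1 by simp
    hence u: "s \<le> u" "u < t" using False C_ge1 unfolding u_def by linarith+
    obtain l where l: "l \<in> P (\<gamma> u)" using P_nonempty by blast
    have "dist (a l) (a j) \<le> C * real (Suc n)"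
    proof (rule Suc.IH[OF _ _ _ _ l Suc.prems(6)])
      show "t - u \<le> 2 * C * real (Suc n)" using Suc.prems(4) by (auto simp: u_def algebra_simps)
    qed (use u Suc.prems in auto)
    moreover have "dist (a i) (a l) \<le> C"
    proof -
      have "2 * C \<le> infdist (\<gamma> s) (range a)" using Suc.prems u by auto
      moreover have "dist (\<gamma> s) (\<gamma> u) = 2 * C" using Suc.prems(1)[of s u] u C_ge1 by (auto simp: u_def)
      ultimately show ?thesis using proj_close[of "\<gamma> s" "\<gamma> u" i l] Suc.prems l by (auto simp: P_def)
    qed
    ultimately show ?thesis using dist_triangle[of "a i" "a j" "a l"] by (auto simp: algebra_simps)
  qed
qed

text \<open>The last, incomplete step counts as a full one; this is the additive term.\<close>

lemma proj_close_path:
  fixes \<gamma> :: "real \<Rightarrow> 'a"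
  assumes iso: "\<And>u v. u \<in> {s..t} \<Longrightarrow> v \<in> {s..t} \<Longrightarrow> dist (\<gamma> u) (\<gamma> v) = \<bar>u - v\<bar>"
    and far: "\<And>u. u \<in> {s..<t} \<Longrightarrow> infdist (\<gamma> u) (range a) \<ge> 2 * C"
    and st: "s \<le> t" and ij: "i \<in> P (\<gamma> s)" "j \<in> P (\<gamma> t)"
  shows "2 * dist (a i) (a j) \<le> 2 * C + (t - s)"
proof -
  define n where "n = nat \<lfloor>(t - s) / (2 * C)\<rfloor>"
  have q: "0 \<le> (t - s) / (2 * C)" using st C_ge1 by simp
  have "(t - s) / (2 * C) \<le> real (Suc n)" using q unfolding n_def by linarith
  hence le: "t - s \<le> 2 * C * real (Suc n)" using C_ge1 by (simp add: field_simps)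
  have "real n \<le> (t - s) / (2 * C)" using q unfolding n_def by linarith
  hence "2 * (C * real n) \<le> t - s" using C_ge1 by (simp add: field_simps)
  moreover have "dist (a i) (a j) \<le> C * real n + C"
    using proj_close_steps[OF iso far st le ij] by (simp add: algebra_simps)
  ultimately show ?thesis by linarith
qed

text \<open>Outside the \<open>2 * C\<close>-neighbourhood of the line the projection moves at most half as fast as
  the geodesic, so a geodesic with distant projections cannot afford to stay away from the line.\<close>
lemma geodesic_near_proj:
  assumes S: "geodesic_segment x y S" and ij: "i \<in> P x" "j \<in> P y"
    and large: "dist (a i) (a j) > 6 * C"
  shows "\<exists>u\<in>S. dist u (a i) \<le> 8 * C"
proof -
  define L where "L = dist x y"
  obtain \<gamma> where g: "\<gamma> 0 = x" "\<gamma> L = y" "S = \<gamma> ` {0..L}"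
    and iso: "\<And>s t. s \<in> {0..L} \<Longrightarrow> t \<in> {0..L} \<Longrightarrow> dist (\<gamma> s) (\<gamma> t) = \<bar>s - t\<bar>"
    using S unfolding geodesic_segment_def L_def by auto
  have L0: "0 \<le> L" by (simp add: L_def)
  define D where "D = (\<lambda>u. infdist (\<gamma> u) (range a))"
  define r where "r = dist x (a i)"
  define r' where "r' = dist y (a j)"
  have cg: "continuous_on {0..L} \<gamma>"
    unfolding continuous_on_iff using iso by (metis dist_real_def)
  have cD: "continuous_on {0..L} D" unfolding D_def by (intro continuous_intros cg)
  show ?thesis
  proof (cases "\<exists>u\<in>{0..L}. D u \<le> 2 * C")
    case True
    define T where "T = {u\<in>{0..L}. D u \<le> 2 * C}"
    have "T = {0..L} \<inter> D -` {..2 * C}" by (auto simp: T_def)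
    hence "closed T" using cD by (simp add: continuous_closed_preimage)
    moreover have "bounded T" by (rule bounded_subset[of "{0..L}"]) (auto simp: T_def)
    ultimately have "compact T" by (simp add: compact_eq_bounded_closed)
    moreover have "T \<noteq> {}" using True by (auto simp: T_def)
    \<comment> \<open>\<open>s\<close> is the first time at which the geodesic is within
      \<open>2 * C\<close> of the line; the half-speed bound applies up to then.\<close>
    ultimately obtain s where s: "s \<in> T" "\<And>u. u \<in> T \<Longrightarrow> s \<le> u"
      using compact_attains_inf by metis
    have sL: "s \<in> {0..L}" "D s \<le> 2 * C" using s by (auto simp: T_def)
    have before: "D u \<ge> 2 * C" if "u \<in> {0..<s}" for u
      using s(2)[of u] that sL by (force simp: T_def)
    obtain l where l: "l \<in> P (\<gamma> s)" using P_nonempty by blast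
    hence dl: "dist (\<gamma> s) (a l) \<le> 2 * C" using sL by (simp add: P_def D_def)
    have dxs: "dist x (\<gamma> s) = s" using iso[of 0 s] sL g by auto
    show ?thesis
    proof (cases "s \<le> r")
      case True
      hence "dist (a i) (a l) \<le> C" using proj_close[of x "\<gamma> s" i l] ij l dxs r_def by auto
      hence "dist (\<gamma> s) (a i) \<le> 8 * C"
        using dl dist_triangle2[of "\<gamma> s" "a i" "a l"] C_ge1 by linarith
      thus ?thesis using sL g by blast
    next
      case False
      \<comment> \<open>Up to time \<open>r\<close> one contraction suffices, and afterwards the
        projection moves at half speed. Conversely the triangle inequality bounds
        \<open>s - r\<close> by the distance of the projections, and the two inequalities together
        leave at most \<open>6 * C\<close>.\<close>
      have r0: "0 \<le> r" by (simp add: r_def)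
      obtain m where m: "m \<in> P (\<gamma> r)" using P_nonempty by blast
      have "dist x (\<gamma> r) = r" using iso[of 0 r] sL False g r0 by auto
      hence im: "dist (a i) (a m) \<le> C" using proj_close[of x "\<gamma> r" i m] ij m r_def by auto
      have ml: "2 * dist (a m) (a l) \<le> 2 * C + (s - r)"
        by (rule proj_close_path[OF _ _ _ m l])
           (use iso before False sL r0 in \<open>auto simp: D_def\<close>)
      have il: "2 * dist (a i) (a l) \<le> 4 * C + (s - r)"
        using dist_triangle[of "a i" "a l" "a m"] im ml by linarith
      have "dist x (\<gamma> s) \<le> r + dist (a i) (a l) + 2 * C"
        using dist_triangle[of x "\<gamma> s" "a i"] dist_triangle2[of "a i" "\<gamma> s" "a l"] dl
        unfolding r_def by linarith
      hence "s - r \<le> dist (a i) (a l) + 2 * C" unfolding dxs by linarith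
      hence "dist (a i) (a l) \<le> 6 * C" using il by linarith
      hence "dist (\<gamma> s) (a i) \<le> 8 * C"
        using dl dist_triangle2[of "\<gamma> s" "a i" "a l"] by linarith
      thus ?thesis using sL g by blast
    qed
  next
    case False
    hence far: "D u \<ge> 2 * C" if "u \<in> {0..L}" for u using that by force
    have r0: "0 \<le> r" "0 \<le> r'" by (auto simp: r_def r'_def)
    \<comment> \<open>If the geodesic never comes close, the balls about its endpoints with radii
      \<open>r\<close> and \<open>r'\<close> cost one contraction each, and the part between them,
      if any, runs at half speed. This contradicts \<open>large\<close>.\<close>
    have "dist (a i) (a j) \<le> 6 * C"
    proof (cases "r + r' \<ge> L")
      case True
      define v where "v = min r L"
      have v: "v \<in> {0..L}" using r0 L0 by (auto simp: v_def)
      obtain m where m: "m \<in> P (\<gamma> v)" using P_nonempty by blast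
      have "dist x (\<gamma> v) = v" "dist y (\<gamma> v) = L - v"
        using iso[of 0 v] iso[of L v] v g L0 by auto
      moreover have "v \<le> r" "L - v \<le> r'" using True r0 by (auto simp: v_def min_def)
      ultimately have "dist x (\<gamma> v) \<le> dist x (a i)" "dist y (\<gamma> v) \<le> dist y (a j)"
        unfolding r_def r'_def by linarith+
      hence "dist (a i) (a m) \<le> C" "dist (a j) (a m) \<le> C"
        using proj_close[of x "\<gamma> v" i m] proj_close[of y "\<gamma> v" j m] ij m by auto
      thus ?thesis using dist_triangle2[of "a i" "a j" "a m"] C_ge1 by linarith
    next
      case less: False
      define v where "v = L - r'"
      have v: "v \<in> {0..L}" "r \<in> {0..L}" "r \<le> v" using r0 less by (auto simp: v_def)
      obtain m where m: "m \<in> P (\<gamma> r)" using P_nonempty by blast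
      obtain n where n: "n \<in> P (\<gamma> v)" using P_nonempty by blast
      have "dist x (\<gamma> r) = r" "dist y (\<gamma> v) = r'"
        using iso[of 0 r] iso[of L v] v g L0 r0 by (auto simp: v_def)
      hence 1: "dist (a i) (a m) \<le> C" "dist (a j) (a n) \<le> C"
        using proj_close[of x "\<gamma> r" i m] proj_close[of y "\<gamma> v" j n] ij m n
        by (auto simp: r_def r'_def)
      have 2: "2 * dist (a m) (a n) \<le> 2 * C + (v - r)"
        by (rule proj_close_path[OF _ _ _ m n]) (use iso far v in \<open>auto simp: D_def\<close>)
      have "L \<le> r + dist (a i) (a j) + r'"
        using dist_triangle[of x y "a i"] dist_triangle2[of "a i" y "a j"]
        unfolding r_def r'_def L_def by (simp add: dist_commute)
      moreover have "2 * dist (a i) (a j) \<le> 6 * C + (v - r)"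
        using 1 2 dist_triangle[of "a i" "a j" "a m"] dist_triangle2[of "a m" "a j" "a n"]
        by linarith
      ultimately show ?thesis by (simp add: v_def)
    qed
    thus ?thesis using large by simp
  qed
qed

section \<open>The index of the projection as a coarse coordinate\<close>

lemma index_le: "dist (a i) (a j) \<le> r \<Longrightarrow> \<bar>real_of_int (i - j)\<bar> \<le> k * (r + c)"
proof -
  assume "dist (a i) (a j) \<le> r"
  hence "\<bar>real_of_int (i - j)\<bar> / k \<le> r + c" using qi_lower[of i j] by linarith
  thus ?thesis using k_ge1 by (simp add: field_simps)
qed

lemma dist_le_index: "\<bar>real_of_int i\<bar> \<le> r \<Longrightarrow> dist (a i) (a 0) \<le> k * r + c"
proof -
  assume "\<bar>real_of_int i\<bar> \<le> r"
  hence "k * \<bar>real_of_int i\<bar> \<le> k * r" using k_ge1 by (intro mult_left_mono) auto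
  thus ?thesis using qi_upper[of i 0] by simp
qed

text \<open>Both predicates are existential in the nearest index, so that no choice of projection is
  made: at a given threshold every point is \<open>low\<close> or \<open>high\<close>, possibly
  both.\<close>

definition low :: "real \<Rightarrow> 'a \<Rightarrow> bool" where "low r x \<longleftrightarrow> (\<exists>i\<in>P x. \<bar>real_of_int i\<bar> \<le> r)"

definition high :: "real \<Rightarrow> 'a \<Rightarrow> bool" where "high r x \<longleftrightarrow> (\<exists>i\<in>P x. \<bar>real_of_int i\<bar> \<ge> r)"

lemma low_or_high: "low r x \<or> high r x"
  unfolding low_def high_def using P_nonempty[of x] by (meson linorder_le_cases)

lemma low_mono: "low r x \<Longrightarrow> r \<le> r' \<Longrightarrow> low r' x" unfolding low_def by force

lemma high_mono: "high r x \<Longrightarrow> r' \<le> r \<Longrightarrow> high r' x" unfolding high_def by force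

text \<open>Points of the line whose indices are at most \<open>r\<close> and at least
  \<open>sep r\<close> in absolute value are more than \<open>6 * C\<close> apart, as
  \<open>geodesic_near_proj\<close> requires.\<close>

definition sep :: "real \<Rightarrow> real" where "sep r = r + k * (6 * C + 1 + c)"

text \<open>The \<open>8 * C\<close> of \<open>geodesic_near_proj\<close>, plus the distance to
  \<open>a 0\<close> of a point with index at most \<open>r\<close>.\<close>

definition near :: "real \<Rightarrow> real" where "near r = 8 * C + k * r + c"

lemma sep_gt: "r < sep r"
  using C_ge1 k_ge1 c_ge0 by (simp add: sep_def add_pos_nonneg)

lemma near_pos: "r \<ge> 0 \<Longrightarrow> near r > 0"
  using C_ge1 k_ge1 c_ge0 by (simp add: near_def add_pos_nonneg)

lemma low_high_geodesic:
  assumes "low r x" "high (sep r) y" and S: "geodesic_segment x y S"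
  obtains u where "u \<in> S" "dist u (a 0) \<le> near r"
proof -
  obtain i j where ij: "i \<in> P x" "\<bar>real_of_int i\<bar> \<le> r" "j \<in> P y" "\<bar>real_of_int j\<bar> \<ge> sep r"
    using assms unfolding low_def high_def by auto
  have "dist (a i) (a j) > 6 * C"
  proof (rule ccontr)
    assume "\<not> dist (a i) (a j) > 6 * C"
    hence "\<bar>real_of_int (i - j)\<bar> \<le> k * (6 * C + c)" by (intro index_le) simp
    also have "\<dots> < k * (6 * C + 1 + c)" using k_ge1 by simp
    finally show False using ij unfolding sep_def by linarith
  qed
  from geodesic_near_proj[OF S ij(1,3) this] obtain u where u: "u \<in> S" "dist u (a i) \<le> 8 * C" by auto
  have "dist u (a 0) \<le> near r"
    using dist_triangle[of u "a 0" "a i"] u dist_le_index[OF ij(2)] unfolding near_def by linarith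
  thus ?thesis using that u by auto
qed

definition index_lip :: "real \<Rightarrow> real" where "index_lip r = k * (r + 16 * C + c)"

text \<open>If the projections are more than \<open>6 * C\<close> apart, the geodesic comes within
  \<open>8 * C\<close> of both, and two of its points are at most \<open>dist x y\<close>
  apart.\<close>

lemma proj_lipschitz:
  assumes S: "geodesic_segment x y S" and ij: "i \<in> P x" "j \<in> P y"
  shows "dist (a i) (a j) \<le> dist x y + 16 * C"
proof (cases "dist (a i) (a j) \<le> 6 * C")
  case True
  thus ?thesis using C_ge1 zero_le_dist[of x y] by linarith
next
  case False
  obtain u where u: "u \<in> S" "dist u (a i) \<le> 8 * C"
    using geodesic_near_proj[OF S ij] False by auto
  obtain v where v: "v \<in> S" "dist v (a j) \<le> 8 * C"
    using geodesic_near_proj[OF geodesic_segment_sym[OF S] ij(2,1)] False by (auto simp: dist_commute)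
  have "dist u v \<le> dist x y"
    using geodesic_segment_dist_diff[OF S u(1) v(1)] geodesic_segment_dist_add[OF S u(1)]
      geodesic_segment_dist_add[OF S v(1)] zero_le_dist[of u y] zero_le_dist[of v y]
      zero_le_dist[of x u] zero_le_dist[of x v] by linarith
  thus ?thesis using u v dist_triangle[of "a i" "a j" u] dist_triangle[of u "a j" v]
    by (simp add: dist_commute)
qed

lemma low_lipschitz:
  assumes S: "geodesic_segment x y S" and "low r x" "dist x y \<le> t"
  shows "low (r + index_lip t) y"
proof -
  obtain i where i: "i \<in> P x" "\<bar>real_of_int i\<bar> \<le> r" using assms by (auto simp: low_def)
  obtain j where j: "j \<in> P y" using P_nonempty by blast
  have "dist (a i) (a j) \<le> t + 16 * C" using proj_lipschitz[OF S i(1) j] assms by simp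
  hence "\<bar>real_of_int (i - j)\<bar> \<le> index_lip t"
    unfolding index_lip_def by (rule index_le)
  thus ?thesis using i j unfolding low_def by (intro bexI[of _ j]) auto
qed

text \<open>A ball that stays away from the line projects to a set of diameter at most \<open>C\<close>, however large
  the ball is: this makes the gain in the index independent of \<open>dist x y\<close>.\<close>
lemma low_far:
  assumes "low r x" "dist x y \<le> dist x (a 0) - (k * r + c)"
  shows "low (r + k * (C + c)) y"
proof -
  obtain i where i: "i \<in> P x" "\<bar>real_of_int i\<bar> \<le> r" using assms by (auto simp: low_def)
  obtain j where j: "j \<in> P y" using P_nonempty by blast
  have "dist x (a i) \<ge> dist x (a 0) - (k * r + c)"
    using dist_triangle[of x "a 0" "a i"] dist_le_index[OF i(2)] by linarith
  hence "dist (a i) (a j) \<le> C" using proj_close[of x y i j] i j assms by auto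
  hence "\<bar>real_of_int (i - j)\<bar> \<le> k * (C + c)" by (rule index_le)
  thus ?thesis using i j unfolding low_def by (intro bexI[of _ j]) auto
qed

end

section \<open>Quasi-conformal measures and normal subgroups\<close>

abbreviation ginv :: "('a \<Rightarrow> 'b) \<Rightarrow> 'b \<Rightarrow> 'a" where "ginv \<equiv> inv_into UNIV"

text \<open>\<open>F g\<close> stands for the density of the measure based at \<open>g p\<close>
  against \<open>M\<close>, and \<open>U g\<close> for the shadow at \<open>g p\<close>.
  \<open>good u\<close> stands for: \<open>u p\<close> projects near \<open>p\<close>. Thus
  \<open>good (ginv g \<circ> h)\<close> means that geodesics from \<open>h p\<close> into the
  shadow pass near \<open>g p\<close>, which is why \<open>F_shadow\<close> replaces Busemann
  differences by distances to \<open>g p\<close>. The element \<open>s\<close> is a long translation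
  along the axis.\<close>

locale quasi_conformal_action =
  fixes M :: "'b measure" and \<Gamma> :: "('a::metric_space \<Rightarrow> 'a) set"
    and act :: "('a \<Rightarrow> 'a) \<Rightarrow> 'b \<Rightarrow> 'b" and F :: "('a \<Rightarrow> 'a) \<Rightarrow> 'b \<Rightarrow> real"
    and p :: 'a and \<omega> m :: real and U :: "('a \<Rightarrow> 'a) \<Rightarrow> 'b set"
    and good :: "('a \<Rightarrow> 'a) \<Rightarrow> bool" and Z :: "'b set" and s :: "'a \<Rightarrow> 'a"
    and A :: "nat \<Rightarrow> ('a \<Rightarrow> 'a) set" and n0 m0 :: nat and c0 :: real
  assumes finite_M: "finite_measure M"
    and id_in: "id \<in> \<Gamma>"
    and comp_in: "g \<in> \<Gamma> \<Longrightarrow> h \<in> \<Gamma> \<Longrightarrow> g \<circ> h \<in> \<Gamma>"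
    and inv_in: "g \<in> \<Gamma> \<Longrightarrow> ginv g \<in> \<Gamma>"
    and bij_in: "g \<in> \<Gamma> \<Longrightarrow> bij g"
    and isom_in: "g \<in> \<Gamma> \<Longrightarrow> dist (g x) (g y) = dist x y"
    and countable_in: "countable \<Gamma>"
    and act_meas: "g \<in> \<Gamma> \<Longrightarrow> act g \<in> M \<rightarrow>\<^sub>M M"
    and act_id: "\<xi> \<in> space M \<Longrightarrow> act id \<xi> = \<xi>"
    and act_comp: "g \<in> \<Gamma> \<Longrightarrow> h \<in> \<Gamma> \<Longrightarrow> \<xi> \<in> space M \<Longrightarrow> act (g \<circ> h) \<xi> = act g (act h \<xi>)"
    and F_meas: "F g \<in> borel_measurable M"
    and change_var: "g \<in> \<Gamma> \<Longrightarrow> E \<in> sets M \<Longrightarrow>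
       emeasure M E = (\<integral>\<^sup>+\<xi>. ennreal (F (ginv g) \<xi>) * indicator E (act g \<xi>) \<partial>M)"
    and U_sets: "g \<in> \<Gamma> \<Longrightarrow> U g \<in> sets M"
    and U_act: "g \<in> \<Gamma> \<Longrightarrow> h \<in> \<Gamma> \<Longrightarrow> \<xi> \<in> space M \<Longrightarrow> act h \<xi> \<in> U g \<longleftrightarrow> \<xi> \<in> U (ginv h \<circ> g)"
    and Z_sets: "Z \<in> sets M"
    and Z_act: "g \<in> \<Gamma> \<Longrightarrow> \<xi> \<in> Z \<Longrightarrow> act g \<xi> \<in> Z"
    and F_pos: "g \<in> \<Gamma> \<Longrightarrow> \<xi> \<in> Z \<Longrightarrow> F g \<xi> > 0"
    and F_id: "\<xi> \<in> Z \<Longrightarrow> F id \<xi> = 1"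
    and F_cocycle: "g \<in> \<Gamma> \<Longrightarrow> h \<in> \<Gamma> \<Longrightarrow> \<xi> \<in> Z \<Longrightarrow> F h (act g \<xi>) * F (ginv g) \<xi> = F (ginv g \<circ> h) \<xi>"
    and F_lipschitz: "g \<in> \<Gamma> \<Longrightarrow> h \<in> \<Gamma> \<Longrightarrow> \<xi> \<in> Z \<Longrightarrow> F g \<xi> \<le> exp (\<omega> * dist (g p) (h p) + m) * F h \<xi>"
    and F_shadow: "g \<in> \<Gamma> \<Longrightarrow> h \<in> \<Gamma> \<Longrightarrow> h' \<in> \<Gamma> \<Longrightarrow> \<xi> \<in> Z \<Longrightarrow> \<xi> \<in> U g \<Longrightarrow> good (ginv g \<circ> h) \<Longrightarrow>
       good (ginv g \<circ> h') \<Longrightarrow>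
       \<bar>ln (F h \<xi>) - ln (F h' \<xi>) + \<omega> * (dist (h p) (g p) - dist (h' p) (g p))\<bar> \<le> m"
    and good_id: "good id"
    and omega_pos: "\<omega> > 0" and m_ge0: "m \<ge> 0"
    and s_in: "s \<in> \<Gamma>" and U_cover: "\<xi> \<in> Z \<Longrightarrow> \<xi> \<in> U id \<or> act s \<xi> \<in> U id"
    and A_good: "g \<in> A n \<Longrightarrow> g \<in> \<Gamma> \<and> good (ginv g) \<and> dist p (g p) \<le> real n"
    and A_finite: "finite (A n)"
    and c0_pos: "c0 > 0"
    and A_card: "n \<ge> n0 \<Longrightarrow> c0 * exp (\<omega> * real n) \<le> real (card (A n))"
    and A_mult: "\<xi> \<in> Z \<Longrightarrow> card {g \<in> A n. \<xi> \<in> U g} \<le> m0"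
begin

sublocale finite_measure M by (rule finite_M)

lemma inv_comp: "g \<in> \<Gamma> \<Longrightarrow> ginv g \<circ> g = id" "g \<in> \<Gamma> \<Longrightarrow> g \<circ> ginv g = id"
  "g \<in> \<Gamma> \<Longrightarrow> ginv (ginv g) = g"
  using bij_in[of g] by (auto simp: bij_is_inj bij_is_surj surj_f_inv_f inv_inv_eq)

lemma dist_inv: "g \<in> \<Gamma> \<Longrightarrow> dist (h p) ((ginv g) p) = dist ((g \<circ> h) p) p"
  using isom_in[of g "h p" "ginv g p"] bij_in[of g] by (simp add: bij_def surj_f_inv_f)

section \<open>Transport of mass and the size of shadows\<close>

lemma Z_space: "\<xi> \<in> Z \<Longrightarrow> \<xi> \<in> space M"
  using Z_sets sets.sets_into_space by blast

lemma pull_sets: "g \<in> \<Gamma> \<Longrightarrow> E \<in> sets M \<Longrightarrow> Y \<in> sets M \<Longrightarrow> {\<xi>\<in>Y. act g \<xi> \<in> E} \<in> sets M"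
proof -
  assume *: "g \<in> \<Gamma>" "E \<in> sets M" "Y \<in> sets M"
  have "{\<xi>\<in>Y. act g \<xi> \<in> E} = (act g -` E \<inter> space M) \<inter> Y"
    using sets.sets_into_space[OF *(3)] by auto
  thus ?thesis using * measurable_sets[OF act_meas] by auto
qed

text \<open>The Lipschitz bound on the densities holds on all of \<open>Z\<close>, so this estimate
  is available for every \<open>g\<close>. The opposite one, \<open>pull_upper\<close>, has to be
  fed a bound on \<open>F (ginv g)\<close>.\<close>

lemma pull_lower:
  assumes "g \<in> \<Gamma>" "E \<in> sets M" "Y \<in> sets M" "Y \<subseteq> Z"
  shows "exp (- \<omega> * dist p (g p) - m) * measure M {\<xi>\<in>Y. act g \<xi> \<in> E} \<le> measure M E"
proof -
  let ?l = "exp (- \<omega> * dist p (g p) - m)" and ?B = "{\<xi>\<in>Y. act g \<xi> \<in> E}"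
  have B: "?B \<in> sets M" using assms pull_sets by auto
  have low: "?l \<le> F (ginv g) \<xi>" if "\<xi> \<in> Z" for \<xi>
  proof -
    have "1 \<le> exp (\<omega> * dist p (g p) + m) * F (ginv g) \<xi>"
      using F_lipschitz[OF id_in inv_in[OF assms(1)] that] F_id[OF that] dist_inv[OF assms(1), of id]
      by (simp add: dist_commute)
    hence "?l * 1 \<le> ?l * (exp (\<omega> * dist p (g p) + m) * F (ginv g) \<xi>)" by (intro mult_left_mono) auto
    also have "\<dots> = F (ginv g) \<xi>" by (simp add: mult.assoc[symmetric] exp_add[symmetric])
    finally show ?thesis by simp
  qed
  have "ennreal (?l * measure M ?B) = (\<integral>\<^sup>+\<xi>. ennreal ?l * indicator ?B \<xi> \<partial>M)"
    using B by (simp add: nn_integral_cmult_indicator emeasure_eq_measure ennreal_mult)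
  also have "\<dots> \<le> (\<integral>\<^sup>+\<xi>. ennreal (F (ginv g) \<xi>) * indicator E (act g \<xi>) \<partial>M)"
    using low assms(4) by (intro nn_integral_mono) (auto simp: indicator_def intro!: ennreal_leI)
  also have "\<dots> = ennreal (measure M E)"
    using change_var[OF assms(1,2)] by (simp add: emeasure_eq_measure)
  finally show ?thesis by (simp add: ennreal_le_iff)
qed

lemma pull_upper:
  assumes "g \<in> \<Gamma>" "E \<in> sets M" "B \<in> sets M" "\<And>\<xi>. \<xi> \<in> space M \<Longrightarrow> act g \<xi> \<in> E \<Longrightarrow> \<xi> \<in> B"
    and "\<And>\<xi>. \<xi> \<in> B \<Longrightarrow> F (ginv g) \<xi> \<le> u" "u \<ge> 0"
  shows "measure M E \<le> u * measure M B"
proof -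
  have "ennreal (measure M E) = (\<integral>\<^sup>+\<xi>. ennreal (F (ginv g) \<xi>) * indicator E (act g \<xi>) \<partial>M)"
    using change_var[OF assms(1,2)] by (simp add: emeasure_eq_measure)
  also have "\<dots> \<le> (\<integral>\<^sup>+\<xi>. ennreal u * indicator B \<xi> \<partial>M)"
    using assms(4,5) by (intro nn_integral_mono) (auto simp: indicator_def intro!: ennreal_leI)
  also have "\<dots> = ennreal (u * measure M B)"
    using assms by (simp add: nn_integral_cmult_indicator emeasure_eq_measure ennreal_mult)
  finally show ?thesis using assms(6) by (simp add: ennreal_le_iff)
qed

definition invariant :: "'b set \<Rightarrow> bool" where
  "invariant Y \<longleftrightarrow> Y \<in> sets M \<and> Y \<subseteq> Z \<and> (\<forall>g\<in>\<Gamma>. \<forall>\<xi>\<in>Y. act g \<xi> \<in> Y)"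

lemma invariant_iff:
  assumes "invariant Y" "g \<in> \<Gamma>" "\<xi> \<in> space M"
  shows "act g \<xi> \<in> Y \<longleftrightarrow> \<xi> \<in> Y"
proof
  assume "act g \<xi> \<in> Y"
  hence "act (ginv g) (act g \<xi>) \<in> Y" using assms inv_in by (auto simp: invariant_def)
  thus "\<xi> \<in> Y" using act_comp[OF inv_in[OF assms(2)] assms(2,3)] act_id assms inv_comp by simp
qed (use assms in \<open>auto simp: invariant_def\<close>)

lemma shadow_lower:
  assumes Y: "invariant Y" and g: "g \<in> \<Gamma>"
  shows "exp (- \<omega> * dist p (g p) - m) * measure M (U id \<inter> Y) \<le> measure M (U g \<inter> Y)"
proof -
  have "U id \<inter> Y = {\<xi>\<in>Y. act g \<xi> \<in> U g \<inter> Y}"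
    using Y g U_act[OF g g] inv_comp[OF g] Z_space by (auto simp: invariant_def)
  thus ?thesis using pull_lower[OF g, of "U g \<inter> Y" Y] Y U_sets[OF g] by (auto simp: invariant_def)
qed

text \<open>\<open>F_shadow\<close> at the identity, comparing \<open>ginv g p\<close> with
  \<open>p\<close>: goodness changes the exponent of the Lipschitz bound from plus to minus
  \<open>\<omega> * dist p (g p)\<close>.\<close>

lemma F_inv_upper:
  assumes g: "g \<in> \<Gamma>" "good (ginv g)" and x: "\<xi> \<in> U id" "\<xi> \<in> Z"
  shows "F (ginv g) \<xi> \<le> exp (m - \<omega> * dist p (g p))"
proof -
  have d: "dist (ginv g p) p = dist p (g p)" using dist_inv[OF g(1), of id] by (simp add: dist_commute)
  have "\<bar>ln (F (ginv g) \<xi>) - ln (F id \<xi>) + \<omega> * (dist (ginv g p) (id p) - dist (id p) (id p))\<bar> \<le> m"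
    by (rule F_shadow[OF id_in inv_in[OF g(1)] id_in x(2,1)]) (simp_all only: inv_id id_comp g good_id)
  hence "ln (F (ginv g) \<xi>) \<le> m - \<omega> * dist p (g p)" using F_id[OF x(2)] d by auto
  thus ?thesis using F_pos[OF inv_in[OF g(1)] x(2)] by (metis exp_le_cancel_iff exp_ln)
qed

text \<open>Together with \<open>shadow_lower\<close> this determines the mass of the shadow in
  \<open>Y\<close> up to a factor \<open>exp (2 * m)\<close>.\<close>

lemma shadow_upper:
  assumes Y: "invariant Y" and g: "g \<in> \<Gamma>" "good (ginv g)"
  shows "measure M (U g \<inter> Y) \<le> exp (m - \<omega> * dist p (g p)) * measure M (U id \<inter> Y)"
proof (rule pull_upper[OF g(1)])
  fix \<xi> assume "\<xi> \<in> space M" "act g \<xi> \<in> U g \<inter> Y"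
  thus "\<xi> \<in> U id \<inter> Y"
    using U_act[OF g(1) g(1)] inv_comp[OF g(1)] invariant_iff[OF Y g(1)] by auto
qed (use Y g U_sets id_in F_inv_upper in \<open>auto simp: invariant_def\<close>)

text \<open>Each point of \<open>E\<close> lies in \<open>U id\<close> or is moved into it by
  \<open>s\<close>. There are two sets because the lemma is later applied to a set that is not
  invariant, which \<open>s\<close> moves only into a larger one.\<close>

lemma U_id_positive:
  assumes Y: "invariant Y" and E: "E \<in> sets M" "E' \<in> sets M" "E \<subseteq> Y" "measure M E > 0"
    and shift: "\<And>\<xi>. \<xi> \<in> E \<Longrightarrow> \<xi> \<in> E' \<and> act s \<xi> \<in> E'"
  shows "measure M (U id \<inter> E') > 0"
proof (rule ccontr)
  assume "\<not> ?thesis"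
  hence 0: "measure M (U id \<inter> E') = 0" by (simp add: zero_less_measure_iff)
  have sets: "U id \<inter> E' \<in> sets M" using U_sets[OF id_in] E by auto
  define B where "B = {\<xi>\<in>E. act s \<xi> \<in> U id \<inter> E'}"
  have B: "B \<in> sets M" unfolding B_def using pull_sets[OF s_in sets E(1)] .
  have "exp (- \<omega> * dist p (s p) - m) * measure M B \<le> 0"
    using pull_lower[OF s_in sets E(1)] E Y 0 unfolding B_def by (auto simp: invariant_def)
  hence B0: "measure M B = 0"
    by (metis exp_gt_zero less_eq_real_def mult_pos_pos not_le zero_less_measure_iff)
  have "E \<subseteq> (U id \<inter> E') \<union> B"
    using U_cover shift E Y by (auto simp: B_def invariant_def)
  hence "measure M E \<le> measure M ((U id \<inter> E') \<union> B)" using sets B by (intro finite_measure_mono) auto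
  also have "\<dots> \<le> measure M (U id \<inter> E') + measure M B" by (rule measure_Un_le[OF sets B])
  finally show False using E 0 B0 by simp
qed

lemma U_id_invariant_positive:
  assumes Y: "invariant Y" "measure M Y > 0"
  shows "measure M (U id \<inter> Y) > 0"
  by (rule U_id_positive[OF Y(1), of Y]) (use Y s_in in \<open>auto simp: invariant_def\<close>)

text \<open>Integration of the number of shadows that contain a point, which is at most
  \<open>m0\<close> on \<open>Z\<close>.\<close>

lemma multiplicity:
  assumes G: "G \<subseteq> A n" and D: "D \<in> sets M" "D \<subseteq> Z"
  shows "(\<Sum>g\<in>G. measure M (U g \<inter> D)) \<le> real m0 * measure M (D \<inter> (\<Union>g\<in>G. U g))"
proof -
  have fin: "finite G" using G A_finite finite_subset by blast
  have sets: "U g \<inter> D \<in> sets M" if "g \<in> G" for g using that G A_good U_sets D by auto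
  have DU: "D \<inter> (\<Union>g\<in>G. U g) \<in> sets M" using fin G A_good U_sets D by (intro sets.Int sets.finite_UN) auto
  have pt: "(\<Sum>g\<in>G. indicat_real (U g \<inter> D) \<xi>) \<le> real m0 * indicat_real (D \<inter> (\<Union>g\<in>G. U g)) \<xi>" for \<xi>
  proof (cases "\<xi> \<in> D \<inter> (\<Union>g\<in>G. U g)")
    case True
    have "(\<Sum>g\<in>G. indicat_real (U g \<inter> D) \<xi>) = real (card {g\<in>G. \<xi> \<in> U g})"
      using True fin by (simp add: indicator_def sum.If_cases Int_def)
    also have "card {g\<in>G. \<xi> \<in> U g} \<le> card {g\<in>A n. \<xi> \<in> U g}"
      using G A_finite by (intro card_mono) auto
    also have "\<dots> \<le> m0" using A_mult True D by auto
    finally show ?thesis using True by simp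
  qed (auto simp: indicator_def intro!: sum_nonpos)
  have "(\<Sum>g\<in>G. measure M (U g \<inter> D)) = (\<Sum>g\<in>G. \<integral>\<xi>. indicat_real (U g \<inter> D) \<xi> \<partial>M)"
    using sets by (intro sum.cong) (auto simp: sets.sets_into_space Int_absorb2)
  also have "\<dots> = (\<integral>\<xi>. (\<Sum>g\<in>G. indicat_real (U g \<inter> D) \<xi>) \<partial>M)"
    using sets by (subst Bochner_Integration.integral_sum)
      (auto simp: integrable_indicator_iff emeasure_eq_measure)
  also have "\<dots> \<le> (\<integral>\<xi>. real m0 * indicat_real (D \<inter> (\<Union>g\<in>G. U g)) \<xi> \<partial>M)"
  proof (rule integral_mono[OF _ _ pt])
    show "integrable M (\<lambda>\<xi>. \<Sum>g\<in>G. indicat_real (U g \<inter> D) \<xi>)"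
      using sets by (intro Bochner_Integration.integrable_sum)
        (auto simp: integrable_indicator_iff emeasure_eq_measure)
    show "integrable M (\<lambda>\<xi>. real m0 * indicat_real (D \<inter> (\<Union>g\<in>G. U g)) \<xi>)"
      using DU by (intro integrable_mult_right) (auto simp: integrable_indicator_iff emeasure_eq_measure)
  qed
  also have "\<dots> = real m0 * measure M (D \<inter> (\<Union>g\<in>G. U g))"
    using DU by (simp add: sets.sets_into_space Int_absorb2)
  finally show ?thesis .
qed

text \<open>The number of elements, of order \<open>exp (\<omega> * real n)\<close>, cancels the
  decay of the mass of a single shadow, so \<open>\<kappa>\<close> does not depend on
  \<open>n\<close>.\<close>

lemma shadows_lower_bound:
  assumes Y: "invariant Y" "measure M Y > 0"
  obtains \<kappa> where "\<kappa> > 0" "\<And>n. n \<ge> n0 \<Longrightarrow> \<kappa> \<le> measure M (Y \<inter> (\<Union>g\<in>A n. U g))"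
proof -
  define v where "v = measure M (U id \<inter> Y)"
  have v: "v > 0" using U_id_invariant_positive[OF Y] by (simp add: v_def)
  have YZ: "Y \<in> sets M" "Y \<subseteq> Z" using Y by (auto simp: invariant_def)
  have main: "c0 * exp (- m) * v \<le> real m0 * measure M (Y \<inter> (\<Union>g\<in>A n. U g))" if n: "n \<ge> n0" for n
  proof -
    have each: "exp (- \<omega> * real n - m) * v \<le> measure M (U g \<inter> Y)" if "g \<in> A n" for g
    proof -
      have "exp (- \<omega> * real n - m) \<le> exp (- \<omega> * dist p (g p) - m)"
        using A_good[OF that] omega_pos by (simp add: mult_left_mono)
      hence "exp (- \<omega> * real n - m) * v \<le> exp (- \<omega> * dist p (g p) - m) * v"
        using v by (intro mult_right_mono) auto
      thus ?thesis using shadow_lower[OF Y(1), of g] A_good[OF that] by (auto simp: v_def)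
    qed
    have "c0 * exp (- m) * v = (c0 * exp (\<omega> * real n)) * (exp (- \<omega> * real n - m) * v)"
      by (simp add: exp_diff exp_minus field_simps)
    also have "\<dots> \<le> real (card (A n)) * (exp (- \<omega> * real n - m) * v)"
      using A_card[OF n] v by (intro mult_right_mono) auto
    also have "\<dots> \<le> (\<Sum>g\<in>A n. measure M (U g \<inter> Y))" using each by (intro sum_bounded_below) auto
    also have "\<dots> \<le> real m0 * measure M (Y \<inter> (\<Union>g\<in>A n. U g))"
      using multiplicity[of "A n" n Y] YZ by auto
    finally show ?thesis .
  qed
  have pos: "c0 * exp (- m) * v > 0" using c0_pos v by simp
  hence "m0 > 0" using main[of n0] by (cases "m0 = 0") auto
  thus ?thesis using pos main
    by (intro that[of "c0 * exp (- m) * v / real m0"]) (auto simp: field_simps)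
qed

end

text \<open>\<open>H_long\<close> supplies points with a large density.
  \<open>A_eventually_good\<close> says that a distant \<open>g p\<close> sees \<open>h p\<close> as
  it sees \<open>p\<close>, so that \<open>F h\<close> is nearly constant on its shadow.\<close>

locale quasi_conformal_normal_subgroup =
  quasi_conformal_action M \<Gamma> act F p \<omega> m U good Z s A n0 m0 c0
  for M :: "'b measure" and \<Gamma> :: "('a::metric_space \<Rightarrow> 'a) set"
    and act F p \<omega> m U good Z s A n0 m0 c0 +
  fixes H :: "('a \<Rightarrow> 'a) set"
  assumes H_sub: "H \<subseteq> \<Gamma>"
    and H_conj: "g \<in> \<Gamma> \<Longrightarrow> h \<in> H \<Longrightarrow> g \<circ> h \<circ> ginv g \<in> H"
    and H_long: "\<exists>h\<in>H. dist p (h p) \<ge> L \<and> good (ginv h)"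
    and A_eventually_good: "h \<in> H \<Longrightarrow> \<exists>n1. \<forall>n\<ge>n1. \<forall>g\<in>A n. good (ginv g \<circ> h)"
begin

definition E :: "real \<Rightarrow> 'b set" where "E r = {\<xi>\<in>Z. \<forall>h\<in>H. F h \<xi> \<le> exp r}"

definition T :: "'b set" where "T = (\<Union>n::nat. E (real n))"

section \<open>The points at which the densities of the subgroup are bounded\<close>

lemma H_countable: "countable H" using H_sub countable_in countable_subset by blast

lemma E_sets: "E r \<in> sets M"
proof -
  have "{\<xi>\<in>Z. F h \<xi> \<le> exp r} \<in> sets M" for h
  proof -
    have "{\<xi>\<in>space M. F h \<xi> \<le> exp r} \<in> sets M" using F_meas[of h] by measurable
    moreover have "{\<xi>\<in>Z. F h \<xi> \<le> exp r} = Z \<inter> {\<xi>\<in>space M. F h \<xi> \<le> exp r}" using Z_space by auto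
    ultimately show ?thesis using Z_sets by auto
  qed
  moreover have "H \<noteq> {}" using H_long by auto
  moreover have "E r = (\<Inter>h\<in>H. {\<xi>\<in>Z. F h \<xi> \<le> exp r})" using \<open>H \<noteq> {}\<close> by (auto simp: E_def)
  ultimately show ?thesis using H_countable by (auto intro!: sets.countable_INT')
qed

lemma E_mono: "r \<le> r' \<Longrightarrow> E r \<subseteq> E r'"
  unfolding E_def using order_trans[OF _ exp_le_cancel_iff[THEN iffD2]] by blast

lemma E_subset_T: "E r \<subseteq> T"
proof
  fix \<xi> assume "\<xi> \<in> E r"
  moreover obtain n :: nat where "r \<le> real n" using real_arch_simple by blast
  ultimately show "\<xi> \<in> T" using E_mono[of r "real n"] by (auto simp: T_def)
qed

text \<open>By the cocycle relation the density in question is the quotient of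
  \<open>F (h \<circ> ginv g) \<xi>\<close> by \<open>F (ginv g) \<xi>\<close>, and
  \<open>h \<circ> ginv g\<close> moves \<open>p\<close> to a point at distance
  \<open>dist p (g p)\<close> from \<open>h p\<close>. The bound \<open>b\<close> is a parameter
  because it decides the outcome: the general bound doubles the loss
  \<open>\<omega> * dist p (g p)\<close>, whereas that of \<open>F_inv_upper\<close> cancels
  it.\<close>

lemma shift_conj:
  assumes "\<xi> \<in> Z" "h \<in> H" "g \<in> \<Gamma>" "F h \<xi> > exp r" "F (ginv g) \<xi> \<le> exp b"
  shows "F (g \<circ> h \<circ> ginv g) (act g \<xi>) > exp (r - \<omega> * dist p (g p) - m - b)"
proof -
  have h: "h \<in> \<Gamma>" using assms H_sub by auto
  have ig: "ginv g \<in> \<Gamma>" using assms inv_in by auto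
  let ?h = "g \<circ> h \<circ> ginv g"
  have "ginv g \<circ> ?h = h \<circ> ginv g" using inv_comp(1)[OF assms(3)] by (metis comp_assoc id_comp)
  hence co: "F ?h (act g \<xi>) * F (ginv g) \<xi> = F (h \<circ> ginv g) \<xi>"
    using F_cocycle[OF assms(3) _ assms(1), of ?h] comp_in assms(3) h ig by auto
  have d: "dist (h p) ((h \<circ> ginv g) p) = dist p (g p)"
    using isom_in[OF h, of p "ginv g p"] dist_inv[OF assms(3), of id] by (simp add: dist_commute)
  have "exp r < exp (\<omega> * dist p (g p) + m) * F (h \<circ> ginv g) \<xi>"
    using F_lipschitz[OF h comp_in[OF h ig] assms(1)] assms(4) d by auto
  hence "exp r < exp (\<omega> * dist p (g p) + m) * (F ?h (act g \<xi>) * F (ginv g) \<xi>)" unfolding co .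
  also have "\<dots> \<le> exp (\<omega> * dist p (g p) + m) * (F ?h (act g \<xi>) * exp b)"
    using assms F_pos[of ?h "act g \<xi>"] comp_in h ig Z_act by (intro mult_left_mono) auto
  finally have "exp r < exp (\<omega> * dist p (g p) + m + b) * F ?h (act g \<xi>)" by (simp add: exp_add mult_ac)
  hence "exp (- (\<omega> * dist p (g p) + m + b)) * exp r <
      exp (- (\<omega> * dist p (g p) + m + b)) * (exp (\<omega> * dist p (g p) + m + b) * F ?h (act g \<xi>))"
    by (intro mult_strict_left_mono) auto
  also have "\<dots> = F ?h (act g \<xi>)" by (simp add: mult.assoc[symmetric] exp_add[symmetric])
  also have "exp (- (\<omega> * dist p (g p) + m + b)) * exp r = exp (r - \<omega> * dist p (g p) - m - b)"
    by (simp add: exp_add[symmetric] algebra_simps)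
  finally show ?thesis .
qed

lemma F_inv_le:
  assumes "\<xi> \<in> Z" "g \<in> \<Gamma>"
  shows "F (ginv g) \<xi> \<le> exp (\<omega> * dist p (g p) + m)"
  using F_lipschitz[OF inv_in[OF assms(2)] id_in assms(1)] F_id[OF assms(1)] dist_inv[OF assms(2), of id]
  by (simp add: dist_commute)

lemma shift_not_E:
  assumes "\<xi> \<in> Z" "\<xi> \<notin> E (r + 2 * \<omega> * dist p (g p) + 2 * m)" "g \<in> \<Gamma>"
  shows "act g \<xi> \<notin> E r"
proof -
  obtain h where h: "h \<in> H" "F h \<xi> > exp (r + 2 * \<omega> * dist p (g p) + 2 * m)"
    using assms by (auto simp: E_def not_le)
  show ?thesis using shift_conj[OF assms(1) h(1) assms(3) h(2) F_inv_le[OF assms(1,3)]] H_conj[OF assms(3) h(1)]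
    by (auto simp: E_def not_le algebra_simps intro!: bexI[of _ "g \<circ> h \<circ> ginv g"])
qed

lemma invariant_T: "invariant T"
  unfolding invariant_def
proof (intro conjI ballI)
  show "T \<in> sets M" using E_sets by (auto simp: T_def)
  show "T \<subseteq> Z" by (auto simp: T_def E_def)
next
  fix g \<xi> assume g: "g \<in> \<Gamma>" and "\<xi> \<in> T"
  then obtain r where r: "\<xi> \<in> E r" by (auto simp: T_def)
  hence x: "\<xi> \<in> Z" by (simp add: E_def)
  have eq: "act (ginv g) (act g \<xi>) = \<xi>"
    using act_comp[OF inv_in[OF g] g Z_space[OF x]] inv_comp[OF g] act_id Z_space[OF x] by simp
  \<comment> \<open>The contrapositive of \<open>shift_not_E\<close> for the inverse of
    \<open>g\<close>; the increase of the bound does not matter in the union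
    \<open>T\<close>.\<close>
  have "act g \<xi> \<in> E (r + 2 * \<omega> * dist p (ginv g p) + 2 * m)"
    using shift_not_E[of "act g \<xi>" r "ginv g"] Z_act[OF g x] inv_in[OF g] eq r by auto
  thus "act g \<xi> \<in> T" using E_subset_T by blast
qed

text \<open>The shadow of a long \<open>h\<close> in \<open>H\<close> has positive mass, and
  \<open>F h\<close> is so large on it that it misses \<open>E r'\<close>. The translation
  \<open>s\<close> then brings positive mass into \<open>U id\<close>.\<close>

lemma U_id_not_E:
  assumes "measure M T > 0"
  shows "measure M (U id \<inter> (T - E r)) > 0"
proof -
  \<comment> \<open>\<open>r'\<close> exceeds \<open>r\<close> by the loss of
    \<open>shift_not_E\<close> under \<open>s\<close>.\<close>
  define r' where "r' = r + 2 * \<omega> * dist p (s p) + 2 * m"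
  have r': "r \<le> r'" using omega_pos m_ge0 by (simp add: r'_def)
  obtain h where h: "h \<in> H" "dist p (h p) \<ge> (r' + m + 1) / \<omega>" "good (ginv h)"
    using H_long by blast
  have hG: "h \<in> \<Gamma>" using h H_sub by auto
  have long: "\<omega> * dist p (h p) \<ge> r' + m + 1" using h(2) omega_pos by (simp add: field_simps)
  have sub: "U h \<inter> T \<subseteq> T - E r'"
  proof
    fix \<xi> assume x: "\<xi> \<in> U h \<inter> T"
    hence xZ: "\<xi> \<in> Z" using invariant_T by (auto simp: invariant_def)
    \<comment> \<open>\<open>h p\<close> is the centre of its own shadow, so the first distance
      vanishes.\<close>
    have "\<bar>ln (F h \<xi>) - ln (F id \<xi>) + \<omega> * (dist (h p) (h p) - dist (id p) (h p))\<bar> \<le> m"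
      by (rule F_shadow[OF hG hG id_in xZ])
        (use x in \<open>simp_all only: inv_comp(1)[OF hG] comp_id h good_id Int_iff\<close>)
    hence "ln (F h \<xi>) > r'" using F_id[OF xZ] long by auto
    hence "F h \<xi> > exp r'" using F_pos[OF hG xZ] by (metis exp_less_cancel_iff exp_ln)
    thus "\<xi> \<in> T - E r'" using x h by (force simp: E_def)
  qed
  have "0 < exp (- \<omega> * dist p (h p) - m) * measure M (U id \<inter> T)"
    using U_id_invariant_positive[OF invariant_T assms] by simp
  also have "\<dots> \<le> measure M (U h \<inter> T)" by (rule shadow_lower[OF invariant_T hG])
  also have "\<dots> \<le> measure M (T - E r')"
    using sub invariant_T E_sets by (intro finite_measure_mono) (auto simp: invariant_def)
  finally have pos: "measure M (T - E r') > 0" .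
  show ?thesis
  proof (rule U_id_positive[OF invariant_T _ _ _ pos])
    fix \<xi> assume x: "\<xi> \<in> T - E r'"
    hence xZ: "\<xi> \<in> Z" using invariant_T by (auto simp: invariant_def)
    have "act s \<xi> \<notin> E r" using shift_not_E[OF xZ _ s_in, of r] x by (auto simp: r'_def)
    thus "\<xi> \<in> T - E r \<and> act s \<xi> \<in> T - E r"
      using x E_mono[OF r'] invariant_T s_in by (auto simp: invariant_def)
  qed (use invariant_T E_sets in \<open>auto simp: invariant_def\<close>)
qed

text \<open>Conjugation by \<open>g\<close> preserves \<open>H\<close>, and for good
  \<open>g\<close> the lengths cancel in \<open>shift_conj\<close>: points of the fixed shadow
  \<open>U id\<close> outside \<open>E (r + 2 * m)\<close> are carried outside \<open>E r\<close>,
  however long \<open>g\<close> is. Comparing the masses of the two shadows gives a proportion that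
  does not depend on \<open>g\<close>.\<close>

lemma shadow_not_E:
  assumes "measure M T > 0"
  obtains \<delta> where "\<delta> > 0"
    "\<And>g. g \<in> \<Gamma> \<Longrightarrow> good (ginv g) \<Longrightarrow> \<delta> * measure M (U g \<inter> T) \<le> measure M (U g \<inter> (T - E r))"
proof -
  define w where "w = measure M (U id \<inter> (T - E (r + 2 * m)))"
  define v where "v = measure M (U id \<inter> T)"
  have w: "w > 0" using U_id_not_E[OF assms] by (simp add: w_def)
  have v: "v > 0" using U_id_invariant_positive[OF invariant_T assms] by (simp add: v_def)
  have TS: "T \<in> sets M" "T \<subseteq> Z" using invariant_T by (auto simp: invariant_def)
  show ?thesis
  proof (rule that[of "exp (- 2 * m) * w / v"])
    fix g assume g: "g \<in> \<Gamma>" "good (ginv g)"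
    let ?d = "\<omega> * dist p (g p)"
    have "U id \<inter> (T - E (r + 2 * m)) \<subseteq> {\<xi>\<in>T. act g \<xi> \<in> U g \<inter> (T - E r)}"
    proof
      fix \<xi> assume x: "\<xi> \<in> U id \<inter> (T - E (r + 2 * m))"
      hence xZ: "\<xi> \<in> Z" using TS by auto
      obtain h where h: "h \<in> H" "F h \<xi> > exp (r + 2 * m)" using x xZ by (auto simp: E_def not_le)
      have "F (ginv g) \<xi> \<le> exp (m - ?d)" using F_inv_upper[OF g] x xZ by auto
      from shift_conj[OF xZ h(1) g(1) h(2) this]
      have "act g \<xi> \<notin> E r" using H_conj[OF g(1) h(1)]
        by (auto simp: E_def not_le intro!: bexI[of _ "g \<circ> h \<circ> ginv g"])
      moreover have "act g \<xi> \<in> U g" using U_act[OF g(1) g(1) Z_space[OF xZ]] inv_comp[OF g(1)] x by simp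
      moreover have "act g \<xi> \<in> T" using invariant_T g x by (auto simp: invariant_def)
      ultimately show "\<xi> \<in> {\<xi>\<in>T. act g \<xi> \<in> U g \<inter> (T - E r)}" using x by auto
    qed
    hence "w \<le> measure M {\<xi>\<in>T. act g \<xi> \<in> U g \<inter> (T - E r)}"
      unfolding w_def using g TS E_sets U_sets by (intro finite_measure_mono pull_sets) auto
    hence "exp (- \<omega> * dist p (g p) - m) * w \<le> exp (- \<omega> * dist p (g p) - m) * measure M {\<xi>\<in>T. act g \<xi> \<in> U g \<inter> (T - E r)}"
      by (intro mult_left_mono) auto
    also have "\<dots> \<le> measure M (U g \<inter> (T - E r))"
      by (rule pull_lower) (use g TS E_sets U_sets in auto)
    finally have 1: "exp (- \<omega> * dist p (g p) - m) * w \<le> measure M (U g \<inter> (T - E r))" .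
    have "measure M (U g \<inter> T) \<le> exp (m - ?d) * v"
      unfolding v_def by (rule shadow_upper[OF invariant_T g])
    hence "exp (- 2 * m) * w / v * measure M (U g \<inter> T) \<le> exp (- 2 * m) * w / v * (exp (m - ?d) * v)"
      using w v by (intro mult_left_mono) auto
    also have "\<dots> = (exp (- 2 * m) * exp (m - ?d)) * w" using v by simp
    also have "exp (- 2 * m) * exp (m - ?d) = exp (- \<omega> * dist p (g p) - m)" by (simp add: exp_add[symmetric])
    finally show "exp (- 2 * m) * w / v * measure M (U g \<inter> T) \<le> measure M (U g \<inter> (T - E r))"
      using 1 by linarith
  qed (use w v in auto)
qed

text \<open>Instead of a Lebesgue density theorem: the set \<open>E r\<close> is almost determined by finitely many
  elements of \<open>H\<close>, and the densities of these hardly vary on shadows of distant elements.  So the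
  shadows of length \<open>n\<close> meeting \<open>E r\<close>, which have a definite total mass, lie almost entirely in
  \<open>E (r + 2 * m)\<close>.\<close>
theorem measure_T: "measure M T = 0"
proof (rule ccontr)
  assume "measure M T \<noteq> 0"
  hence pos: "measure M T > 0" by (simp add: zero_less_measure_iff)
  have TS: "T \<in> sets M" "T \<subseteq> Z" using invariant_T by (auto simp: invariant_def)
  obtain \<kappa> where k: "\<kappa> > 0" "\<And>n. n \<ge> n0 \<Longrightarrow> \<kappa> \<le> measure M (T \<inter> (\<Union>g\<in>A n. U g))"
    using shadows_lower_bound[OF invariant_T pos] by blast
  have "(\<lambda>n. measure M (E (real n))) \<longlonglongrightarrow> measure M T"
    unfolding T_def using E_sets E_mono by (intro finite_Lim_measure_incseq) (auto simp: incseq_def)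
  moreover have "measure M T - \<kappa> / 2 < measure M T" using k by simp
  ultimately have "eventually (\<lambda>n. measure M T - \<kappa> / 2 < measure M (E (real n))) sequentially"
    by (rule order_tendstoD(1))
  \<comment> \<open>\<open>E r\<close> misses less than half of the mass \<open>\<kappa>\<close>, so
    the shadows that meet it carry more than the other half.\<close>
  then obtain n where n: "measure M T - \<kappa> / 2 < measure M (E (real n))"
    by (auto simp: eventually_sequentially)
  define r where "r = real n"
  define r' where "r' = r + 2 * m"
  have TE: "measure M (T - E r) < \<kappa> / 2"
    using n E_subset_T TS E_sets by (subst finite_measure_Diff) (auto simp: r_def)
  obtain \<delta> where d: "\<delta> > 0"
    "\<And>g. g \<in> \<Gamma> \<Longrightarrow> good (ginv g) \<Longrightarrow> \<delta> * measure M (U g \<inter> T) \<le> measure M (U g \<inter> (T - E r'))"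
    using shadow_not_E[OF pos, of r'] by blast
  have Hne: "H \<noteq> {}" using H_long by auto
  define e where "e = from_nat_into H"
  have eH: "e i \<in> H" for i using Hne by (simp add: e_def from_nat_into)
  \<comment> \<open>Since \<open>e\<close> enumerates \<open>H\<close>, these sets decrease to the
    empty set, and their measure falls below the threshold of the final contradiction.\<close>
  define D where "D = (\<lambda>j::nat. {\<xi>\<in>T. \<forall>i\<le>j. F (e i) \<xi> \<le> exp r'} - E r')"
  have D_sets: "D j \<in> sets M" for j
  proof -
    have "{\<xi>\<in>space M. \<forall>i\<le>j. F (e i) \<xi> \<le> exp r'} \<in> sets M" using F_meas by measurable
    hence "T \<inter> {\<xi>\<in>space M. \<forall>i\<le>j. F (e i) \<xi> \<le> exp r'} - E r' \<in> sets M"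
      by (intro sets.Diff sets.Int TS E_sets)
    moreover have "D j = T \<inter> {\<xi>\<in>space M. \<forall>i\<le>j. F (e i) \<xi> \<le> exp r'} - E r'"
      using TS Z_space by (auto simp: D_def)
    ultimately show ?thesis by simp
  qed
  have "(\<Inter>j. D j) = {}"
  proof (rule ccontr)
    assume "(\<Inter>j. D j) \<noteq> {}"
    then obtain \<xi> where x: "\<xi> \<in> D j" for j by blast
    have "F h \<xi> \<le> exp r'" if hH: "h \<in> H" for h
    proof -
      obtain i where "e i = h"
        using from_nat_into_surj[OF H_countable hH] unfolding e_def by blast
      thus ?thesis using x[of i] by (auto simp: D_def)
    qed
    thus False using x[of 0] TS by (auto simp: D_def E_def)
  qed
  moreover have "decseq D"
    unfolding decseq_def
  proof (intro allI impI subsetI)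
    fix i j \<xi> assume "i \<le> j" "\<xi> \<in> D j"
    thus "\<xi> \<in> D i" by (simp add: D_def)
  qed
  hence "(\<lambda>j. measure M (D j)) \<longlonglongrightarrow> measure M (\<Inter>j. D j)"
    by (intro finite_Lim_measure_decseq image_subsetI D_sets)
  ultimately have "(\<lambda>j. measure M (D j)) \<longlonglongrightarrow> 0" by simp
  hence "(\<lambda>j. real m0 * measure M (D j)) \<longlonglongrightarrow> real m0 * 0"
    by (rule tendsto_mult_left)
  moreover have "real m0 * 0 < \<delta> * \<kappa> / 2" using d k by simp
  ultimately have "eventually (\<lambda>j. real m0 * measure M (D j) < \<delta> * \<kappa> / 2) sequentially"
    by (rule order_tendstoD(2))
  then obtain j where j: "real m0 * measure M (D j) < \<delta> * \<kappa> / 2"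
    by (auto simp: eventually_sequentially)
  have "\<exists>n1. \<forall>n\<ge>n1. \<forall>g\<in>A n. good (ginv g \<circ> e i)" for i using A_eventually_good eH by blast
  then obtain N where N: "\<And>i n g. n \<ge> N i \<Longrightarrow> g \<in> A n \<Longrightarrow> good (ginv g \<circ> e i)" by metis
  define n where "n = max n0 (Max (N ` {..j}))"
  have nN: "n \<ge> N i" if "i \<le> j" for i using that unfolding n_def by (intro max.coboundedI2 Max_ge) auto
  define G where "G = {g\<in>A n. U g \<inter> E r \<noteq> {}}"
  have G: "G \<subseteq> A n" "finite G" using A_finite by (auto simp: G_def)
  have Usets: "U g \<in> sets M" if "g \<in> A n" for g using that A_good U_sets by auto
  \<comment> \<open>Comparison with \<open>id\<close> on one shadow: \<open>F (e i)\<close> varies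
    there by at most the factor \<open>exp (2 * m)\<close>, which is the gap between
    \<open>r\<close> and \<open>r'\<close>.\<close>
  have close: "U g \<inter> (T - E r') \<subseteq> U g \<inter> D j" if g: "g \<in> G" for g
  proof
    fix \<eta> assume eta: "\<eta> \<in> U g \<inter> (T - E r')"
    obtain \<xi> where x: "\<xi> \<in> U g" "\<xi> \<in> E r" using g by (auto simp: G_def)
    have gA: "g \<in> A n" and gG: "g \<in> \<Gamma>" "good (ginv g)" using g A_good by (auto simp: G_def)
    have xZ: "\<xi> \<in> Z" "\<eta> \<in> Z" using x eta TS by (auto simp: E_def)
    have "F (e i) \<eta> \<le> exp r'" if "i \<le> j" for i
    proof -
      have ei: "e i \<in> \<Gamma>" using eH H_sub by auto
      have gd: "good (ginv g \<circ> e i)" using N[OF nN[OF that] gA] .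
      have sh: "\<bar>ln (F (e i) \<zeta>) - ln (F id \<zeta>) + \<omega> * (dist (e i p) (g p) - dist (id p) (g p))\<bar> \<le> m"
        if "\<zeta> \<in> Z" "\<zeta> \<in> U g" for \<zeta>
        by (rule F_shadow[OF gG(1) ei id_in that gd]) (simp only: comp_id gG)
      have "ln (F (e i) \<xi>) \<le> r"
        using x(2) eH[of i] F_pos[OF ei xZ(1)] by (auto simp: E_def) (metis ln_exp ln_le_cancel_iff exp_gt_zero)
      hence "ln (F (e i) \<eta>) \<le> r'"
        using sh[OF xZ(1) x(1)] sh[OF xZ(2)] eta F_id[OF xZ(1)] F_id[OF xZ(2)] by (auto simp: r'_def)
      thus ?thesis using F_pos[OF ei xZ(2)] by (metis exp_le_cancel_iff exp_ln)
    qed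
    thus "\<eta> \<in> U g \<inter> D j" using eta by (auto simp: D_def)
  qed
  have "\<kappa> \<le> measure M (T \<inter> (\<Union>g\<in>A n. U g))" by (rule k(2)) (simp add: n_def)
  also have "\<dots> \<le> measure M ((\<Union>g\<in>G. U g \<inter> T) \<union> (T - E r))"
    using TS E_sets G Usets by (intro finite_measure_mono sets.Un sets.finite_UN) (auto simp: G_def)
  also have "\<dots> \<le> measure M (\<Union>g\<in>G. U g \<inter> T) + measure M (T - E r)"
    using TS E_sets G Usets by (intro measure_Un_le sets.finite_UN) auto
  also have "measure M (\<Union>g\<in>G. U g \<inter> T) \<le> (\<Sum>g\<in>G. measure M (U g \<inter> T))"
    using TS G Usets by (intro finite_measure_subadditive_finite) auto
  finally have "\<kappa> / 2 < (\<Sum>g\<in>G. measure M (U g \<inter> T))" using TE by linarith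
  \<comment> \<open>A proportion \<open>\<delta>\<close> of these shadows lies outside
    \<open>E r'\<close>, hence in \<open>D j\<close>; the bounded overlap then contradicts the
    smallness of \<open>D j\<close>.\<close>
  hence "\<delta> * (\<kappa> / 2) < \<delta> * (\<Sum>g\<in>G. measure M (U g \<inter> T))" using d by simp
  also have "\<dots> \<le> (\<Sum>g\<in>G. measure M (U g \<inter> (T - E r')))"
    unfolding sum_distrib_left using d(2) G A_good by (intro sum_mono) auto
  also have "\<dots> \<le> (\<Sum>g\<in>G. measure M (U g \<inter> D j))"
    using close D_sets Usets G by (intro sum_mono finite_measure_mono) auto
  also have "\<dots> \<le> real m0 * measure M (D j \<inter> (\<Union>g\<in>G. U g))"
    by (rule multiplicity[OF G(1) D_sets]) (use TS in \<open>unfold D_def, blast\<close>)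
  also have "\<dots> \<le> real m0 * measure M (D j)"
    by (intro mult_left_mono finite_measure_mono D_sets Int_lower1) simp
  finally show False using j by simp
qed

end

section \<open>Counting group elements near the axis\<close>

locale isometry_action =
  fixes \<Gamma> :: "('a::metric_space \<Rightarrow> 'a) set"
  assumes id_in: "id \<in> \<Gamma>"
    and comp_in: "g \<in> \<Gamma> \<Longrightarrow> h \<in> \<Gamma> \<Longrightarrow> g \<circ> h \<in> \<Gamma>"
    and ginv_in: "g \<in> \<Gamma> \<Longrightarrow> ginv g \<in> \<Gamma>"
    and surj_in: "g \<in> \<Gamma> \<Longrightarrow> surj g"
    and isom_in: "g \<in> \<Gamma> \<Longrightarrow> dist (g x) (g y) = dist x y"
begin

lemma bij_in: "g \<in> \<Gamma> \<Longrightarrow> bij g"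
  using surj_in isom_in by (auto simp: bij_def intro!: injI) (metis dist_eq_0_iff)

lemma ginv_comp: "g \<in> \<Gamma> \<Longrightarrow> ginv g \<circ> g = id" "g \<in> \<Gamma> \<Longrightarrow> g \<circ> ginv g = id"
  "g \<in> \<Gamma> \<Longrightarrow> ginv (ginv g) = g"
  using bij_in[of g] by (auto simp: bij_is_inj bij_is_surj surj_f_inv_f inv_inv_eq)

lemma ginv_simps: "g \<in> \<Gamma> \<Longrightarrow> ginv g (g x) = x" "g \<in> \<Gamma> \<Longrightarrow> g (ginv g x) = x"
  using ginv_comp(1,2)[of g] by (metis comp_apply id_apply)+

lemma dist_ginv: "g \<in> \<Gamma> \<Longrightarrow> dist (ginv g x) y = dist x (g y)"
  using isom_in[of g "ginv g x" y] ginv_simps(2)[of g x] by simp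

lemma dist_ginv': "g \<in> \<Gamma> \<Longrightarrow> dist x (ginv g y) = dist (g x) y"
  using dist_ginv[of g y x] by (simp add: dist_commute)

end

text \<open>The growth bounds count group elements. Counts of orbit points differ from these by at
  most the order of the stabiliser of \<open>a 0\<close>.\<close>

locale axis_group = contracting_line a k c C + isometry_action \<Gamma>
  for a :: "int \<Rightarrow> 'a::metric_space" and k c C :: real and \<Gamma> +
  fixes shift :: "int \<Rightarrow> 'a \<Rightarrow> 'a" and \<omega> c1 c2 :: real
  assumes geodesic: "\<exists>S. geodesic_segment x (y::'a) S"
    and shift_in: "shift i \<in> \<Gamma>" and shift_a: "shift i (a j) = a (i + j)"
    and shift_uminus: "shift i (shift (- i) x) = x"
    and finite_ball: "finite {g\<in>\<Gamma>. dist (a 0) (g (a 0)) \<le> r}"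
    and growth_lower: "c1 * exp (\<omega> * real n) \<le> real (card {g\<in>\<Gamma>. dist (a 0) (g (a 0)) \<le> real n})"
    and growth_upper: "real (card {g\<in>\<Gamma>. dist (a 0) (g (a 0)) \<le> real n}) \<le> c2 * exp (\<omega> * real n)"
    and omega_pos: "\<omega> > 0" and c1_pos: "c1 > 0"
begin

abbreviation p :: 'a where "p \<equiv> a 0"

definition len :: "('a \<Rightarrow> 'a) \<Rightarrow> real" where "len g = dist p (g p)"

definition ball :: "real \<Rightarrow> ('a \<Rightarrow> 'a) set" where "ball r = {g\<in>\<Gamma>. len g \<le> r}"

lemma finite_ball': "finite (ball r)"
  using finite_ball by (simp add: ball_def len_def)

lemma ball_mono: "r \<le> r' \<Longrightarrow> ball r \<subseteq> ball r'" by (auto simp: ball_def)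

lemma card_ball_lower: "c1 * exp (\<omega> * real n) \<le> real (card (ball (real n)))"
  using growth_lower by (simp add: ball_def len_def)

lemma card_ball_upper_nat: "real (card (ball (real n))) \<le> c2 * exp (\<omega> * real n)"
  using growth_upper by (simp add: ball_def len_def)

lemma c2_pos: "c2 > 0"
proof -
  have "0 < c1 * exp (\<omega> * real 0)" using c1_pos by simp
  also have "\<dots> \<le> c2 * exp (\<omega> * real 0)"
    using card_ball_lower[of 0] card_ball_upper_nat[of 0] by linarith
  finally show ?thesis by simp
qed

lemma card_ball_upper: "real (card (ball r)) \<le> c2 * exp (\<omega> * (r + 1))"
proof (cases "r < 0")
  case True
  hence "ball r = {}" by (auto simp: ball_def len_def not_le intro: less_le_trans[OF _ zero_le_dist])
  thus ?thesis using c2_pos by simp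
next
  case False
  define n where "n = nat \<lceil>r\<rceil>"
  have n: "r \<le> real n" "real n \<le> r + 1" using False unfolding n_def by linarith+
  have "real (card (ball r)) \<le> real (card (ball (real n)))"
    using ball_mono[OF n(1)] finite_ball' by (simp add: card_mono)
  also have "\<dots> \<le> c2 * exp (\<omega> * real n)" by (rule card_ball_upper_nat)
  also have "\<dots> \<le> c2 * exp (\<omega> * (r + 1))" using n omega_pos c2_pos by simp
  finally show ?thesis .
qed

section \<open>Elements whose inverse moves the base point far along the axis\<close>

lemma len_ginv: "g \<in> \<Gamma> \<Longrightarrow> len (ginv g) = len g"
  by (simp add: len_def dist_ginv' dist_commute)

lemma len_ginv_p: "g \<in> \<Gamma> \<Longrightarrow> dist (ginv g p) p = len g"
  by (simp add: len_def dist_ginv)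

definition bad :: "nat \<Rightarrow> nat \<Rightarrow> ('a \<Rightarrow> 'a) set" where
  "bad K n = {g\<in>ball (real n). \<not> low (real K) (ginv g p)}"

text \<open>If \<open>ginv g p\<close> projects to \<open>a i\<close>, then \<open>g\<close> is a product of \<open>shift (- i)\<close> with an element
  shorter by about \<open>\<bar>i\<bar> / k\<close>.  So pure exponentiality makes large \<open>\<bar>i\<bar>\<close> rare.\<close>
lemma bad_subset:
  assumes K: "real K \<ge> k * (6 * C + c)"
  obtains N :: nat where "bad K n \<subseteq> (\<Union>i\<in>{i. int K < \<bar>i\<bar> \<and> \<bar>i\<bar> \<le> int N}.
    (\<lambda>h. h \<circ> shift (- i)) ` ball (real n + 16 * C + c - real_of_int \<bar>i\<bar> / k))"
proof -
  define N where "N = nat \<lceil>k * (real n + 16 * C + c)\<rceil>"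
  have "g \<in> (\<Union>i\<in>{i. int K < \<bar>i\<bar> \<and> \<bar>i\<bar> \<le> int N}.
    (\<lambda>h. h \<circ> shift (- i)) ` ball (real n + 16 * C + c - real_of_int \<bar>i\<bar> / k))" if g: "g \<in> bad K n" for g
  proof -
    have gG: "g \<in> \<Gamma>" and gn: "len g \<le> real n" using g by (auto simp: bad_def ball_def)
    define x where "x = ginv g p"
    obtain i where i: "i \<in> P x" using P_nonempty by blast
    have iK: "\<bar>real_of_int i\<bar> > real K" using g i by (auto simp: bad_def low_def x_def not_le)
    have "\<bar>real_of_int i\<bar> > k * (6 * C + c)" using iK K by linarith
    hence "\<bar>real_of_int i\<bar> / k > 6 * C + c" using k_ge1 by (simp add: field_simps)
    hence large: "dist (a i) (a 0) > 6 * C" using qi_lower[of i 0] by simp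
    obtain S where S: "geodesic_segment x (a 0) S" using geodesic by blast
    obtain u where u: "u \<in> S" "dist u (a i) \<le> 8 * C"
      using geodesic_near_proj[OF S i P_point(1) large] by blast
    have "dist x (a 0) = dist x u + dist u (a 0)" using geodesic_segment_dist_add[OF S u(1)] .
    \<comment> \<open>The geodesic from \<open>x\<close> to \<open>p\<close> passes within
      \<open>8 * C\<close> of \<open>a i\<close>, so the detour through \<open>a i\<close> costs at
      most \<open>16 * C\<close>.\<close>
    hence "dist x (a i) + dist (a i) (a 0) \<le> dist x p + 16 * C"
      using dist_triangle[of x "a i" u] dist_triangle2[of "a i" "a 0" u] u(2)
        dist_triangle[of "a i" "a 0" u] by (simp add: dist_commute)
    hence le: "dist x (a i) \<le> real n + 16 * C + c - real_of_int \<bar>i\<bar> / k"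
      using gn len_ginv_p[OF gG] qi_lower[of i 0] by (simp add: x_def)
    have mem: "g \<circ> shift i \<in> ball (real n + 16 * C + c - real_of_int \<bar>i\<bar> / k)"
      using le comp_in[OF gG shift_in] shift_a[of i 0] dist_ginv[OF gG, of p "a i"]
      by (simp add: ball_def len_def x_def)
    have eq: "g = (g \<circ> shift i) \<circ> shift (- i)"
      by (simp add: fun_eq_iff shift_uminus)
    have iN: "\<bar>i\<bar> \<le> int N"
    proof -
      have "real_of_int \<bar>i\<bar> / k \<le> real n + 16 * C + c" using le zero_le_dist[of x "a i"] by linarith
      hence "real_of_int \<bar>i\<bar> \<le> k * (real n + 16 * C + c)" using k_ge1 by (simp add: field_simps)
      thus ?thesis unfolding N_def by linarith
    qed
    show ?thesis
    proof (rule UN_I)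
      show "i \<in> {i. int K < \<bar>i\<bar> \<and> \<bar>i\<bar> \<le> int N}" using iK iN by auto
      show "g \<in> (\<lambda>h. h \<circ> shift (- i)) ` ball (real n + 16 * C + c - real_of_int \<bar>i\<bar> / k)"
        using eq mem by (rule image_eqI)
    qed
  qed
  thus ?thesis by (intro that[of N] subsetI)
qed

text \<open>The factor 2 accounts for the two signs of the index, the denominator for the geometric
  series in its absolute value.\<close>

definition c3 :: real where
  "c3 = 2 * c2 * exp (\<omega> * (16 * C + c + 1)) / (1 - exp (- \<omega> / k))"

lemma sum_powers_le:
  fixes q :: real
  assumes "0 < q" "q < 1"
  shows "(\<Sum>j\<in>{K<..N}. q ^ j) \<le> q ^ K / (1 - q)"
proof (cases "K \<le> N")
  case True
  have "(1 - q) * (\<Sum>j=K..N. q ^ j) = q ^ K - q ^ Suc N" by (rule sum_gp_multiplied[OF True])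
  also have "\<dots> \<le> q ^ K" using assms by simp
  finally have "(\<Sum>j=K..N. q ^ j) \<le> q ^ K / (1 - q)" using assms by (simp add: field_simps)
  moreover have "(\<Sum>j\<in>{K<..N}. q ^ j) \<le> (\<Sum>j=K..N. q ^ j)"
    using assms by (intro sum_mono2) auto
  ultimately show ?thesis by linarith
qed (use assms in auto)

lemma card_bad:
  assumes K: "real K \<ge> k * (6 * C + c)"
  shows "real (card (bad K n)) \<le> c3 * exp (- \<omega> / k) ^ K * exp (\<omega> * real n)"
proof -
  define q where "q = exp (- \<omega> / k)"
  have q: "0 < q" "q < 1" using omega_pos k_ge1 by (auto simp: q_def)
  obtain N where sub: "bad K n \<subseteq> (\<Union>i\<in>{i. int K < \<bar>i\<bar> \<and> \<bar>i\<bar> \<le> int N}.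
    (\<lambda>h. h \<circ> shift (- i)) ` ball (real n + 16 * C + c - real_of_int \<bar>i\<bar> / k))"
    using bad_subset[OF K] by blast
  define I where "I = {i. int K < \<bar>i\<bar> \<and> \<bar>i\<bar> \<le> int N}"
  define b where "b = c2 * exp (\<omega> * (real n + 16 * C + c + 1))"
  have I: "I = int ` {K<..N} \<union> (uminus \<circ> int) ` {K<..N}"
  proof (intro equalityI subsetI)
    fix i assume i: "i \<in> I"
    show "i \<in> int ` {K<..N} \<union> (uminus \<circ> int) ` {K<..N}"
    proof (cases "i \<ge> 0")
      case True
      hence "i = int (nat i)" "nat i \<in> {K<..N}" using i by (auto simp: I_def)
      thus ?thesis by blast
    next
      case False
      hence "i = (uminus \<circ> int) (nat (- i))" "nat (- i) \<in> {K<..N}" using i by (auto simp: I_def)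
      thus ?thesis by blast
    qed
  qed (auto simp: I_def)
  have fI: "finite I" unfolding I by simp
  have "real (card (bad K n)) \<le> real (card (\<Union>i\<in>I.
    (\<lambda>h. h \<circ> shift (- i)) ` ball (real n + 16 * C + c - real_of_int \<bar>i\<bar> / k)))"
    using sub fI finite_ball' unfolding I_def[symmetric] by (intro of_nat_mono card_mono) auto
  also have "\<dots> \<le> (\<Sum>i\<in>I. real (card ((\<lambda>h. h \<circ> shift (- i)) ` ball (real n + 16 * C + c - real_of_int \<bar>i\<bar> / k))))"
    by (simp only: of_nat_sum[symmetric] of_nat_le_iff) (rule card_UN_le[OF fI])
  also have "\<dots> \<le> (\<Sum>i\<in>I. b * q ^ nat \<bar>i\<bar>)"
  proof (rule sum_mono)
    fix i
    let ?r = "real n + 16 * C + c - real_of_int \<bar>i\<bar> / k"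
    have "real (card ((\<lambda>h. h \<circ> shift (- i)) ` ball ?r)) \<le> real (card (ball ?r))"
      using finite_ball' by (simp add: card_image_le)
    also have "\<dots> \<le> c2 * exp (\<omega> * (?r + 1))" by (rule card_ball_upper)
    also have "\<omega> * (?r + 1) = \<omega> * (real n + 16 * C + c + 1) + real (nat \<bar>i\<bar>) * (- \<omega> / k)"
      by (simp add: algebra_simps)
    also have "c2 * exp \<dots> = b * q ^ nat \<bar>i\<bar>"
      by (simp only: exp_add exp_of_nat_mult b_def q_def mult.assoc)
    finally show "real (card ((\<lambda>h. h \<circ> shift (- i)) ` ball ?r)) \<le> b * q ^ nat \<bar>i\<bar>" .
  qed
  also have "\<dots> = b * (\<Sum>i\<in>I. q ^ nat \<bar>i\<bar>)" by (simp add: sum_distrib_left)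
  also have "(\<Sum>i\<in>I. q ^ nat \<bar>i\<bar>) \<le> 2 * (q ^ K / (1 - q))"
  proof -
    have "(\<Sum>i\<in>I. q ^ nat \<bar>i\<bar>) \<le> (\<Sum>i\<in>int ` {K<..N}. q ^ nat \<bar>i\<bar>) + (\<Sum>i\<in>(uminus \<circ> int) ` {K<..N}. q ^ nat \<bar>i\<bar>)"
      unfolding I using q by (subst sum_Un) (auto intro!: sum_nonneg)
    also have "\<dots> = (\<Sum>j\<in>{K<..N}. q ^ j) + (\<Sum>j\<in>{K<..N}. q ^ j)"
      by (subst (1 2) sum.reindex) (auto simp: inj_on_def)
    finally show ?thesis using sum_powers_le[OF q, where K=K and N=N] by linarith
  qed
  finally have "real (card (bad K n)) \<le> b * (2 * (q ^ K / (1 - q)))"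
    using c2_pos by (simp add: b_def mult_left_mono)
  also have "\<dots> = c3 * q ^ K * exp (\<omega> * real n)"
    unfolding b_def c3_def q_def[symmetric] by (simp add: exp_add[symmetric] algebra_simps add_divide_distrib)
  finally show ?thesis unfolding q_def .
qed

text \<open>With a quarter, the bad and the short elements together leave \<open>c1 / 2\<close> for
  the annulus, and even the bad elements, their inverses and the short elements do not exhaust a
  ball.\<close>

definition K0 :: nat where
  "K0 = (SOME K. \<forall>n. real (card (bad K n)) \<le> c1 / 4 * exp (\<omega> * real n))"

lemma card_bad_K0: "real (card (bad K0 n)) \<le> c1 / 4 * exp (\<omega> * real n)"
proof -
  let ?q = "exp (- \<omega> / k)"
  have "(\<lambda>K. c3 * ?q ^ K) \<longlonglongrightarrow> c3 * 0"
    using omega_pos k_ge1 by (intro tendsto_mult_left LIMSEQ_realpow_zero) auto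
  moreover have "c3 * 0 < c1 / 4" using c1_pos by simp
  ultimately have ev: "eventually (\<lambda>K. c3 * ?q ^ K < c1 / 4) sequentially"
    by (rule order_tendstoD(2))
  then obtain K1 where K1: "\<And>K. K \<ge> K1 \<Longrightarrow> c3 * ?q ^ K < c1 / 4"
    by (auto simp: eventually_sequentially)
  define K where "K = max K1 (nat \<lceil>k * (6 * C + c)\<rceil>)"
  have K: "real K \<ge> k * (6 * C + c)" "K \<ge> K1" unfolding K_def by linarith+
  have "\<forall>n. real (card (bad K n)) \<le> c1 / 4 * exp (\<omega> * real n)"
  proof
    fix n
    have "real (card (bad K n)) \<le> c3 * ?q ^ K * exp (\<omega> * real n)" by (rule card_bad[OF K(1)])
    also have "\<dots> \<le> c1 / 4 * exp (\<omega> * real n)"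
      using K1[OF K(2)] by (intro mult_right_mono) auto
    finally show "real (card (bad K n)) \<le> c1 / 4 * exp (\<omega> * real n)" .
  qed
  thus ?thesis unfolding K0_def by (rule someI2) blast
qed

definition width :: nat where
  "width = (SOME w. \<forall>n. c2 * exp (\<omega> * real n) \<le> c1 / 4 * exp (\<omega> * real (n + w)))"

lemma width: "c2 * exp (\<omega> * real n) \<le> c1 / 4 * exp (\<omega> * real (n + width))"
proof -
  obtain w :: nat where w: "ln (4 * c2 / c1) / \<omega> \<le> real w" using real_arch_simple by blast
  have pos: "4 * c2 / c1 > 0" using c1_pos c2_pos by simp
  have "ln (4 * c2 / c1) \<le> real w * \<omega>" using w omega_pos by (simp only: pos_divide_le_eq)
  hence "exp (ln (4 * c2 / c1)) \<le> exp (\<omega> * real w)"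
    by (simp only: exp_le_cancel_iff mult.commute)
  hence "4 * c2 / c1 \<le> exp (\<omega> * real w)" by (simp only: exp_ln[OF pos])
  hence "4 * c2 \<le> exp (\<omega> * real w) * c1" using c1_pos by (simp only: pos_divide_le_eq)
  hence "c2 \<le> c1 / 4 * exp (\<omega> * real w)" by (simp add: mult.commute)
  hence "c2 * exp (\<omega> * real n) \<le> c1 / 4 * exp (\<omega> * real w) * exp (\<omega> * real n)" for n
    by (intro mult_right_mono) auto
  hence "\<forall>n. c2 * exp (\<omega> * real n) \<le> c1 / 4 * exp (\<omega> * real (n + w))"
    by (simp add: distrib_left exp_add mult_ac)
  thus ?thesis unfolding width_def by (rule someI2) blast
qed

text \<open>The lower bound on the length limits length differences within one annulus, and with
  them the overlap of the shadows.\<close>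

definition annulus :: "nat \<Rightarrow> ('a \<Rightarrow> 'a) set" where
  "annulus n = {g\<in>\<Gamma>. low (real K0) (ginv g p) \<and> real n - real width < len g \<and> len g \<le> real n}"

lemma annulus_finite: "finite (annulus n)"
  by (rule finite_subset[OF _ finite_ball'[of "real n"]]) (auto simp: annulus_def ball_def)

lemma annulus_card:
  assumes "n \<ge> width"
  shows "c1 / 2 * exp (\<omega> * real n) \<le> real (card (annulus n))"
proof -
  obtain j where n: "n = j + width" using assms by (metis le_Suc_ex add.commute)
  have "ball (real n) \<subseteq> annulus n \<union> (bad K0 n \<union> ball (real j))"
    by (auto simp: n annulus_def bad_def ball_def)
  hence "card (ball (real n)) \<le> card (annulus n \<union> (bad K0 n \<union> ball (real j)))"
    using annulus_finite finite_ball' by (intro card_mono) (auto simp: bad_def)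
  also have "\<dots> \<le> card (annulus n) + (card (bad K0 n) + card (ball (real j)))"
    by (meson add_mono card_Un_le le_refl le_trans add_left_mono)
  finally have "real (card (ball (real n))) \<le> real (card (annulus n)) + (real (card (bad K0 n)) + real (card (ball (real j))))"
    by linarith
  moreover have "real (card (ball (real j))) \<le> c1 / 4 * exp (\<omega> * real n)"
    using card_ball_upper_nat[of j] width[of j] by (simp add: n)
  ultimately show ?thesis using card_ball_lower[of n] card_bad_K0[of n] by linarith
qed

section \<open>A transversal to the axis and long elements of a normal subgroup\<close>

lemma ex_transversal:
  obtains t where "t \<in> \<Gamma>" "low (real K0) (t p)" "low (real K0) (ginv t p)" "len t > r"
proof -
  define j where "j = nat \<lceil>r\<rceil>"
  define n where "n = j + width"
  let ?B = "bad K0 n"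
  have fB: "finite ?B" using finite_ball' by (simp add: bad_def)
  have "card (?B \<union> (ginv ` ?B \<union> ball (real j))) \<le> card ?B + (card (ginv ` ?B) + card (ball (real j)))"
    by (meson add_mono card_Un_le le_refl le_trans add_left_mono)
  also have "card (ginv ` ?B) \<le> card ?B" using fB by (rule card_image_le)
  finally have "real (card (?B \<union> (ginv ` ?B \<union> ball (real j)))) \<le> real (card ?B) + (real (card ?B) + real (card (ball (real j))))"
    by linarith
  moreover have "real (card (ball (real j))) \<le> c1 / 4 * exp (\<omega> * real n)"
    using card_ball_upper_nat[of j] width[of j] by (simp add: n_def)
  moreover have "c1 * exp (\<omega> * real n) > 0" using c1_pos by simp
  \<comment> \<open>The three sets together have at most three quarters of the guaranteed size of
    the ball.\<close>
  ultimately have "card (?B \<union> (ginv ` ?B \<union> ball (real j))) < card (ball (real n))"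
    using card_ball_lower[of n] card_bad_K0[of n] by linarith
  hence "\<not> ball (real n) \<subseteq> ?B \<union> (ginv ` ?B \<union> ball (real j))"
    using fB finite_ball' by (metis card_mono finite_Un finite_imageI not_le)
  then obtain t where t: "t \<in> ball (real n)" "t \<notin> ?B" "t \<notin> ginv ` ?B" "t \<notin> ball (real j)" by auto
  have tG: "t \<in> \<Gamma>" using t by (simp add: ball_def)
  have "ginv t \<notin> ?B" using t(3) ginv_comp(3)[OF tG] by (metis imageI)
  moreover have "ginv t \<in> ball (real n)" using t tG len_ginv ginv_in by (simp add: ball_def)
  ultimately have "low (real K0) (t p)" using ginv_comp(3)[OF tG] by (simp add: bad_def)
  moreover have "low (real K0) (ginv t p)" using t by (simp add: bad_def)
  moreover have "len t > r" using t tG unfolding j_def by (simp add: ball_def) linarith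
  ultimately show ?thesis using that tG by blast
qed

lemma low_high_dist:
  assumes "low r x" "high (sep r) y"
  shows "dist x p + dist p y \<le> dist x y + 2 * near r"
proof -
  obtain S where S: "geodesic_segment x y S" using geodesic by blast
  obtain u where u: "u \<in> S" "dist u p \<le> near r" using low_high_geodesic[OF assms S] by blast
  show ?thesis
    using geodesic_segment_dist_add[OF S u(1)] u(2) dist_triangle[of x p u]
      dist_triangle[of p y u] by (simp add: dist_commute)
qed

text \<open>The length has to beat the loss \<open>2 * near (real K0)\<close> of
  \<open>low_high_dist\<close>, on which \<open>conj_low\<close> rests.\<close>

definition transversal :: "'a \<Rightarrow> 'a" where
  "transversal = (SOME t. t \<in> \<Gamma> \<and> low (real K0) (t p) \<and> low (real K0) (ginv t p) \<and> len t > 2 * near (real K0))"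

lemma transversal: "transversal \<in> \<Gamma>" "low (real K0) (transversal p)" "low (real K0) (ginv transversal p)"
  "len transversal > 2 * near (real K0)"
proof -
  have "\<exists>t. t \<in> \<Gamma> \<and> low (real K0) (t p) \<and> low (real K0) (ginv t p) \<and> len t > 2 * near (real K0)"
    using ex_transversal[of "2 * near (real K0)"] by metis
  from someI_ex[OF this] show "transversal \<in> \<Gamma>" "low (real K0) (transversal p)" "low (real K0) (ginv transversal p)"
    "len transversal > 2 * near (real K0)" by (simp_all add: transversal_def[symmetric])
qed

definition K1 :: real where "K1 = sep (real K0) + index_lip (len transversal)"

text \<open>The transversal moves the axis off itself, so \<open>u p\<close> and \<open>ginv transversal (u p)\<close> cannot both
  project far from \<open>p\<close>.\<close>
lemma conj_low:
  assumes u: "u \<in> \<Gamma>" "\<not> low (sep (real K0)) (u p)"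
  shows "low K1 ((ginv transversal \<circ> u \<circ> transversal) p)"
proof -
  have hu: "high (sep (real K0)) (u p)" using low_or_high u(2) by blast
  define w where "w = ginv transversal (u p)"
  have tw: "transversal w = u p" using ginv_simps[OF transversal(1)] by (simp add: w_def)
  \<comment> \<open>Otherwise \<open>low_high_dist\<close> applies both at \<open>w\<close> and at
    \<open>u p\<close>. Adding the two inequalities cancels the distances from \<open>p\<close> to
    these points and leaves a bound on \<open>len transversal\<close> that is too small.\<close>
  have "\<not> high (sep (real K0)) w"
  proof
    assume hw: "high (sep (real K0)) w"
    have "len transversal + dist p w \<le> dist p (transversal w) + 2 * near (real K0)"
      using low_high_dist[OF transversal(3) hw] len_ginv_p[OF transversal(1)] dist_ginv[OF transversal(1)] by simp
    moreover have "len transversal + dist p (transversal w) \<le> dist p w + 2 * near (real K0)"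
      using low_high_dist[OF transversal(2) hu] tw isom_in[OF transversal(1), of w p] by (simp add: len_def dist_commute)
    ultimately show False using transversal(4) by linarith
  qed
  hence lw: "low (sep (real K0)) w" using low_or_high by blast
  have "dist w ((ginv transversal \<circ> u \<circ> transversal) p) \<le> len transversal"
    using isom_in[OF ginv_in[OF transversal(1)]] isom_in[OF u(1)] by (simp add: w_def len_def)
  moreover obtain S where "geodesic_segment w ((ginv transversal \<circ> u \<circ> transversal) p) S" using geodesic by blast
  ultimately show "low K1 ((ginv transversal \<circ> u \<circ> transversal) p)"
    unfolding K1_def using low_lipschitz[OF _ lw] by blast
qed

text \<open>Balls are finite, so \<open>H\<close> has arbitrarily long elements. If
  \<open>u p\<close> projects far away, the conjugate by the transversal does not; it still lies in
  \<open>H\<close>, and its length differs by at most \<open>2 * len transversal\<close>. Inverses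
  are taken at the end because the projection of \<open>ginv h p\<close> is wanted.\<close>

lemma ex_long_low:
  assumes H: "H \<subseteq> \<Gamma>" "infinite H" "\<And>h. h \<in> H \<Longrightarrow> ginv h \<in> H"
    and conj: "\<And>g h. g \<in> \<Gamma> \<Longrightarrow> h \<in> H \<Longrightarrow> g \<circ> h \<circ> ginv g \<in> H"
  shows "\<exists>h\<in>H. len h \<ge> L \<and> low K1 (ginv h p)"
proof -
  have "\<not> H \<subseteq> ball (L + 2 * len transversal)" using H(2) finite_ball' finite_subset by blast
  then obtain u where u': "u \<in> H" "u \<notin> ball (L + 2 * len transversal)" by blast
  hence u: "u \<in> H" "u \<in> \<Gamma>" "len u > L + 2 * len transversal"
    using H(1) by (auto simp: ball_def)
  have lt: "len transversal \<ge> 0" by (simp add: len_def)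
  show ?thesis
  proof (cases "low (sep (real K0)) (u p)")
    case True
    have "sep (real K0) \<le> K1"
      unfolding K1_def index_lip_def using lt C_ge1 k_ge1 c_ge0 by simp
    hence "low K1 (ginv (ginv u) p)" using True low_mono ginv_comp(3)[OF u(2)] by metis
    thus ?thesis using u lt H(3)[OF u(1)] len_ginv[OF u(2)] by (intro bexI[of _ "ginv u"]) auto
  next
    case False
    let ?v = "ginv transversal \<circ> u \<circ> transversal"
    have lv: "low K1 (?v p)" by (rule conj_low[OF u(2) False])
    have vH: "?v \<in> H"
      using conj[OF ginv_in[OF transversal(1)] u(1)] ginv_comp(3)[OF transversal(1)] by simp
    have vG: "?v \<in> \<Gamma>" using vH H by auto
    have "dist p (u p) \<le> dist p (transversal p) + dist (transversal p) (u (transversal p)) + dist (u (transversal p)) (u p)"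
      using dist_triangle[of p "u p" "transversal p"] dist_triangle[of "transversal p" "u p" "u (transversal p)"] by linarith
    moreover have "len ?v = dist (transversal p) (u (transversal p))"
      using dist_ginv'[OF transversal(1), of p] by (simp add: len_def)
    ultimately have "len ?v \<ge> L" using u isom_in[OF u(2)] by (simp add: len_def dist_commute)
    thus ?thesis using lv vH H(3)[OF vH] len_ginv[OF vG] ginv_comp(3)[OF vG]
      by (intro bexI[of _ "ginv ?v"]) auto
  qed
qed

text \<open>\<open>K1\<close> serves the long elements of \<open>H\<close>, the other term the
  images under inverses of annulus elements of a fixed orbit point.\<close>

definition Kt :: real where "Kt = max K1 (real K0 + k * (C + c))"

definition good :: "('a \<Rightarrow> 'a) \<Rightarrow> bool" where "good u \<longleftrightarrow> low Kt (u p)"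

lemma Kt_ge: "real K0 \<le> Kt" "K1 \<le> Kt" "0 \<le> Kt"
  using C_ge1 k_ge1 c_ge0 by (auto simp: Kt_def intro: order_trans[of _ "real K0 + k * (C + c)"])

lemma good_id: "good id"
  using P_point(1)[of 0] Kt_ge unfolding good_def low_def by (intro bexI[of _ 0]) auto

lemma annulus_good: "g \<in> annulus n \<Longrightarrow> good (ginv g)"
  using low_mono[OF _ Kt_ge(1)] by (auto simp: annulus_def good_def)

text \<open>Only \<open>n1\<close> depends on \<open>h\<close>: by \<open>low_far\<close> the index
  bound is the same for all \<open>h\<close>, so one threshold \<open>Kt\<close> can be fixed
  beforehand.\<close>

lemma annulus_eventually_good:
  assumes "h \<in> \<Gamma>"
  shows "\<exists>n1. \<forall>n\<ge>n1. \<forall>g\<in>annulus n. good (ginv g \<circ> h)"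
proof -
  obtain n1 :: nat where n1: "len h + real width + (k * real K0 + c) \<le> real n1"
    using real_arch_simple by blast
  have "good (ginv g \<circ> h)" if "n \<ge> n1" "g \<in> annulus n" for n g
  proof -
    have g: "g \<in> \<Gamma>" "low (real K0) (ginv g p)" "len g > real n - real width"
      using that by (auto simp: annulus_def)
    have "dist (ginv g p) (ginv g (h p)) \<le> dist (ginv g p) (a 0) - (k * real K0 + c)"
      using isom_in[OF ginv_in[OF g(1)]] len_ginv_p[OF g(1)] g(3) n1 that(1)
      by (simp add: len_def[of h])
    from low_far[OF g(2) this] show ?thesis
      using low_mono by (auto simp: good_def Kt_def)
  qed
  thus ?thesis by blast
qed

end

section \<open>Shadows on the boundary\<close>

lemma continuous_eq_on_dense:
  fixes f g :: "'b::topological_space \<Rightarrow> 'c::t2_space"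
  assumes "continuous_on UNIV f" "continuous_on UNIV g" "closure S = UNIV" "\<And>x. x \<in> S \<Longrightarrow> f x = g x"
  shows "f = g"
proof -
  have "closed {x. f x = g x}" using assms by (intro closed_Collect_eq) auto
  moreover have "S \<subseteq> {x. f x = g x}" using assms by auto
  ultimately have "closure S \<subseteq> {x. f x = g x}" by (rule closure_minimal[rotated])
  thus ?thesis using assms by auto
qed

text \<open>The parametrising interval has length 1, whence the additional 1 in the additive
  constant.\<close>

lemma quasi_geodesic_pair:
  assumes "dist u v \<le> d"
  shows "quasi_geodesic 1 (d + 1) {u, v}"
proof -
  let ?f = "\<lambda>t::real. if t \<le> 0 then u else v"
  have d: "d \<ge> 0" using assms zero_le_dist[of u v] by linarith
  have "?f ` {0..1} = {u, v}"
  proof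
    have "u \<in> ?f ` {0..1}" by (rule image_eqI[of _ _ 0]) auto
    moreover have "v \<in> ?f ` {0..1}" by (rule image_eqI[of _ _ 1]) auto
    ultimately show "{u, v} \<subseteq> ?f ` {0..1}" by simp
  qed auto
  moreover have "qi_embedding_on 1 (d + 1) {0..1} ?f"
    using assms d
    by (auto simp: qi_embedding_on_def dist_real_def dist_commute intro: order_trans[OF _ zero_le_dist])
  ultimately show ?thesis
    unfolding quasi_geodesic_def by (intro exI[of _ "{0..1}"] exI[of _ ?f]) (auto simp: is_interval_cc)
qed

lemma contracting_pair:
  assumes "dist u v \<le> d"
  shows "contracting_set d {u, v}"
  unfolding contracting_set_def
proof (intro conjI allI impI)
  fix x y
  have d: "d \<ge> 0" using assms zero_le_dist[of u v] by linarith
  let ?S = "nearest_proj {u, v} x \<union> nearest_proj {u, v} y"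
  have sub: "?S \<subseteq> {u, v}" by (auto simp: nearest_proj_def)
  have "dist a b \<le> d" if "a \<in> ?S" "b \<in> ?S" for a b
  proof -
    have "a = u \<or> a = v" "b = u \<or> b = v" using sub that by blast+
    thus ?thesis using assms d by (auto simp: dist_commute)
  qed
  thus "diameter ?S \<le> d" using d by (auto simp: diameter_def intro!: cSUP_least)
qed simp

locale boundary_action = axis_group a k c C \<Gamma> shift \<omega> c1 c2
  for a :: "int \<Rightarrow> 'a::metric_space" and k c C \<Gamma> shift \<omega> c1 c2 +
  fixes \<iota> :: "'a \<Rightarrow> 'b::metric_space" and R :: "'b rel" and Chor :: "'b set"
    and B :: "'b \<Rightarrow> 'a \<Rightarrow> 'a \<Rightarrow> real" and eps :: "'b \<Rightarrow> real"
    and act :: "('a \<Rightarrow> 'a) \<Rightarrow> 'b \<Rightarrow> 'b"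
  assumes dense: "closure (range \<iota>) = UNIV"
    and equiv: "equiv (boundary \<iota>) R"
    and act_cont: "g \<in> \<Gamma> \<Longrightarrow> continuous_on UNIV (act g)"
    and act_iota: "g \<in> \<Gamma> \<Longrightarrow> act g (\<iota> x) = \<iota> (g x)"
    and Chor_non_pinched: "Chor \<subseteq> non_pinched (a 0) \<iota> R"
    and busemann: "\<xi> \<in> Chor \<Longrightarrow> Limsup (toward_class \<iota> (R `` {\<xi>}))
          (\<lambda>z. ereal \<bar>B \<xi> x y - (dist x z - dist y z)\<bar>) \<le> ereal (eps \<xi>)"
    and cones: "assumption_B (a 0) \<iota> R"
begin

section \<open>The extended action and the shadows\<close>

lemma Chor_boundary: "\<xi> \<in> Chor \<Longrightarrow> \<xi> \<in> boundary \<iota>"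
  using Chor_non_pinched by (auto simp: non_pinched_def)

lemma class_self: "\<xi> \<in> boundary \<iota> \<Longrightarrow> \<xi> \<in> R `` {\<xi>}"
  using equiv by (auto simp: equiv_def refl_on_def)

lemma act_id: "act id = id"
  by (rule continuous_eq_on_dense[OF act_cont[OF id_in] continuous_on_id' dense])
    (use act_iota[OF id_in] in \<open>auto simp: id_def\<close>)

lemma act_comp:
  assumes "g \<in> \<Gamma>" "h \<in> \<Gamma>"
  shows "act (g \<circ> h) = act g \<circ> act h"
proof (rule continuous_eq_on_dense[OF act_cont[OF comp_in[OF assms]] _ dense])
  show "continuous_on UNIV (act g \<circ> act h)"
    by (intro continuous_on_compose act_cont assms continuous_on_subset[OF act_cont[OF assms(1)]]) simp
qed (use act_iota comp_in assms in auto)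

lemma act_ginv: "g \<in> \<Gamma> \<Longrightarrow> act (ginv g) (act g \<xi>) = \<xi>" "g \<in> \<Gamma> \<Longrightarrow> act g (act (ginv g) \<xi>) = \<xi>"
  using act_comp[OF ginv_in, of g g] act_comp[OF _ ginv_in, of g g] ginv_comp[of g] act_id
  by (metis comp_apply id_apply)+

lemma act_boundary: 
  assumes "g \<in> \<Gamma>" "\<xi> \<in> boundary \<iota>"
  shows "act g \<xi> \<in> boundary \<iota>"
proof (rule ccontr)
  assume "act g \<xi> \<notin> boundary \<iota>"
  then obtain x where "act g \<xi> = \<iota> x" by (auto simp: boundary_def)
  hence "\<xi> = \<iota> (ginv g x)" using act_ginv(1)[OF assms(1)] act_iota[OF ginv_in[OF assms(1)]] by metis
  thus False using assms by (auto simp: boundary_def)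
qed

text \<open>Two scales above \<open>Kt\<close>: a point that fails to be
  \<open>high (sep Kt)\<close> is \<open>low (sep Kt)\<close>, and this has to be separated from
  \<open>V\<close> once more.\<close>

definition V :: "'a set" where "V = {w. high (sep (sep Kt)) w}"

text \<open>Taking closures makes shadows Borel and lets a finite union of them cover the
  boundary.\<close>

definition U :: "('a \<Rightarrow> 'a) \<Rightarrow> 'b set" where "U g = boundary \<iota> \<inter> closure (\<iota> ` g ` V)"

lemma U_act_imp:
  assumes "g \<in> \<Gamma>" "h \<in> \<Gamma>" "\<xi> \<in> U g"
  shows "act h \<xi> \<in> U (h \<circ> g)"
proof -
  have "act h ` closure (\<iota> ` g ` V) \<subseteq> closure (act h ` \<iota> ` g ` V)"
    using act_cont[OF assms(2)] by (intro continuous_image_closure_subset) auto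
  also have "act h ` \<iota> ` g ` V = \<iota> ` (h \<circ> g) ` V"
    using act_iota[OF assms(2)] by (auto simp: image_iff)
  finally show ?thesis using assms act_boundary unfolding U_def by blast
qed

lemma U_act:
  assumes "g \<in> \<Gamma>" "h \<in> \<Gamma>"
  shows "act h \<xi> \<in> U g \<longleftrightarrow> \<xi> \<in> U (ginv h \<circ> g)"
proof
  assume "act h \<xi> \<in> U g"
  from U_act_imp[OF assms(1) ginv_in[OF assms(2)] this]
  show "\<xi> \<in> U (ginv h \<circ> g)" using act_ginv assms by simp
next
  assume "\<xi> \<in> U (ginv h \<circ> g)"
  from U_act_imp[OF comp_in[OF ginv_in[OF assms(2)] assms(1)] assms(2) this]
  show "act h \<xi> \<in> U g" using ginv_comp(2)[OF assms(2)] by (simp add: o_assoc)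
qed

lemma U_cover:
  obtains s where "s \<in> \<Gamma>" "\<And>\<xi>. \<xi> \<in> boundary \<iota> \<Longrightarrow> \<xi> \<in> U id \<or> act s \<xi> \<in> U id"
proof -
  \<comment> \<open>If the index \<open>i\<close> is less than \<open>N\<close> in absolute value,
    then \<open>2 * N + i\<close> exceeds \<open>N\<close>; hence a translation by
    \<open>2 * N\<close> moves the complement of \<open>V\<close> into \<open>V\<close>.\<close>
  define N where "N = \<lceil>sep (sep Kt)\<rceil>"
  define s where "s = shift (2 * N)"
  have sG: "s \<in> \<Gamma>" using shift_in by (simp add: s_def)
  have cover: "w \<in> V \<or> s w \<in> V" for w
  proof -
    obtain i where i: "i \<in> P w" using P_nonempty by blast
    have "dist (s w) (a (2 * N + j)) = dist w (a j)" for j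
      using isom_in[OF sG, of w "a j"] shift_a by (simp add: s_def)
    moreover have "infdist (s w) (range a) = infdist w (range a)"
    proof -
      have "s ` range a = range a"
      proof (intro equalityI subsetI)
        fix y assume "y \<in> range a"
        then obtain j where "y = a j" by auto
        hence "y = s (a (j - 2 * N))" using shift_a by (simp add: s_def)
        thus "y \<in> s ` range a" by blast
      qed (use shift_a in \<open>auto simp: s_def\<close>)
      hence "infdist (s w) (range a) = infdist (s w) (s ` range a)" by (simp only:)
      also have "\<dots> = (INF y\<in>s ` range a. dist (s w) y)" by (rule infdist_notempty) simp
      also have "\<dots> = (INF y\<in>range a. dist w y)" by (simp only: image_image isom_in[OF sG])
      also have "\<dots> = infdist w (range a)" by (rule infdist_notempty[symmetric]) simp
      finally show ?thesis .
    qed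
    ultimately have "2 * N + i \<in> P (s w)" using i by (simp add: P_def)
    moreover have "\<bar>real_of_int i\<bar> \<ge> sep (sep Kt) \<or> \<bar>real_of_int (2 * N + i)\<bar> \<ge> sep (sep Kt)"
      unfolding N_def by linarith
    ultimately show ?thesis using i unfolding V_def high_def by blast
  qed
  have "\<xi> \<in> U id \<or> act s \<xi> \<in> U id" if b: "\<xi> \<in> boundary \<iota>" for \<xi>
  proof -
    have "range \<iota> \<subseteq> \<iota> ` V \<union> \<iota> ` ginv s ` V"
    proof
      fix y assume "y \<in> range \<iota>"
      then obtain w where w: "y = \<iota> w" by auto
      have "w = ginv s (s w)" using ginv_simps[OF sG] by simp
      thus "y \<in> \<iota> ` V \<union> \<iota> ` ginv s ` V" using cover[of w] w by blast
    qed
    hence "closure (range \<iota>) \<subseteq> closure (\<iota> ` V \<union> \<iota> ` ginv s ` V)" by (rule closure_mono)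
    hence "\<xi> \<in> closure (\<iota> ` V) \<union> closure (\<iota> ` ginv s ` V)" using dense by (auto simp: closure_Un)
    hence "\<xi> \<in> U id \<or> \<xi> \<in> U (ginv s)" using b by (auto simp: U_def)
    thus ?thesis using U_act[OF id_in sG, of \<xi>] by simp
  qed
  thus ?thesis using that sG by blast
qed

section \<open>Busemann functions and geodesics in shadows\<close>

lemma U_seq:
  assumes "\<xi> \<in> U g"
  obtains z where "\<And>n. z n \<in> g ` V" "(\<lambda>n. \<iota> (z n)) \<longlonglongrightarrow> \<xi>"
proof -
  have "\<xi> \<in> closure (\<iota> ` g ` V)" using assms by (simp add: U_def)
  then obtain f where f: "\<forall>n. f n \<in> \<iota> ` g ` V" "f \<longlonglongrightarrow> \<xi>" by (auto simp: closure_sequential)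
  have "\<forall>n. \<exists>w. w \<in> g ` V \<and> f n = \<iota> w" using f(1) by blast
  then obtain z where z: "\<forall>n. z n \<in> g ` V \<and> f n = \<iota> (z n)" by (rule choice[THEN exE])
  hence "f = (\<lambda>n. \<iota> (z n))" by auto
  thus ?thesis using that[of z] z f(2) by simp
qed

lemma boundary_seq:
  obtains z where "(\<lambda>n. \<iota> (z n)) \<longlonglongrightarrow> \<xi>"
proof -
  have "\<xi> \<in> closure (range \<iota>)" using dense by simp
  then obtain f where f: "\<forall>n. f n \<in> range \<iota>" "f \<longlonglongrightarrow> \<xi>" by (auto simp: closure_sequential)
  have "\<forall>n. \<exists>w. f n = \<iota> w" using f(1) by blast
  then obtain z where "\<forall>n. f n = \<iota> (z n)" by (rule choice[THEN exE])
  hence "f = (\<lambda>n. \<iota> (z n))" by auto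
  thus ?thesis using that[of z] f(2) by simp
qed

lemma high_of_V: "g \<in> \<Gamma> \<Longrightarrow> z \<in> g ` V \<Longrightarrow> high (sep (sep Kt)) (ginv g z)"
  using ginv_simps by (auto simp: V_def)

text \<open>The additional 1 turns the bound on the limit superior into one that holds eventually
  along every sequence converging to \<open>\<xi>\<close>.\<close>

lemma busemann_eventually:
  assumes x: "\<xi> \<in> Chor" and z: "(\<lambda>n. \<iota> (z n)) \<longlonglongrightarrow> \<xi>"
  shows "\<forall>\<^sub>F n in sequentially. \<bar>B \<xi> x y - (dist x (z n) - dist y (z n))\<bar> \<le> eps \<xi> + 1"
proof -
  let ?A = "R `` {\<xi>}"
  have "Limsup (toward_class \<iota> ?A) (\<lambda>z. ereal \<bar>B \<xi> x y - (dist x z - dist y z)\<bar>) < ereal (eps \<xi> + 1)"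
    by (rule le_less_trans[OF busemann[OF x]]) simp
  hence "\<forall>\<^sub>F z in toward_class \<iota> ?A. ereal \<bar>B \<xi> x y - (dist x z - dist y z)\<bar> < ereal (eps \<xi> + 1)"
    by (rule Limsup_lessD)
  moreover have "filterlim z (toward_class \<iota> ?A) sequentially"
  proof -
    have "filterlim z (filtercomap \<iota> (nhds \<xi>)) sequentially"
      using z by (simp add: filterlim_filtercomap_iff comp_def)
    moreover have "filtercomap \<iota> (nhds \<xi>) \<le> toward_class \<iota> ?A"
      unfolding toward_class_def by (rule SUP_upper) (use class_self Chor_boundary x in blast)
    ultimately show ?thesis by (rule filterlim_mono) simp
  qed
  ultimately have "\<forall>\<^sub>F n in sequentially. ereal \<bar>B \<xi> x y - (dist x (z n) - dist y (z n))\<bar> < ereal (eps \<xi> + 1)"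
    by (rule eventually_compose_filterlim)
  thus ?thesis by eventually_elim simp
qed

lemma low_high_translate:
  assumes g: "g \<in> \<Gamma>" and "low r (ginv g x)" "high (sep r) (ginv g y)" and S: "geodesic_segment x y S"
  obtains u where "u \<in> S" "dist u (g p) \<le> near r"
proof -
  have "geodesic_segment (ginv g x) (ginv g y) (ginv g ` S)"
    by (rule geodesic_segment_image[OF S isom_in[OF ginv_in[OF g]]])
  from low_high_geodesic[OF assms(2,3) this] obtain u where "u \<in> S" "dist (ginv g u) p \<le> near r"
    by blast
  thus ?thesis using that dist_ginv[OF g] by metis
qed

lemma low_high_dist_translate:
  assumes g: "g \<in> \<Gamma>" and "low r (ginv g x)" "high (sep r) (ginv g y)"
  shows "dist x (g p) + dist (g p) y \<le> dist x y + 2 * near r"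
  using low_high_dist[OF assms(2,3)] dist_ginv[OF g] dist_ginv'[OF g] isom_in[OF ginv_in[OF g]] by simp

definition err :: "'b \<Rightarrow> real" where "err \<xi> = eps \<xi> + 1 + 2 * near (sep Kt)"

lemma sep_Kt: "0 \<le> sep Kt" "Kt \<le> sep Kt" "sep Kt \<le> sep (sep Kt)" "near (sep Kt) > 0" "near Kt > 0"
  using sep_gt[of Kt] sep_gt[of "sep Kt"] Kt_ge(3) near_pos by (auto intro: less_imp_le)

lemma busemann_shadow:
  assumes x: "\<xi> \<in> Chor" "\<xi> \<in> U g" and g: "g \<in> \<Gamma>"
    and low: "low (sep Kt) (ginv g x)" "low (sep Kt) (ginv g y)"
  shows "\<bar>B \<xi> x y - (dist x (g p) - dist y (g p))\<bar> \<le> err \<xi>"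
proof -
  obtain z where z: "\<And>n. z n \<in> g ` V" "(\<lambda>n. \<iota> (z n)) \<longlonglongrightarrow> \<xi>" using U_seq[OF x(2)] by blast
  obtain n where n: "\<bar>B \<xi> x y - (dist x (z n) - dist y (z n))\<bar> \<le> eps \<xi> + 1"
    using eventually_happens'[OF sequentially_bot busemann_eventually[OF x(1) z(2)]] by blast
  note h = high_of_V[OF g z(1)[of n]]
  have "dist x (g p) + dist (g p) (z n) \<le> dist x (z n) + 2 * near (sep Kt)"
    "dist y (g p) + dist (g p) (z n) \<le> dist y (z n) + 2 * near (sep Kt)"
    by (rule low_high_dist_translate[OF g low(1) h], rule low_high_dist_translate[OF g low(2) h])
  moreover have "dist x (z n) \<le> dist x (g p) + dist (g p) (z n)" "dist y (z n) \<le> dist y (g p) + dist (g p) (z n)"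
    by (rule dist_triangle)+
  ultimately show ?thesis using n unfolding err_def by linarith
qed

text \<open>Differences of distances to one point close to \<open>\<xi>\<close> satisfy the identity
  exactly; each of the three values of \<open>B\<close> is off by
  \<open>eps \<xi> + 1\<close>.\<close>

lemma busemann_cocycle:
  assumes x: "\<xi> \<in> Chor"
  shows "\<bar>B \<xi> x q - (B \<xi> x y - B \<xi> q y)\<bar> \<le> 3 * (eps \<xi> + 1)" "\<bar>B \<xi> x y\<bar> \<le> dist x y + (eps \<xi> + 1)"
proof -
  obtain z where z: "(\<lambda>n. \<iota> (z n)) \<longlonglongrightarrow> \<xi>" using boundary_seq by blast
  have ev: "\<forall>\<^sub>F n in sequentially. \<bar>B \<xi> x q - (dist x (z n) - dist q (z n))\<bar> \<le> eps \<xi> + 1 \<and>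
     \<bar>B \<xi> x y - (dist x (z n) - dist y (z n))\<bar> \<le> eps \<xi> + 1 \<and>
     \<bar>B \<xi> q y - (dist q (z n) - dist y (z n))\<bar> \<le> eps \<xi> + 1"
    by (intro eventually_conj busemann_eventually x z)
  obtain n where n: "\<bar>B \<xi> x q - (dist x (z n) - dist q (z n))\<bar> \<le> eps \<xi> + 1"
     "\<bar>B \<xi> x y - (dist x (z n) - dist y (z n))\<bar> \<le> eps \<xi> + 1"
     "\<bar>B \<xi> q y - (dist q (z n) - dist y (z n))\<bar> \<le> eps \<xi> + 1"
    using eventually_happens'[OF sequentially_bot ev] by blast
  show "\<bar>B \<xi> x q - (B \<xi> x y - B \<xi> q y)\<bar> \<le> 3 * (eps \<xi> + 1)"
    using n unfolding abs_le_iff by (simp add: algebra_simps)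
  show "\<bar>B \<xi> x y\<bar> \<le> dist x y + (eps \<xi> + 1)"
    using n(2) dist_triangle[of x "z n" y] dist_triangle[of y "z n" x] dist_commute[of x y] by linarith
qed

lemma eps_ge: "\<xi> \<in> Chor \<Longrightarrow> 0 \<le> eps \<xi> + 1"
  using busemann_cocycle(2)[of \<xi> p p] by (metis abs_ge_zero add_0 dist_self order_trans)

lemma infdist_le_near:
  assumes "u \<in> S" "dist u y \<le> r"
  shows "infdist x S \<le> dist x y + r"
  using infdist_le[OF assms(1), of x] dist_triangle2[of x u y] assms(2) dist_triangle[of x u y] dist_commute[of u y]
  by linarith

text \<open>Non-pinching forces sequences converging to \<open>\<xi>\<close> in two shadows to be eventually in both, so
  that the geodesics from \<open>p\<close> pass near both centres.\<close>
lemma shadow_overlap: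
  assumes x: "\<xi> \<in> non_pinched p \<iota> R" "\<xi> \<in> U g" "\<xi> \<in> U g'" and g: "g \<in> \<Gamma>" "g' \<in> \<Gamma>"
    and low: "low Kt (ginv g p)" "low Kt (ginv g' p)"
  shows "dist (g p) (g' p) \<le> \<bar>len g - len g'\<bar> + 4 * near Kt"
proof -
  obtain z where z: "\<And>n. z n \<in> g ` V" "(\<lambda>n. \<iota> (z n)) \<longlonglongrightarrow> \<xi>" using U_seq[OF x(2)] by blast
  obtain z' where z': "\<And>n. z' n \<in> g' ` V" "(\<lambda>n. \<iota> (z' n)) \<longlonglongrightarrow> \<xi>" using U_seq[OF x(3)] by blast
  have b: "\<xi> \<in> boundary \<iota>" using x by (simp add: U_def)
  have tc: "tends_to_class \<iota> (R `` {\<xi>}) w" if "(\<lambda>n. \<iota> (w n)) \<longlonglongrightarrow> \<xi>" for w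
    unfolding tends_to_class_def
    using LIMSEQ_subseq_LIMSEQ[OF that] LIMSEQ_unique class_self[OF b] by (fastforce simp: comp_def)
  have "\<forall>n. \<exists>S. geodesic_segment (z n) (z' n) S" using geodesic by blast
  then obtain S where S: "\<And>n. geodesic_segment (z n) (z' n) (S n)" by metis
  have "escaping p S"
    using x(1) tc[OF z(2)] tc[OF z'(2)] S unfolding non_pinched_def by blast
  hence ev: "\<forall>\<^sub>F n in sequentially. infdist p (S n) > len g + near (sep Kt)"
    unfolding escaping_def filterlim_at_top_dense by blast
  obtain n where n: "infdist p (S n) > len g + near (sep Kt)"
    using eventually_happens'[OF sequentially_bot ev] by blast
  \<comment> \<open>Otherwise the segment from \<open>z n\<close> to \<open>z' n\<close> would pass
    near \<open>g p\<close>, closer to \<open>p\<close> than \<open>n\<close> allows.\<close>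
  have "\<not> low (sep Kt) (ginv g (z' n))"
  proof
    assume "low (sep Kt) (ginv g (z' n))"
    from low_high_translate[OF g(1) this high_of_V[OF g(1) z(1)] geodesic_segment_sym[OF S]]
    obtain u where u: "u \<in> S n" "dist u (g p) \<le> near (sep Kt)" by blast
    show False using infdist_le_near[OF u, of p] n by (simp add: len_def)
  qed
  hence h: "high (sep Kt) (ginv g (z' n))" using low_or_high by blast
  have h': "high (sep Kt) (ginv g' (z' n))" by (rule high_mono[OF high_of_V[OF g(2) z'(1)] sep_Kt(3)])
  obtain T where T: "geodesic_segment p (z' n) T" using geodesic by blast
  obtain u where u: "u \<in> T" "dist u (g p) \<le> near Kt" using low_high_translate[OF g(1) low(1) h T] by blast
  obtain u' where u': "u' \<in> T" "dist u' (g' p) \<le> near Kt" using low_high_translate[OF g(2) low(2) h' T] by blast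
  have "dist u u' = \<bar>dist p u - dist p u'\<bar>" by (rule geodesic_segment_dist_diff[OF T u(1) u'(1)])
  moreover have "\<bar>dist p u - len g\<bar> \<le> near Kt" "\<bar>dist p u' - len g'\<bar> \<le> near Kt"
    using u(2) u'(2) unfolding len_def
    using dist_triangle[of p u "g p"] dist_triangle[of p "g p" u] dist_triangle[of p u' "g' p"]
      dist_triangle[of p "g' p" u'] by (simp_all add: dist_commute abs_le_iff)
  moreover have "dist (g p) (g' p) \<le> dist u (g p) + dist u u' + dist u' (g' p)"
    using dist_triangle3[of "g p" "g' p" u] dist_triangle[of u "g' p" u'] by linarith
  ultimately show ?thesis using u(2) u'(2) by linarith
qed

definition m0 :: nat where "m0 = card (ball (real width + 4 * near Kt))"

text \<open>By \<open>shadow_overlap\<close> the centres of all these shadows are uniformly close to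
  one of them, \<open>g p\<close>, so \<open>ginv g\<close> carries the elements into a fixed
  ball.\<close>

lemma annulus_multiplicity:
  assumes "\<xi> \<in> non_pinched p \<iota> R"
  shows "card {g\<in>annulus n. \<xi> \<in> U g} \<le> m0"
proof (cases "{g\<in>annulus n. \<xi> \<in> U g} = {}")
  case False
  then obtain g where g: "g \<in> annulus n" "\<xi> \<in> U g" by auto
  have gG: "g \<in> \<Gamma>" using g by (simp add: annulus_def)
  let ?f = "\<lambda>g'. ginv g \<circ> g'"
  have inj: "inj_on ?f {g\<in>annulus n. \<xi> \<in> U g}"
  proof (rule inj_onI)
    fix h h' assume "ginv g \<circ> h = ginv g \<circ> h'"
    hence "g \<circ> (ginv g \<circ> h) = g \<circ> (ginv g \<circ> h')" by simp
    thus "h = h'" using ginv_comp(2)[OF gG] by (simp add: o_assoc)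
  qed
  have "?f ` {g\<in>annulus n. \<xi> \<in> U g} \<subseteq> ball (real width + 4 * near Kt)"
  proof
    fix h assume "h \<in> ?f ` {g\<in>annulus n. \<xi> \<in> U g}"
    then obtain g' where g': "g' \<in> annulus n" "\<xi> \<in> U g'" "h = ginv g \<circ> g'" by auto
    have g'G: "g' \<in> \<Gamma>" using g' by (simp add: annulus_def)
    have "dist (g p) (g' p) \<le> \<bar>len g - len g'\<bar> + 4 * near Kt"
      by (rule shadow_overlap[OF assms g(2) g'(2) gG g'G])
        (use annulus_good g g' in \<open>auto simp: good_def\<close>)
    moreover have "\<bar>len g - len g'\<bar> \<le> real width" using g g' by (auto simp: annulus_def)
    ultimately show "h \<in> ball (real width + 4 * near Kt)"
      using comp_in[OF ginv_in[OF gG] g'G] dist_ginv'[OF gG] by (simp add: ball_def len_def g'(3))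
  qed
  from card_mono[OF finite_ball' this] show ?thesis unfolding m0_def card_image[OF inj] .
next
  case True
  thus ?thesis by (simp only: card.empty le0)
qed

text \<open>Both the orbit points \<open>y n\<close> and points converging to \<open>\<xi>\<close> lie in the shadows of \<open>gs m\<close>, so
  geodesics from \<open>q\<close> to them meet a common pair of points near \<open>gs m p\<close>; such pairs are uniformly
  contracting quasi-geodesics.\<close>
lemma horoball_converges:
  assumes x: "\<xi> \<in> Chor"
    and gs: "\<And>m. gs m \<in> \<Gamma>" "\<And>m. \<xi> \<in> U (gs m)" "\<And>m. low Kt (ginv (gs m) q)"
      "filterlim (\<lambda>m. dist q (gs m p)) at_top sequentially"
    and y: "\<And>r. finite {n. dist p (y n) \<le> r}" "\<And>n. B \<xi> (y n) p \<le> L" "(\<lambda>n. \<iota> (y n)) \<longlonglongrightarrow> \<zeta>"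
  shows "\<zeta> \<in> R `` {\<xi>}"
proof -
  \<comment> \<open>If \<open>y n\<close> is low as seen from \<open>gs m\<close>, its Busemann
    value is about its distance to \<open>gs m p\<close> minus a constant. The bound
    \<open>L\<close> then confines it to a ball, which contains only finitely many terms.\<close>
  have ev: "\<exists>N. \<forall>n\<ge>N. high (sep Kt) (ginv (gs m) (y n))" for m
  proof -
    define r where "r = dist p (gs m p) + dist q (gs m p) + err \<xi> + 3 * (eps \<xi> + 1) + L + dist q p + (eps \<xi> + 1)"
    have "dist p (y n) \<le> r" if "\<not> high (sep Kt) (ginv (gs m) (y n))" for n
    proof -
      have low: "low (sep Kt) (ginv (gs m) (y n))" using that low_or_high by blast
      have "\<bar>B \<xi> (y n) q - (dist (y n) (gs m p) - dist q (gs m p))\<bar> \<le> err \<xi>"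
        by (rule busemann_shadow[OF x gs(2,1) low low_mono[OF gs(3) sep_Kt(2)]])
      moreover have "\<bar>B \<xi> (y n) q - (B \<xi> (y n) p - B \<xi> q p)\<bar> \<le> 3 * (eps \<xi> + 1)" "\<bar>B \<xi> q p\<bar> \<le> dist q p + (eps \<xi> + 1)"
        by (rule busemann_cocycle[OF x])+
      moreover have "dist p (y n) \<le> dist p (gs m p) + dist (y n) (gs m p)" by (rule dist_triangle2)
      ultimately show ?thesis using y(2)[of n] unfolding r_def by linarith
    qed
    hence "{n. \<not> high (sep Kt) (ginv (gs m) (y n))} \<subseteq> {n. dist p (y n) \<le> r}" by auto
    hence "finite {n. \<not> high (sep Kt) (ginv (gs m) (y n))}" using y(1) finite_subset by blast
    then obtain N where "\<forall>n\<in>{n. \<not> high (sep Kt) (ginv (gs m) (y n))}. n < N"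
      using finite_nat_set_iff_bounded by blast
    thus ?thesis by (intro exI[of _ N]) (auto simp: not_less[symmetric])
  qed
  then obtain N where N: "\<And>m n. n \<ge> N m \<Longrightarrow> high (sep Kt) (ginv (gs m) (y n))" by metis
  \<comment> \<open>A diagonal choice: \<open>y' m\<close> is far along the shadow of
    \<open>gs m\<close> and still converges to \<open>\<zeta>\<close>.\<close>
  define y' where "y' = (\<lambda>m. y (max m (N m)))"
  have y'h: "high (sep Kt) (ginv (gs m) (y' m))" for m unfolding y'_def by (rule N) simp
  have "filterlim (\<lambda>m. max m (N m)) at_top sequentially"
    by (rule filterlim_at_top_mono[OF filterlim_ident]) auto
  hence y'lim: "(\<lambda>m. \<iota> (y' m)) \<longlonglongrightarrow> \<zeta>" unfolding y'_def by (rule filterlim_compose[OF y(3)])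
  have "\<exists>z. z \<in> gs m ` V \<and> dist (\<iota> z) \<xi> < 1 / real (Suc m)" for m
  proof -
    have "\<xi> \<in> closure (\<iota> ` gs m ` V)" using gs(2)[of m] by (simp add: U_def)
    hence "\<exists>w\<in>\<iota> ` gs m ` V. dist w \<xi> < 1 / real (Suc m)" by (simp add: closure_approachable)
    thus ?thesis by blast
  qed
  then obtain z where z: "\<And>m. z m \<in> gs m ` V" "\<And>m. dist (\<iota> (z m)) \<xi> < 1 / real (Suc m)" by metis
  have zlim: "(\<lambda>m. \<iota> (z m)) \<longlonglongrightarrow> \<xi>"
  proof (rule metric_LIMSEQ_I)
    fix e :: real assume "e > 0"
    then obtain M where M: "1 / real (Suc M) < e" using nat_approx_posE by blast
    have "dist (\<iota> (z n)) \<xi> < e" if "n \<ge> M" for n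
    proof -
      have "1 / real (Suc n) \<le> 1 / real (Suc M)" using that by (simp add: field_simps)
      thus ?thesis using z(2)[of n] M by linarith
    qed
    thus "\<exists>M. \<forall>n\<ge>M. dist (\<iota> (z n)) \<xi> < e" by blast
  qed
  have zh: "high (sep Kt) (ginv (gs m) (z m))" for m
    by (rule high_mono[OF high_of_V[OF gs(1) z(1)] sep_Kt(3)])
  have pass: "\<exists>S u. geodesic_segment q w S \<and> u \<in> S \<and> dist u (gs m p) \<le> near Kt"
    if "high (sep Kt) (ginv (gs m) w)" for m w
  proof -
    obtain S where S: "geodesic_segment q w S" using geodesic by blast
    thus ?thesis using low_high_translate[OF gs(1) gs(3) that S] by blast
  qed
  obtain Sy u where u: "\<And>m. geodesic_segment q (y' m) (Sy m) \<and> u m \<in> Sy m \<and> dist (u m) (gs m p) \<le> near Kt"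
    using pass[OF y'h] by metis
  obtain Sz v where v: "\<And>m. geodesic_segment q (z m) (Sz m) \<and> v m \<in> Sz m \<and> dist (v m) (gs m p) \<le> near Kt"
    using pass[OF zh] by metis
  \<comment> \<open>Both families of geodesics meet the pair, so one class from assumption (B)
    receives both limits.\<close>
  define Y where "Y = (\<lambda>m. {u m, v m})"
  have duv: "dist (u m) (v m) \<le> 2 * near Kt" for m
    using u[of m] v[of m] dist_triangle2[of "u m" "v m" "gs m p"] by linarith
  have "escaping p Y"
    unfolding escaping_def
  proof (rule filterlim_at_top_mono)
    show "filterlim (\<lambda>m. - (near Kt + dist p q) + dist q (gs m p)) at_top sequentially"
      by (rule filterlim_tendsto_add_at_top[OF tendsto_const gs(4)])
    have le: "dist p w \<ge> - (near Kt + dist p q) + dist q (gs m p)" if "w \<in> Y m" for m w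
    proof -
      have "dist w (gs m p) \<le> near Kt" using that u[of m] v[of m] by (auto simp: Y_def)
      thus ?thesis using dist_triangle[of q "gs m p" p] dist_triangle[of p "gs m p" w] dist_commute[of p q] by linarith
    qed
    have "infdist p (Y m) \<ge> - (near Kt + dist p q) + dist q (gs m p)" for m
    proof -
      have ne: "Y m \<noteq> {}" by (simp add: Y_def)
      show ?thesis unfolding infdist_notempty[OF ne] by (rule cINF_greatest[OF ne le])
    qed
    thus "\<forall>\<^sub>F m in sequentially. - (near Kt + dist p q) + dist q (gs m p) \<le> infdist p (Y m)" by simp
  qed
  moreover have "quasi_geodesic 1 (2 * near Kt + 1) (Y m) \<and> contracting_set (2 * near Kt) (Y m)" for m
    unfolding Y_def using quasi_geodesic_pair[OF duv] contracting_pair[OF duv] by blast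
  ultimately have "\<exists>r. strict_mono r \<and> (\<exists>\<theta>\<in>boundary \<iota>. \<forall>w \<eta>.
      (\<forall>n. w n \<in> cone q (Y (r n))) \<longrightarrow> (\<lambda>n. \<iota> (w n)) \<longlonglongrightarrow> \<eta> \<longrightarrow> \<eta> \<in> R `` {\<theta>})"
    by (intro cones[unfolded assumption_B_def, THEN spec, of "2 * near Kt", THEN spec, of 1, THEN spec,
      of "2 * near Kt + 1", THEN spec, of Y, THEN spec, of q, THEN mp, THEN mp] allI)
  then obtain r \<theta> where r: "strict_mono r" and t: "\<forall>w \<eta>. (\<forall>n. w n \<in> cone q (Y (r n))) \<longrightarrow>
      (\<lambda>n. \<iota> (w n)) \<longlonglongrightarrow> \<eta> \<longrightarrow> \<eta> \<in> R `` {\<theta>}"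
    by (elim exE conjE bexE) (rule that)
  note limit = t[THEN spec, THEN spec, THEN mp, THEN mp]
  have "\<zeta> \<in> R `` {\<theta>}"
  proof (rule limit)
    show "(\<lambda>n. \<iota> (y' (r n))) \<longlonglongrightarrow> \<zeta>" using LIMSEQ_subseq_LIMSEQ[OF y'lim r] by (simp add: comp_def)
    show "\<forall>n. y' (r n) \<in> cone q (Y (r n))" using u by (auto simp: cone_def Y_def)
  qed
  moreover have "\<xi> \<in> R `` {\<theta>}"
  proof (rule limit)
    show "(\<lambda>n. \<iota> (z (r n))) \<longlonglongrightarrow> \<xi>" using LIMSEQ_subseq_LIMSEQ[OF zlim r] by (simp add: comp_def)
    show "\<forall>n. z (r n) \<in> cone q (Y (r n))" using v by (auto simp: cone_def Y_def)
  qed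
  moreover have "sym R" "trans R" using equiv by (auto simp: equiv_def)
  ultimately show ?thesis by (meson Image_singleton_iff symD transD)
qed

end

section \<open>Radon-Nikodym cocycles\<close>

lemma sets_Collect_Ball_countable:
  assumes "countable X" "\<And>i. i \<in> X \<Longrightarrow> {x\<in>space M. P i x} \<in> sets M"
  shows "{x\<in>space M. \<forall>i\<in>X. P i x} \<in> sets M"
proof (cases "X = {}")
  case False
  hence "{x\<in>space M. \<forall>i\<in>X. P i x} = (\<Inter>i\<in>X. {x\<in>space M. P i x})" by auto
  thus ?thesis using assms False by (auto intro!: sets.countable_INT')
qed simp

locale density_action =
  boundary_action a k c C \<Gamma> shift \<omega> c1 c2 \<iota> R Chor B eps act
  for a :: "int \<Rightarrow> 'a::metric_space" and k c C \<Gamma> shift \<omega> c1 c2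
    and \<iota> :: "'a \<Rightarrow> 'b::metric_space" and R Chor B eps act +
  fixes \<mu> :: "'a \<Rightarrow> 'b measure" and \<kappa> :: real and H :: "('a \<Rightarrow> 'a) set"
  assumes mu_finite: "finite_measure (\<mu> x)"
    and mu_sets: "sets (\<mu> x) = sets (boundary_borel \<iota>)"
    and mu_act: "g \<in> \<Gamma> \<Longrightarrow> distr (\<mu> x) (boundary_borel \<iota>) (act g) = \<mu> (g x)"
    and kappa_ge1: "\<kappa> \<ge> 1"
    and mu_ac: "absolutely_continuous (\<mu> y) (\<mu> x)"
    and mu_RN: "AE \<xi> in \<mu> y. \<xi> \<in> Chor \<and>
           ennreal (exp (- \<omega> * B \<xi> x y) / \<kappa>) \<le> RN_deriv (\<mu> y) (\<mu> x) \<xi> \<and>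
           RN_deriv (\<mu> y) (\<mu> x) \<xi> \<le> ennreal (\<kappa> * exp (- \<omega> * B \<xi> x y))"
    and H_sub: "H \<subseteq> \<Gamma>" and H_infinite: "infinite H"
    and H_ginv: "h \<in> H \<Longrightarrow> ginv h \<in> H"
    and H_conj: "g \<in> \<Gamma> \<Longrightarrow> h \<in> H \<Longrightarrow> g \<circ> h \<circ> ginv g \<in> H"
begin

abbreviation M :: "'b measure" where "M \<equiv> \<mu> p"

lemma mu_space: "space (\<mu> x) = boundary \<iota>"
  using sets_eq_imp_space_eq[OF mu_sets] by (simp add: space_restrict_space)

lemma mu_sets_eq: "sets (\<mu> x) = sets (\<mu> y)"
  by (simp add: mu_sets)

lemma act_measurable:
  assumes "g \<in> \<Gamma>"
  shows "act g \<in> boundary_borel \<iota> \<rightarrow>\<^sub>M boundary_borel \<iota>"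
proof (rule measurable_restrict_space3)
  show "act g \<in> borel \<rightarrow>\<^sub>M borel" by (rule borel_measurable_continuous_onI[OF act_cont[OF assms]])
  show "act g \<in> boundary \<iota> \<rightarrow> boundary \<iota>" using act_boundary[OF assms] by auto
qed

lemma act_measurable_mu: "g \<in> \<Gamma> \<Longrightarrow> act g \<in> \<mu> x \<rightarrow>\<^sub>M \<mu> y"
  using act_measurable by (simp cong: measurable_cong_sets add: mu_sets)

lemma mu_act_emeasure:
  assumes "g \<in> \<Gamma>" "E \<in> sets M"
  shows "emeasure (\<mu> (g x)) E = emeasure (\<mu> x) (act g -` E \<inter> space M)"
proof -
  have "emeasure (\<mu> (g x)) E = emeasure (distr (\<mu> x) (boundary_borel \<iota>) (act g)) E"
    using mu_act[OF assms(1)] by simp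
  also have "\<dots> = emeasure (\<mu> x) (act g -` E \<inter> space (\<mu> x))"
    by (rule emeasure_distr) (use act_measurable[OF assms(1)] assms(2) mu_sets in \<open>simp_all cong: measurable_cong_sets\<close>)
  finally show ?thesis by (simp only: mu_space)
qed

lemma U_sets: "U g \<in> sets M"
  unfolding mu_sets U_def by (auto simp: sets_restrict_space)

text \<open>\<open>enn2real\<close> sends infinity to 0, but the upper bound in \<open>mu_RN\<close>
  makes the derivative finite almost everywhere.\<close>

definition F :: "('a \<Rightarrow> 'a) \<Rightarrow> 'b \<Rightarrow> real" where
  "F g \<xi> = enn2real (RN_deriv M (\<mu> (g p)) \<xi>)"

lemma F_measurable: "F g \<in> borel_measurable M"
  unfolding F_def by measurable

lemma countable_in: "countable \<Gamma>"
proof -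
  have "g \<in> (\<Union>n::nat. ball (real n))" if "g \<in> \<Gamma>" for g
    using that real_arch_simple[of "len g"] by (auto simp: ball_def)
  hence "\<Gamma> \<subseteq> (\<Union>n::nat. ball (real n))" by blast
  moreover have "countable (\<Union>n::nat. ball (real n))"
    using finite_ball' by (intro countable_UN) (auto intro: countable_finite)
  ultimately show ?thesis by (rule countable_subset)
qed

lemma sigma_finite_mu: "sigma_finite_measure (\<mu> x)"
  using mu_finite by (simp add: finite_measure_def)

lemma density_RN: "density M (RN_deriv M (\<mu> x)) = \<mu> x"
  by (rule sigma_finite_measure.density_RN_deriv[OF sigma_finite_mu mu_ac mu_sets_eq])

lemma RN_F: "AE \<xi> in M. ennreal (F g \<xi>) = RN_deriv M (\<mu> (g p)) \<xi>"
  using mu_RN[where y = p and x = "g p"]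
proof eventually_elim
  case (elim \<xi>)
  hence "RN_deriv M (\<mu> (g p)) \<xi> < \<infinity>"
    using order_le_less_trans ennreal_less_top unfolding infinity_ennreal_def by blast
  thus ?case unfolding infinity_ennreal_def unfolding F_def by (rule ennreal_enn2real)
qed

text \<open>By equivariance \<open>M\<close> is the image under \<open>act g\<close> of the measure
  based at \<open>ginv g p\<close>.\<close>

lemma change_var:
  assumes g: "g \<in> \<Gamma>" and E: "E \<in> sets M"
  shows "emeasure M E = (\<integral>\<^sup>+\<xi>. ennreal (F (ginv g) \<xi>) * indicator E (act g \<xi>) \<partial>M)"
proof -
  have S: "act g -` E \<inter> space M \<in> sets M" by (rule measurable_sets[OF act_measurable_mu[OF g] E])
  have "emeasure M E = emeasure (\<mu> (ginv g p)) (act g -` E \<inter> space M)"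
    using mu_act_emeasure[OF g E, of "ginv g p"] ginv_simps(2)[OF g] by simp
  also have "\<dots> = emeasure (density M (RN_deriv M (\<mu> (ginv g p)))) (act g -` E \<inter> space M)"
    by (simp only: density_RN)
  also have "\<dots> = (\<integral>\<^sup>+\<xi>. RN_deriv M (\<mu> (ginv g p)) \<xi> * indicator (act g -` E \<inter> space M) \<xi> \<partial>M)"
    by (rule emeasure_density[OF borel_measurable_RN_deriv S])
  also have "\<dots> = (\<integral>\<^sup>+\<xi>. ennreal (F (ginv g) \<xi>) * indicator E (act g \<xi>) \<partial>M)"
    by (rule nn_integral_cong_AE, use RN_F[of "ginv g"] AE_space in eventually_elim)
      (auto simp: indicator_def)
  finally show ?thesis .
qed

lemma F_id_AE: "AE \<xi> in M. F id \<xi> = 1"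
proof -
  have "AE \<xi> in M. (\<lambda>_. 1) \<xi> = RN_deriv M M \<xi>"
    by (rule RN_deriv_unique_sigma_finite[OF _ density_1 sigma_finite_mu]) simp
  thus ?thesis by eventually_elim (simp add: F_def flip: id_def)
qed

text \<open>Both sides are densities against \<open>M\<close> of the measure based at
  \<open>(ginv g \<circ> h) p\<close>, the left one by a chain rule through \<open>ginv g p\<close>;
  they agree almost everywhere by uniqueness.\<close>

lemma F_cocycle_AE:
  assumes g: "g \<in> \<Gamma>" and h: "h \<in> \<Gamma>"
  shows "AE \<xi> in M. F h (act g \<xi>) * F (ginv g) \<xi> = F (ginv g \<circ> h) \<xi>"
proof -
  let ?f = "\<lambda>\<xi>. RN_deriv M (\<mu> (ginv g p)) \<xi> * RN_deriv M (\<mu> (h p)) (act g \<xi>)"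
  let ?N = "\<mu> ((ginv g \<circ> h) p)"
  have gi: "ginv g \<in> \<Gamma>" by (rule ginv_in[OF g])
  have Rh: "(\<lambda>\<xi>. RN_deriv M (\<mu> (h p)) (act g \<xi>)) \<in> borel_measurable (\<mu> x)" for x
    by (rule measurable_compose[OF act_measurable_mu[OF g, where y = p] borel_measurable_RN_deriv])
  have fm: "?f \<in> borel_measurable M" using Rh by measurable
  have "density M ?f = ?N"
  proof (rule measure_eqI)
    show "sets (density M ?f) = sets ?N" by (simp add: mu_sets)
    fix D assume "D \<in> sets (density M ?f)"
    hence D: "D \<in> sets M" by simp
    have S: "act (ginv g) -` D \<inter> space M \<in> sets M" by (rule measurable_sets[OF act_measurable_mu[OF gi] D])
    have "emeasure ?N D = emeasure (\<mu> (h p)) (act (ginv g) -` D \<inter> space M)"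
      using mu_act_emeasure[OF gi D, of "h p"] by simp
    also have "\<dots> = emeasure (density M (RN_deriv M (\<mu> (h p)))) (act (ginv g) -` D \<inter> space M)"
      by (simp only: density_RN)
    also have "\<dots> = (\<integral>\<^sup>+\<zeta>. RN_deriv M (\<mu> (h p)) \<zeta> * indicator (act (ginv g) -` D \<inter> space M) \<zeta> \<partial>M)"
      by (rule emeasure_density[OF borel_measurable_RN_deriv S])
    \<comment> \<open>\<open>M\<close> is written as an image under \<open>act g\<close>, so that
      the integral can be pulled back.\<close>
    also have "\<dots> = (\<integral>\<^sup>+\<zeta>. RN_deriv M (\<mu> (h p)) \<zeta> * indicator (act (ginv g) -` D \<inter> space M) \<zeta>
        \<partial>distr (\<mu> (ginv g p)) M (act g))"
    proof -
      have "distr (\<mu> (ginv g p)) M (act g) = distr (\<mu> (ginv g p)) (boundary_borel \<iota>) (act g)"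
        by (rule distr_cong) (simp_all add: mu_sets)
      also have "\<dots> = M" using mu_act[OF g, of "ginv g p"] ginv_simps(2)[OF g] by simp
      finally show ?thesis by simp
    qed
    also have "\<dots> = (\<integral>\<^sup>+\<xi>. RN_deriv M (\<mu> (h p)) (act g \<xi>) * indicator (act (ginv g) -` D \<inter> space M) (act g \<xi>) \<partial>\<mu> (ginv g p))"
      by (rule nn_integral_distr[OF act_measurable_mu[OF g]]) (use S in measurable)
    also have "\<dots> = (\<integral>\<^sup>+\<xi>. RN_deriv M (\<mu> (h p)) (act g \<xi>) * indicator D \<xi> \<partial>\<mu> (ginv g p))"
      by (rule nn_integral_cong) (use act_ginv[OF g] act_boundary[OF g] in \<open>auto simp: indicator_def mu_space\<close>)
    also have "\<dots> = (\<integral>\<^sup>+\<xi>. RN_deriv M (\<mu> (h p)) (act g \<xi>) * indicator D \<xi> \<partial>density M (RN_deriv M (\<mu> (ginv g p))))"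
      by (simp only: density_RN)
    also have "\<dots> = (\<integral>\<^sup>+\<xi>. RN_deriv M (\<mu> (ginv g p)) \<xi> * (RN_deriv M (\<mu> (h p)) (act g \<xi>) * indicator D \<xi>) \<partial>M)"
      by (rule nn_integral_density) (use Rh D in measurable)
    also have "\<dots> = emeasure (density M ?f) D"
      by (subst emeasure_density[OF fm D]) (simp only: mult.assoc)
    finally show "emeasure (density M ?f) D = emeasure ?N D" by simp
  qed
  hence "AE \<xi> in M. ?f \<xi> = RN_deriv M ?N \<xi>"
    by (rule RN_deriv_unique_sigma_finite[OF fm _ sigma_finite_mu])
  thus ?thesis
  proof eventually_elim
    case (elim \<xi>)
    show ?case unfolding F_def elim[symmetric] by (simp add: enn2real_mult mult.commute)
  qed
qed

section \<open>An invariant set of full measure and its strata\<close>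

definition regular :: "'b \<Rightarrow> bool" where
  "regular \<xi> \<longleftrightarrow> \<xi> \<in> Chor \<and> F id \<xi> = 1 \<and>
     (\<forall>g\<in>\<Gamma>. exp (- \<omega> * B \<xi> (g p) p) / \<kappa> \<le> F g \<xi> \<and> F g \<xi> \<le> \<kappa> * exp (- \<omega> * B \<xi> (g p) p)) \<and>
     (\<forall>g\<in>\<Gamma>. \<forall>h\<in>\<Gamma>. F h (act g \<xi>) * F (ginv g) \<xi> = F (ginv g \<circ> h) \<xi>)"

lemma AE_regular: "AE \<xi> in M. regular \<xi>"
proof -
  have bounds: "AE \<xi> in M. \<xi> \<in> Chor \<and> exp (- \<omega> * B \<xi> (g p) p) / \<kappa> \<le> F g \<xi> \<and> F g \<xi> \<le> \<kappa> * exp (- \<omega> * B \<xi> (g p) p)" for g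
    using mu_RN[where y = p and x = "g p"] RN_F[of g]
  proof eventually_elim
    case (elim \<xi>)
    hence "ennreal (exp (- \<omega> * B \<xi> (g p) p) / \<kappa>) \<le> ennreal (F g \<xi>)"
      "ennreal (F g \<xi>) \<le> ennreal (\<kappa> * exp (- \<omega> * B \<xi> (g p) p))" by (simp_all only:)
    moreover have "F g \<xi> \<ge> 0" "\<kappa> * exp (- \<omega> * B \<xi> (g p) p) \<ge> 0"
      using kappa_ge1 by (simp_all add: F_def)
    ultimately show ?case using elim(1) by (simp only: ennreal_le_iff)
  qed
  have 1: "AE \<xi> in M. \<forall>g\<in>\<Gamma>. \<xi> \<in> Chor \<and> exp (- \<omega> * B \<xi> (g p) p) / \<kappa> \<le> F g \<xi> \<and> F g \<xi> \<le> \<kappa> * exp (- \<omega> * B \<xi> (g p) p)"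
    unfolding AE_ball_countable[OF countable_in] by (intro ballI bounds)
  have 2: "AE \<xi> in M. \<forall>g\<in>\<Gamma>. \<forall>h\<in>\<Gamma>. F h (act g \<xi>) * F (ginv g) \<xi> = F (ginv g \<circ> h) \<xi>"
    unfolding AE_ball_countable[OF countable_in] by (intro ballI F_cocycle_AE)
  show ?thesis using 1 2 F_id_AE
  proof eventually_elim
    case (elim \<xi>)
    thus ?case using id_in unfolding regular_def by blast
  qed
qed

text \<open>A null set is fixed because \<open>regular\<close> refers to \<open>Chor\<close>, which
  need not be measurable.\<close>

definition N0 :: "'b set" where
  "N0 = (SOME N. N \<in> null_sets M \<and> (\<forall>\<xi>\<in>space M - N. regular \<xi>))"

lemma N0: "N0 \<in> null_sets M" "\<xi> \<in> space M \<Longrightarrow> \<xi> \<notin> N0 \<Longrightarrow> regular \<xi>"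
proof -
  obtain N where "N \<in> null_sets M" "\<And>\<xi>. \<xi> \<in> space M - N \<Longrightarrow> regular \<xi>"
    using AE_E3[OF AE_regular] by blast
  hence "\<exists>N. N \<in> null_sets M \<and> (\<forall>\<xi>\<in>space M - N. regular \<xi>)" by blast
  from someI_ex[OF this] show "N0 \<in> null_sets M" "\<xi> \<in> space M \<Longrightarrow> \<xi> \<notin> N0 \<Longrightarrow> regular \<xi>"
    by (auto simp: N0_def[symmetric])
qed

text \<open>Since \<open>\<Gamma>\<close> is countable, avoiding all translates of \<open>N0\<close>
  gives a set that is measurable and invariant.\<close>

definition F1 :: "'b set" where "F1 = {\<xi>\<in>space M. \<forall>g\<in>\<Gamma>. act g \<xi> \<notin> N0}"

lemma AE_F1: "AE \<xi> in M. \<xi> \<in> F1"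
proof -
  have "AE \<xi> in M. act g \<xi> \<notin> N0" if g: "g \<in> \<Gamma>" for g
  proof -
    have "N0 \<in> null_sets (\<mu> (g p))" using mu_ac N0(1) by (auto simp: absolutely_continuous_def)
    moreover have "N0 \<in> sets M" using N0(1) by auto
    ultimately have "emeasure M (act g -` N0 \<inter> space M) = 0"
      using mu_act_emeasure[OF g, of N0 p] by auto
    hence "act g -` N0 \<inter> space M \<in> null_sets M"
      using measurable_sets[OF act_measurable_mu[OF g] \<open>N0 \<in> sets M\<close>] by (auto simp: null_sets_def)
    from AE_not_in[OF this] AE_space show ?thesis by eventually_elim auto
  qed
  hence "AE \<xi> in M. \<forall>g\<in>\<Gamma>. act g \<xi> \<notin> N0" unfolding AE_ball_countable[OF countable_in] by blast
  thus ?thesis using AE_space by eventually_elim (auto simp: F1_def)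
qed

lemma F1_regular: "\<xi> \<in> F1 \<Longrightarrow> regular \<xi>"
  using N0(2)[of \<xi>] id_in act_id by (auto simp: F1_def id_def) 

lemma F1_act: "\<xi> \<in> F1 \<Longrightarrow> g \<in> \<Gamma> \<Longrightarrow> act g \<xi> \<in> F1"
  using act_boundary act_comp comp_in by (auto simp: F1_def mu_space) (metis comp_apply)

text \<open>The strata are cut out by inequalities between the functions \<open>F\<close>, not by
  the size of \<open>eps\<close>: countably many inequalities give a measurable set, and the cocycle
  relation makes it invariant.\<close>

definition Z :: "nat \<Rightarrow> 'b set" where
  "Z n = {\<xi>\<in>F1. (\<forall>g\<in>\<Gamma>. \<forall>h\<in>\<Gamma>. F g \<xi> \<le> exp (\<omega> * dist (g p) (h p) + real n) * F h \<xi>) \<and>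
     (\<forall>g\<in>\<Gamma>. \<forall>h\<in>\<Gamma>. \<forall>h'\<in>\<Gamma>. \<xi> \<in> U g \<and> good (ginv g \<circ> h) \<and> good (ginv g \<circ> h') \<longrightarrow>
       \<bar>ln (F h \<xi>) - ln (F h' \<xi>) + \<omega> * (dist (h p) (g p) - dist (h' p) (g p))\<bar> \<le> real n)}"

lemma F_pos: "\<xi> \<in> F1 \<Longrightarrow> g \<in> \<Gamma> \<Longrightarrow> F g \<xi> > 0"
  using F1_regular[of \<xi>] kappa_ge1 unfolding regular_def
  by (metis divide_pos_pos exp_gt_zero less_le_trans zero_less_one)

lemma ln_F:
  assumes "\<xi> \<in> F1" "g \<in> \<Gamma>"
  shows "\<bar>ln (F g \<xi>) + \<omega> * B \<xi> (g p) p\<bar> \<le> ln \<kappa>"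
proof -
  have b: "exp (- \<omega> * B \<xi> (g p) p) / \<kappa> \<le> F g \<xi>" "F g \<xi> \<le> \<kappa> * exp (- \<omega> * B \<xi> (g p) p)"
    using F1_regular[OF assms(1)] assms(2) by (auto simp: regular_def)
  have l: "\<kappa> > 0" using kappa_ge1 by simp
  have pos: "F g \<xi> > 0" by (rule F_pos[OF assms])
  have "ln (F g \<xi>) \<le> ln (\<kappa> * exp (- \<omega> * B \<xi> (g p) p))" by (rule ln_mono[OF b(2) pos])
  also have "\<dots> = ln \<kappa> - \<omega> * B \<xi> (g p) p" using l by (simp add: ln_mult)
  finally have 1: "ln (F g \<xi>) \<le> ln \<kappa> - \<omega> * B \<xi> (g p) p" .
  have "ln (exp (- \<omega> * B \<xi> (g p) p) / \<kappa>) \<le> ln (F g \<xi>)" by (rule ln_mono[OF b(1)]) (use l in simp)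
  moreover have "ln (exp (- \<omega> * B \<xi> (g p) p) / \<kappa>) = - \<omega> * B \<xi> (g p) p - ln \<kappa>" using l by (simp add: ln_div)
  ultimately show ?thesis using 1 by (simp add: abs_le_iff)
qed

lemma Z_cover:
  assumes x: "\<xi> \<in> F1"
  shows "\<exists>n. \<xi> \<in> Z n"
proof -
  have xC: "\<xi> \<in> Chor" using F1_regular[OF x] by (simp add: regular_def)
  \<comment> \<open>The cocycle error contributes \<open>3 * (eps \<xi> + 1)\<close> to both
    conditions; the Lipschitz bound adds one more such term to the first, and
    \<open>busemann_shadow\<close> adds \<open>err \<xi>\<close> to the second.\<close>
  define b where "b = 4 * (eps \<xi> + 1) + err \<xi>"
  have e0: "0 \<le> eps \<xi> + 1" by (rule eps_ge[OF xC])
  have err0: "0 \<le> err \<xi>" using e0 sep_Kt(4) by (simp add: err_def)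
  obtain n :: nat where n: "2 * ln \<kappa> + \<omega> * b \<le> real n" using real_arch_simple by blast
  have 1: "F g \<xi> \<le> exp (\<omega> * dist (g p) (h p) + real n) * F h \<xi>" if g: "g \<in> \<Gamma>" and h: "h \<in> \<Gamma>" for g h
  proof -
    have "B \<xi> (h p) p - B \<xi> (g p) p \<le> dist (g p) (h p) + b"
      using busemann_cocycle(1)[OF xC, of "h p" "g p" p] busemann_cocycle(2)[OF xC, of "h p" "g p"] err0
      unfolding b_def abs_le_iff by (simp add: dist_commute algebra_simps)
    hence "\<omega> * (B \<xi> (h p) p - B \<xi> (g p) p) \<le> \<omega> * (dist (g p) (h p) + b)"
      using omega_pos by (intro mult_left_mono) auto
    hence "\<omega> * B \<xi> (h p) p - \<omega> * B \<xi> (g p) p \<le> \<omega> * dist (g p) (h p) + \<omega> * b"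
      by (simp only: distrib_left right_diff_distrib)
    hence "ln (F g \<xi>) \<le> (\<omega> * dist (g p) (h p) + real n) + ln (F h \<xi>)"
      using ln_F[OF x g] ln_F[OF x h] n by linarith
    hence "exp (ln (F g \<xi>)) \<le> exp ((\<omega> * dist (g p) (h p) + real n) + ln (F h \<xi>))" by (simp only: exp_le_cancel_iff)
    thus ?thesis unfolding exp_add[of "\<omega> * dist (g p) (h p) + real n"]
      using F_pos[OF x g] F_pos[OF x h] by simp
  qed
  have 2: "\<bar>ln (F h \<xi>) - ln (F h' \<xi>) + \<omega> * (dist (h p) (g p) - dist (h' p) (g p))\<bar> \<le> real n"
    if g: "g \<in> \<Gamma>" and h: "h \<in> \<Gamma>" "h' \<in> \<Gamma>" and u: "\<xi> \<in> U g" "good (ginv g \<circ> h)" "good (ginv g \<circ> h')" for g h h'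
  proof -
    have low: "low (sep Kt) (ginv g (h p))" "low (sep Kt) (ginv g (h' p))"
      using u low_mono[OF _ sep_Kt(2)] by (auto simp: good_def)
    have "\<bar>B \<xi> (h p) (h' p) - (dist (h p) (g p) - dist (h' p) (g p))\<bar> \<le> err \<xi>"
      by (rule busemann_shadow[OF xC u(1) g low])
    hence "\<bar>B \<xi> (h p) p - B \<xi> (h' p) p - (dist (h p) (g p) - dist (h' p) (g p))\<bar> \<le> b"
      using busemann_cocycle(1)[OF xC, of "h p" "h' p" p] e0 unfolding b_def abs_le_iff by (simp add: algebra_simps)
    hence "\<bar>\<omega> * (B \<xi> (h p) p - B \<xi> (h' p) p - (dist (h p) (g p) - dist (h' p) (g p)))\<bar> \<le> \<omega> * b"
      using omega_pos by (simp add: abs_mult)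
    hence "\<bar>\<omega> * B \<xi> (h p) p - \<omega> * B \<xi> (h' p) p - \<omega> * (dist (h p) (g p) - dist (h' p) (g p))\<bar> \<le> \<omega> * b"
      by (simp only: right_diff_distrib)
    thus ?thesis using ln_F[OF x h(1)] ln_F[OF x h(2)] n by linarith
  qed
  show ?thesis unfolding Z_def using x 1 2 by blast
qed

lemma F1_sets: "F1 \<in> sets M"
proof -
  have "{\<xi>\<in>space M. act g \<xi> \<notin> N0} \<in> sets M" if "g \<in> \<Gamma>" for g
  proof -
    have "act g -` N0 \<inter> space M \<in> sets M" using measurable_sets[OF act_measurable_mu[OF that]] N0(1) by blast
    moreover have "{\<xi>\<in>space M. act g \<xi> \<notin> N0} = space M - (act g -` N0 \<inter> space M)" by auto
    ultimately show ?thesis by auto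
  qed
  thus ?thesis unfolding F1_def by (intro sets_Collect_Ball_countable[OF countable_in])
qed

lemma Z_sets: "Z n \<in> sets M"
proof -
  have m[measurable]: "F g \<in> borel_measurable M" for g by (rule F_measurable)
  have u[measurable]: "U g \<in> sets M" for g by (rule U_sets)
  have 1: "{\<xi>\<in>space M. \<forall>g\<in>\<Gamma>. \<forall>h\<in>\<Gamma>. F g \<xi> \<le> exp (\<omega> * dist (g p) (h p) + real n) * F h \<xi>} \<in> sets M"
    by (intro sets_Collect_Ball_countable[OF countable_in]) measurable
  have 2: "{\<xi>\<in>space M. \<forall>g\<in>\<Gamma>. \<forall>h\<in>\<Gamma>. \<forall>h'\<in>\<Gamma>. \<xi> \<in> U g \<and> good (ginv g \<circ> h) \<and> good (ginv g \<circ> h') \<longrightarrow>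
       \<bar>ln (F h \<xi>) - ln (F h' \<xi>) + \<omega> * (dist (h p) (g p) - dist (h' p) (g p))\<bar> \<le> real n} \<in> sets M"
    by (intro sets_Collect_Ball_countable[OF countable_in]) measurable
  have "F1 \<subseteq> space M" by (auto simp: F1_def)
  hence eq: "Z n = F1 \<inter> {\<xi>\<in>space M. \<forall>g\<in>\<Gamma>. \<forall>h\<in>\<Gamma>. F g \<xi> \<le> exp (\<omega> * dist (g p) (h p) + real n) * F h \<xi>} \<inter>
    {\<xi>\<in>space M. \<forall>g\<in>\<Gamma>. \<forall>h\<in>\<Gamma>. \<forall>h'\<in>\<Gamma>. \<xi> \<in> U g \<and> good (ginv g \<circ> h) \<and> good (ginv g \<circ> h') \<longrightarrow>
       \<bar>ln (F h \<xi>) - ln (F h' \<xi>) + \<omega> * (dist (h p) (g p) - dist (h' p) (g p))\<bar> \<le> real n}"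
    unfolding Z_def by blast
  show ?thesis unfolding eq by (intro sets.Int F1_sets 1 2)
qed

lemma F_cocycle: "\<xi> \<in> F1 \<Longrightarrow> g \<in> \<Gamma> \<Longrightarrow> h \<in> \<Gamma> \<Longrightarrow> F h (act g \<xi>) * F (ginv g) \<xi> = F (ginv g \<circ> h) \<xi>"
  using F1_regular by (simp add: regular_def)

lemma Z_F1: "\<xi> \<in> Z n \<Longrightarrow> \<xi> \<in> F1" by (simp add: Z_def)

text \<open>Each condition compares two densities at the same point, so the factor
  \<open>F (ginv u) \<xi>\<close> from the cocycle relation cancels.\<close>

lemma Z_act:
  assumes u: "u \<in> \<Gamma>" and x: "\<xi> \<in> Z n"
  shows "act u \<xi> \<in> Z n"
proof -
  have xF: "\<xi> \<in> F1" using x by (rule Z_F1)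
  have ui: "ginv u \<in> \<Gamma>" by (rule ginv_in[OF u])
  have pos: "F (ginv u) \<xi> > 0" by (rule F_pos[OF xF ui])
  have 1: "F g (act u \<xi>) \<le> exp (\<omega> * dist (g p) (h p) + real n) * F h (act u \<xi>)"
    if g: "g \<in> \<Gamma>" and h: "h \<in> \<Gamma>" for g h
  proof -
    have "F (ginv u \<circ> g) \<xi> \<le> exp (\<omega> * dist ((ginv u \<circ> g) p) ((ginv u \<circ> h) p) + real n) * F (ginv u \<circ> h) \<xi>"
      using x comp_in[OF ui g] comp_in[OF ui h] unfolding Z_def by blast
    hence "F g (act u \<xi>) * F (ginv u) \<xi> \<le> (exp (\<omega> * dist (g p) (h p) + real n) * F h (act u \<xi>)) * F (ginv u) \<xi>"
      unfolding F_cocycle[OF xF u g, symmetric] F_cocycle[OF xF u h, symmetric]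
      using isom_in[OF ui] by (simp add: mult.assoc)
    thus ?thesis using pos by (rule mult_right_le_imp_le)
  qed
  have lnF: "ln (F h (act u \<xi>)) = ln (F (ginv u \<circ> h) \<xi>) - ln (F (ginv u) \<xi>)" if h: "h \<in> \<Gamma>" for h
    unfolding F_cocycle[OF xF u h, symmetric]
    using pos F_pos[OF F1_act[OF xF u] h] by (simp add: ln_mult)
  have 2: "\<bar>ln (F h (act u \<xi>)) - ln (F h' (act u \<xi>)) + \<omega> * (dist (h p) (g p) - dist (h' p) (g p))\<bar> \<le> real n"
    if g: "g \<in> \<Gamma>" and h: "h \<in> \<Gamma>" "h' \<in> \<Gamma>" and v: "act u \<xi> \<in> U g" "good (ginv g \<circ> h)" "good (ginv g \<circ> h')" for g h h'
  proof -
    let ?g = "ginv u \<circ> g"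
    have gG: "?g \<in> \<Gamma>" by (rule comp_in[OF ui g])
    have xU: "\<xi> \<in> U ?g" using U_act[OF g u] v(1) by simp
    have eq: "ginv ?g \<circ> (ginv u \<circ> w) = ginv g \<circ> w" for w
    proof
      fix y
      have "?g (ginv g (w y)) = (ginv u \<circ> w) y" using ginv_simps(2)[OF g] by simp
      hence "ginv ?g ((ginv u \<circ> w) y) = ginv g (w y)" using ginv_simps(1)[OF gG] by metis
      thus "(ginv ?g \<circ> (ginv u \<circ> w)) y = (ginv g \<circ> w) y" by simp
    qed
    have "\<bar>ln (F (ginv u \<circ> h) \<xi>) - ln (F (ginv u \<circ> h') \<xi>) +
      \<omega> * (dist ((ginv u \<circ> h) p) (?g p) - dist ((ginv u \<circ> h') p) (?g p))\<bar> \<le> real n"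
      using x gG comp_in[OF ui h(1)] comp_in[OF ui h(2)] xU v(2,3) unfolding Z_def mem_Collect_eq
      by (metis eq)
    thus ?thesis using lnF[OF h(1)] lnF[OF h(2)] isom_in[OF ui] by simp
  qed
  show ?thesis using F1_act[OF xF u] 1 2 unfolding Z_def by blast
qed

end

section \<open>Unbounded densities, conical points and horospheric limit points\<close>

context density_action
begin

lemma quasi_conformal:
  assumes s: "s \<in> \<Gamma>" "\<And>\<xi>. \<xi> \<in> boundary \<iota> \<Longrightarrow> \<xi> \<in> U id \<or> act s \<xi> \<in> U id"
  shows "quasi_conformal_normal_subgroup M \<Gamma> act F p \<omega> (real n) U good (Z n) s annulus width m0 (c1 / 2) H"
proof (intro quasi_conformal_normal_subgroup.intro quasi_conformal_action.intro
    quasi_conformal_normal_subgroup_axioms.intro)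
  show "finite_measure M" by (rule mu_finite)
  show "act g \<in> M \<rightarrow>\<^sub>M M" if "g \<in> \<Gamma>" for g by (rule act_measurable_mu[OF that])
  show "act id \<xi> = \<xi>" for \<xi> using act_id by simp
  show "act (g \<circ> h) \<xi> = act g (act h \<xi>)" if "g \<in> \<Gamma>" "h \<in> \<Gamma>" for g h \<xi> using act_comp[OF that] by simp
  show "F id \<xi> = 1" if "\<xi> \<in> Z n" for \<xi> using F1_regular[OF Z_F1[OF that]] by (simp add: regular_def)
  show "F g \<xi> \<le> exp (\<omega> * dist (g p) (h p) + real n) * F h \<xi>" if "g \<in> \<Gamma>" "h \<in> \<Gamma>" "\<xi> \<in> Z n" for g h \<xi>
    using that unfolding Z_def by blast
  show "\<bar>ln (F h \<xi>) - ln (F h' \<xi>) + \<omega> * (dist (h p) (g p) - dist (h' p) (g p))\<bar> \<le> real n"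
    if "g \<in> \<Gamma>" "h \<in> \<Gamma>" "h' \<in> \<Gamma>" "\<xi> \<in> Z n" "\<xi> \<in> U g" "good (ginv g \<circ> h)" "good (ginv g \<circ> h')" for g h h' \<xi>
    using that unfolding Z_def by blast
  show "\<xi> \<in> U id \<or> act s \<xi> \<in> U id" if "\<xi> \<in> Z n" for \<xi>
    using s(2) Chor_boundary F1_regular[OF Z_F1[OF that]] by (simp add: regular_def)
  show "g \<in> \<Gamma> \<and> good (ginv g) \<and> dist p (g p) \<le> real n'" if "g \<in> annulus n'" for g n'
    using that annulus_good[OF that] by (simp add: annulus_def len_def)
  show "card {g \<in> annulus n'. \<xi> \<in> U g} \<le> m0" if "\<xi> \<in> Z n" for \<xi> n'
    using annulus_multiplicity Chor_non_pinched F1_regular[OF Z_F1[OF that]] by (auto simp: regular_def)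
  show "\<exists>h\<in>H. L \<le> dist p (h p) \<and> good (ginv h)" for L
    using ex_long_low[OF H_sub H_infinite H_ginv H_conj, of L] low_mono[OF _ Kt_ge(2)]
    by (auto simp: good_def len_def)
  show "\<exists>n1. \<forall>n'\<ge>n1. \<forall>g\<in>annulus n'. good (ginv g \<circ> h)" if "h \<in> H" for h
    using annulus_eventually_good H_sub that by blast
qed (use id_in comp_in ginv_in bij_in isom_in countable_in F_measurable change_var U_sets U_act Z_sets
    Z_act F_pos Z_F1 F_cocycle good_id omega_pos s(1) annulus_finite c1_pos annulus_card H_sub H_conj in \<open>simp_all\<close>)

lemma AE_unbounded: "AE \<xi> in M. \<forall>r. \<exists>h\<in>H. F h \<xi> > exp r"
proof -
  obtain s where s: "s \<in> \<Gamma>" "\<And>\<xi>. \<xi> \<in> boundary \<iota> \<Longrightarrow> \<xi> \<in> U id \<or> act s \<xi> \<in> U id"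
    using U_cover by blast
  have "AE \<xi> in M. \<xi> \<in> Z n \<longrightarrow> (\<forall>r. \<exists>h\<in>H. F h \<xi> > exp r)" for n
  proof -
    interpret qc: quasi_conformal_normal_subgroup M \<Gamma> act F p \<omega> "real n" U good "Z n" s annulus width m0 "c1 / 2" H
      by (rule quasi_conformal[OF s])
    have "qc.T \<in> null_sets M"
      using qc.measure_T qc.invariant_T by (auto simp: qc.invariant_def null_sets_def qc.emeasure_eq_measure)
    from AE_not_in[OF this] show ?thesis
    proof eventually_elim
      case (elim \<xi>)
      show ?case
      proof (intro impI allI)
        fix r assume "\<xi> \<in> Z n"
        moreover have "\<xi> \<notin> qc.E r" using elim qc.E_subset_T by blast
        ultimately show "\<exists>h\<in>H. F h \<xi> > exp r" unfolding qc.E_def by (auto simp: not_le)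
      qed
    qed
  qed
  hence "AE \<xi> in M. \<forall>n. \<xi> \<in> Z n \<longrightarrow> (\<forall>r. \<exists>h\<in>H. F h \<xi> > exp r)"
    unfolding AE_all_countable by blast
  thus ?thesis using AE_F1 by eventually_elim (use Z_cover in blast)
qed

section \<open>Conical points\<close>

definition conical :: "'b set" where
  "conical = (\<Inter>j. \<Union>n\<in>{j..}. \<Union>g\<in>annulus n. U g)"

lemma conical_sets: "conical \<in> sets M"
proof -
  have "(\<Union>n\<in>{j..}. \<Union>g\<in>annulus n. U g) \<in> sets M" for j
    using annulus_finite U_sets
    by (intro sets.countable_UN' countableI_type image_subsetI) (auto intro: countable_finite)
  thus ?thesis unfolding conical_def by (intro sets.countable_INT image_subsetI) simp_all
qed

text \<open>Only a translate of \<open>\<xi>\<close> is obtained in \<^term>\<open>conical\<close>: this set is not obviously invariant, as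
  moving the base point changes the constant in the definition of the annuli.\<close>
lemma AE_conical: "AE \<xi> in M. \<exists>g\<in>\<Gamma>. act g \<xi> \<in> conical"
proof -
  obtain s where s: "s \<in> \<Gamma>" "\<And>\<xi>. \<xi> \<in> boundary \<iota> \<Longrightarrow> \<xi> \<in> U id \<or> act s \<xi> \<in> U id"
    using U_cover by blast
  have "AE \<xi> in M. \<xi> \<in> Z n \<longrightarrow> (\<exists>g\<in>\<Gamma>. act g \<xi> \<in> conical)" for n
  proof -
    interpret qc: quasi_conformal_normal_subgroup M \<Gamma> act F p \<omega> "real n" U good "Z n" s annulus width m0 "c1 / 2" H
      by (rule quasi_conformal[OF s])
    define W where "W = {\<xi>\<in>Z n. \<forall>g\<in>\<Gamma>. act g \<xi> \<notin> conical}"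
    have W_sets: "W \<in> sets M"
    proof -
      have "{\<xi>\<in>space M. act g \<xi> \<notin> conical} \<in> sets M" if "g \<in> \<Gamma>" for g
      proof -
        have "{\<xi>\<in>space M. act g \<xi> \<notin> conical} = space M - (act g -` conical \<inter> space M)" by auto
        thus ?thesis using measurable_sets[OF act_measurable_mu[OF that] conical_sets] by auto
      qed
      hence "{\<xi>\<in>space M. \<forall>g\<in>\<Gamma>. act g \<xi> \<notin> conical} \<in> sets M"
        by (intro sets_Collect_Ball_countable[OF countable_in])
      moreover have "W = Z n \<inter> {\<xi>\<in>space M. \<forall>g\<in>\<Gamma>. act g \<xi> \<notin> conical}"
        using qc.Z_space by (auto simp: W_def)
      ultimately show ?thesis using Z_sets by auto
    qed
    have W: "qc.invariant W"
      unfolding qc.invariant_def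
    proof (intro conjI ballI W_sets)
      fix g \<xi> assume g: "g \<in> \<Gamma>" and x: "\<xi> \<in> W"
      have "act h (act g \<xi>) \<notin> conical" if "h \<in> \<Gamma>" for h
        using act_comp[OF that g] comp_in[OF that g] x by (auto simp: W_def)
      thus "act g \<xi> \<in> W" using x Z_act[OF g] by (auto simp: W_def)
    qed (auto simp: W_def)
    have "measure M W = 0"
    proof (rule ccontr)
      assume "measure M W \<noteq> 0"
      hence pos: "measure M W > 0" by (simp add: zero_less_measure_iff)
      obtain \<delta> where d: "\<delta> > 0" "\<And>n. n \<ge> width \<Longrightarrow> \<delta> \<le> measure M (W \<inter> (\<Union>g\<in>annulus n. U g))"
        using qc.shadows_lower_bound[OF W pos] by blast
      \<comment> \<open>Each of these decreasing sets contains the part of \<open>W\<close> covered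
        by some annulus, so its measure is at least \<open>\<delta>\<close>, and so is that of the
        intersection; but a point of the intersection would be conical.\<close>
      define D where "D = (\<lambda>j. W \<inter> (\<Union>n\<in>{j..}. \<Union>g\<in>annulus n. U g))"
      have D_sets: "D j \<in> sets M" for j
        unfolding D_def using annulus_finite U_sets W_sets
        by (intro sets.Int sets.countable_UN' countableI_type image_subsetI) (auto intro: countable_finite)
      have "decseq D"
        unfolding decseq_def
      proof (intro allI impI subsetI)
        fix i j \<xi> assume "i \<le> j" "\<xi> \<in> D j"
        thus "\<xi> \<in> D i" unfolding D_def by force
      qed
      hence lim: "(\<lambda>j. measure M (D j)) \<longlonglongrightarrow> measure M (\<Inter>j. D j)"
        by (intro qc.finite_Lim_measure_decseq image_subsetI D_sets)
      have "\<delta> \<le> measure M (D j)" for j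
      proof -
        have "\<delta> \<le> measure M (W \<inter> (\<Union>g\<in>annulus (max j width). U g))" by (rule d(2)) simp
        also have "\<dots> \<le> measure M (D j)"
          by (rule qc.finite_measure_mono[OF _ D_sets]) (auto simp: D_def intro!: bexI[of _ "max j width"])
        finally show ?thesis .
      qed
      hence "\<delta> \<le> measure M (\<Inter>j. D j)" by (intro LIMSEQ_le_const[OF lim]) auto
      moreover have "(\<Inter>j. D j) = {}"
      proof (rule ccontr)
        assume "(\<Inter>j. D j) \<noteq> {}"
        then obtain \<xi> where "\<xi> \<in> W" "\<xi> \<in> conical" unfolding D_def conical_def by blast
        thus False using id_in act_id unfolding W_def by force
      qed
      ultimately show False using d(1) by simp
    qed
    hence "W \<in> null_sets M" using W_sets by (simp add: null_sets_def qc.emeasure_eq_measure)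
    from AE_not_in[OF this] show ?thesis by eventually_elim (auto simp: W_def)
  qed
  hence "AE \<xi> in M. \<forall>n. \<xi> \<in> Z n \<longrightarrow> (\<exists>g\<in>\<Gamma>. act g \<xi> \<in> conical)"
    unfolding AE_all_countable by blast
  thus ?thesis using AE_F1 by eventually_elim (use Z_cover in blast)
qed

text \<open>Translating back by \<open>ginv g0\<close> returns the shadows to \<open>\<xi>\<close>
  but moves the base point. This is why \<open>horoball_converges\<close> allows a point
  \<open>q\<close> different from \<open>p\<close>.\<close>

lemma conical_shadows:
  assumes g0: "g0 \<in> \<Gamma>" and x: "act g0 \<xi> \<in> conical"
  obtains gs where "\<And>m. gs m \<in> \<Gamma>" "\<And>m. \<xi> \<in> U (gs m)" "\<And>m. low Kt (ginv (gs m) (ginv g0 p))"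
    "filterlim (\<lambda>m. dist (ginv g0 p) (gs m p)) at_top sequentially"
proof -
  have "\<exists>h. h \<in> \<Gamma> \<and> \<xi> \<in> U h \<and> low Kt (ginv h (ginv g0 p)) \<and> real m \<le> dist (ginv g0 p) (h p)" for m
  proof -
    \<comment> \<open>The summand \<open>width\<close> is there because an element of the annulus
      may be shorter than \<open>n\<close> by that much.\<close>
    obtain n g where n: "n \<ge> m + width" "g \<in> annulus n" "act g0 \<xi> \<in> U g"
      using x unfolding conical_def by blast
    have g: "g \<in> \<Gamma>" "len g > real n - real width" using n by (auto simp: annulus_def)
    let ?h = "ginv g0 \<circ> g"
    have hG: "?h \<in> \<Gamma>" by (rule comp_in[OF ginv_in[OF g0] g(1)])
    have "?h (ginv g p) = ginv g0 p" using ginv_simps(2)[OF g(1)] by simp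
    hence "ginv ?h (ginv g0 p) = ginv g p" using ginv_simps(1)[OF hG] by metis
    hence "low Kt (ginv ?h (ginv g0 p))" using annulus_good[OF n(2)] by (simp add: good_def)
    moreover have "\<xi> \<in> U ?h" using U_act[OF g(1) g0] n(3) by blast
    moreover have "real m \<le> dist (ginv g0 p) (?h p)"
      using isom_in[OF ginv_in[OF g0]] g(2) n(1) by (simp add: len_def)
    ultimately show ?thesis using hG by blast
  qed
  then obtain gs where gs: "\<And>m. gs m \<in> \<Gamma> \<and> \<xi> \<in> U (gs m) \<and> low Kt (ginv (gs m) (ginv g0 p)) \<and>
      real m \<le> dist (ginv g0 p) (gs m p)" by metis
  have "filterlim (\<lambda>m. dist (ginv g0 p) (gs m p)) at_top sequentially"
    by (rule filterlim_at_top_mono[OF filterlim_real_sequentially]) (use gs in simp)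
  thus ?thesis using gs that by blast
qed

text \<open>Horoballs are defined by the limit superior over the whole class; passing to it from
  \<open>B\<close> costs the error and 1 for strictness.\<close>

lemma horoball_of_busemann:
  assumes x: "\<xi> \<in> Chor" and y: "B \<xi> y p \<le> L - (eps \<xi> + 1)"
  shows "y \<in> horoball p \<iota> (R `` {\<xi>}) L"
proof -
  have "Limsup (toward_class \<iota> (R `` {\<xi>})) (\<lambda>z. ereal \<bar>B \<xi> y p - (dist y z - dist p z)\<bar>) < ereal (eps \<xi> + 1)"
    by (rule le_less_trans[OF busemann[OF x]]) simp
  hence "\<forall>\<^sub>F z in toward_class \<iota> (R `` {\<xi>}). ereal \<bar>B \<xi> y p - (dist y z - dist p z)\<bar> < ereal (eps \<xi> + 1)"
    by (rule Limsup_lessD)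
  hence "\<forall>\<^sub>F z in toward_class \<iota> (R `` {\<xi>}). ereal (dist y z - dist p z) \<le> ereal L"
    by eventually_elim (use y in \<open>auto simp: abs_less_iff\<close>)
  thus ?thesis unfolding horoball_def class_busemann_def by (simp add: Limsup_bounded)
qed

lemma small_horospheric:
  assumes x: "\<xi> \<in> F1" and unbounded: "\<forall>r. \<exists>h\<in>H. F h \<xi> > exp r"
    and conical: "\<exists>g\<in>\<Gamma>. act g \<xi> \<in> conical" and compact: "compact (UNIV :: 'b set)"
  shows "\<xi> \<in> small_horospheric_limit_set p \<iota> R Chor H"
proof -
  have xC: "\<xi> \<in> Chor" using F1_regular[OF x] by (simp add: regular_def)
  obtain g0 where g0: "g0 \<in> \<Gamma>" "act g0 \<xi> \<in> conical" using conical by blast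
  obtain gs where gs: "\<And>m. gs m \<in> \<Gamma>" "\<And>m. \<xi> \<in> U (gs m)" "\<And>m. low Kt (ginv (gs m) (ginv g0 p))"
    "filterlim (\<lambda>m. dist (ginv g0 p) (gs m p)) at_top sequentially"
    using conical_shadows[OF g0] by blast
  \<comment> \<open>Unbounded densities mean that the Busemann function is unbounded below on the
    orbit of \<open>H\<close>.\<close>
  have deep: "\<exists>h\<in>H. B \<xi> (h p) p < t" for t
  proof -
    obtain h where h: "h \<in> H" "F h \<xi> > exp (ln \<kappa> - \<omega> * t)" using unbounded by blast
    have hG: "h \<in> \<Gamma>" using h H_sub by blast
    have "ln (F h \<xi>) > ln \<kappa> - \<omega> * t" using h(2) F_pos[OF x hG] by (metis exp_less_cancel_iff exp_ln)
    hence "\<omega> * B \<xi> (h p) p < \<omega> * t" using ln_F[OF x hG] by linarith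
    thus ?thesis using omega_pos h(1) by auto
  qed
  have acc: "\<exists>y. inj y \<and> range y \<subseteq> orbit_of H p \<inter> horoball p \<iota> (R `` {\<xi>}) L \<and> tends_to_class \<iota> (R `` {\<xi>}) y" for L
  proof -
    define Y where "Y = {y \<in> orbit_of H p. B \<xi> y p \<le> L - (eps \<xi> + 1)}"
    \<comment> \<open>A finite \<open>Y\<close> would have a least Busemann value, and
      \<open>deep\<close> goes below it.\<close>
    have "infinite Y"
    proof
      assume fin: "finite Y"
      define b where "b = Min ((\<lambda>y. B \<xi> y p) ` Y)"
      obtain h' where h': "h' \<in> H" "B \<xi> (h' p) p < min b (L - (eps \<xi> + 1))" using deep by blast
      have "h' p \<in> Y" using h' by (auto simp: Y_def orbit_of_def)
      hence "b \<le> B \<xi> (h' p) p" unfolding b_def using fin by (intro Min_le) auto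
      thus False using h' by simp
    qed
    then obtain y :: "nat \<Rightarrow> 'a" where y: "inj y" "range y \<subseteq> Y" using infinite_countable_subset by blast
    have yY: "y n \<in> Y" for n using y by blast
    have "tends_to_class \<iota> (R `` {\<xi>}) y"
      unfolding tends_to_class_def
    proof (intro allI impI)
      fix r :: "nat \<Rightarrow> nat" and \<eta> assume r: "strict_mono r" and lim: "(\<lambda>n. \<iota> (y (r n))) \<longlonglongrightarrow> \<eta>"
      show "\<eta> \<in> R `` {\<xi>}"
      proof (rule horoball_converges[OF xC gs _ _ lim])
        show "B \<xi> (y (r n)) p \<le> L - (eps \<xi> + 1)" for n using yY by (simp add: Y_def)
        fix t
        have "inj (\<lambda>n. y (r n))" 
          using inj_compose[OF y(1) strict_mono_imp_inj_on[OF r]] by (simp add: comp_def)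
        moreover have "{n. dist p (y (r n)) \<le> t} \<subseteq> (\<lambda>n. y (r n)) -` ((\<lambda>h. h p) ` ball t)"
        proof
          fix n assume "n \<in> {n. dist p (y (r n)) \<le> t}"
          moreover obtain h where "h \<in> H" "y (r n) = h p" using yY[of "r n"] by (auto simp: Y_def orbit_of_def)
          ultimately show "n \<in> (\<lambda>n. y (r n)) -` ((\<lambda>h. h p) ` ball t)"
            using H_sub by (auto simp: ball_def len_def)
        qed
        ultimately show "finite {n. dist p (y (r n)) \<le> t}"
          using finite_ball'[of t] by (meson finite_imageI finite_subset finite_vimageI)
      qed
    qed
    moreover have "range y \<subseteq> orbit_of H p \<inter> horoball p \<iota> (R `` {\<xi>}) L"
      using yY horoball_of_busemann[OF xC] by (auto simp: Y_def)
    ultimately show ?thesis using y(1) by blast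
  qed
  have "\<xi> \<in> R `` limit_set p \<iota> H"
  proof -
    obtain y :: "nat \<Rightarrow> 'a" where y: "inj y" "range y \<subseteq> orbit_of H p" "tends_to_class \<iota> (R `` {\<xi>}) y"
      using acc[of 0] by blast
    obtain r \<eta> where r: "strict_mono (r :: nat \<Rightarrow> nat)" "((\<lambda>n. \<iota> (y n)) \<circ> r) \<longlonglongrightarrow> \<eta>"
      using compact[unfolded compact_def, rule_format, of "\<lambda>n. \<iota> (y n)"] by auto
    have lim: "(\<lambda>n. \<iota> (y (r n))) \<longlonglongrightarrow> \<eta>" using r(2) by (simp add: comp_def)
    hence eta: "\<eta> \<in> R `` {\<xi>}" using y(3) r(1) unfolding tends_to_class_def by blast
    hence b: "\<eta> \<in> boundary \<iota>" using equiv_type[OF equiv] by auto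
    \<comment> \<open>A boundary point differs from all orbit points, so convergence makes it a
      limit point.\<close>
    have "\<forall>n. \<iota> (y (r n)) \<in> \<iota> ` orbit_of H p - {\<eta>}" using y(2) b by (auto simp: boundary_def)
    hence "\<eta> islimpt \<iota> ` orbit_of H p" 
      unfolding islimpt_sequential using lim by (intro exI[of _ "\<lambda>n. \<iota> (y (r n))"] conjI)
    hence "\<eta> \<in> limit_set p \<iota> H" using b by (simp add: limit_set_def)
    moreover have "(\<eta>, \<xi>) \<in> R" using eta equiv by (auto simp: equiv_def dest: symD)
    ultimately show ?thesis by blast
  qed
  thus ?thesis using xC acc unfolding small_horospheric_limit_set_def horoball_accumulates_def by blast
qed

text \<open>The set \<open>S\<close> contains almost every point but need not be Borel, hence the
  completion. Leaving \<open>S\<close> free covers the small and the big limit set at once.\<close>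

theorem horospheric_limit_set_full:
  assumes "compact (UNIV :: 'b set)" "small_horospheric_limit_set p \<iota> R Chor H \<subseteq> S" "S \<subseteq> boundary \<iota>"
  shows "emeasure (completion M) S = emeasure M (space M)"
proof -
  have AE: "AE \<xi> in M. \<xi> \<in> S"
    using AE_F1 AE_unbounded AE_conical by eventually_elim (use small_horospheric assms in blast)
  obtain N where N: "N \<in> null_sets M" "\<And>\<xi>. \<xi> \<in> space M - N \<Longrightarrow> \<xi> \<in> S" using AE_E3[OF AE] by blast
  have "space M - S \<in> sets (completion M)" by (rule null_sets_completion[OF N(1)]) (use N in auto)
  hence "space (completion M) - (space M - S) \<in> sets (completion M)" by (rule sets.compl_sets)
  moreover have "space (completion M) - (space M - S) = S" using assms(3) mu_space by (auto simp: space_completion)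
  ultimately have S: "S \<in> sets (completion M)" by simp
  have "emeasure (completion M) S = emeasure (completion M) (space M)"
  proof (rule emeasure_eq_AE[OF _ S])
    show "space M \<in> sets (completion M)" using sets.top[of "completion M"] by (simp add: space_completion)
    show "AE \<xi> in completion M. \<xi> \<in> S \<longleftrightarrow> \<xi> \<in> space M"
      using AE_completion[OF AE] by eventually_elim (use assms(3) mu_space in auto)
  qed
  thus ?thesis by simp
qed

end

section \<open>Isometry groups\<close>

lemma group_isom_group: "group (isom_group :: ('a::metric_space \<Rightarrow> 'a) monoid)"
proof (rule groupI)
  fix g :: "'a \<Rightarrow> 'a" assume g: "g \<in> carrier isom_group"
  have s: "surj g" and d: "dist (g x) (g y) = dist x y" for x y
    using g by (auto simp: isom_group_def)
  have i: "inj g" using d by (metis dist_eq_0_iff injI)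
  have "surj (ginv g)" using i by (rule inj_imp_surj_inv)
  moreover have "dist (ginv g x) (ginv g y) = dist x y" for x y
    using d[of "ginv g x" "ginv g y"] surj_f_inv_f[OF s] by simp
  ultimately have "ginv g \<in> carrier isom_group" by (simp add: isom_group_def)
  moreover have "ginv g \<circ> g = id" using i by simp
  ultimately show "\<exists>h\<in>carrier isom_group. h \<otimes>\<^bsub>isom_group\<^esub> g = \<one>\<^bsub>isom_group\<^esub>"
    by (auto simp: isom_group_def)
next
  fix g h :: "'a \<Rightarrow> 'a" assume "g \<in> carrier isom_group" "h \<in> carrier isom_group"
  thus "g \<otimes>\<^bsub>isom_group\<^esub> h \<in> carrier isom_group"
    using comp_surj[of h g] by (simp add: isom_group_def)
qed (auto simp: isom_group_def)

lemma m_inv_isom_group: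
  assumes "group (isom_group\<lparr>carrier := \<Gamma>\<rparr>)" "g \<in> \<Gamma>" and sub: "\<Gamma> \<subseteq> carrier isom_group"
  shows "m_inv (isom_group\<lparr>carrier := \<Gamma>\<rparr>) g = ginv g"
proof -
  let ?h = "m_inv (isom_group\<lparr>carrier := \<Gamma>\<rparr>) g"
  have "?h \<circ> g = id"
    using group.l_inv[OF assms(1), of g] assms(2) by (simp add: isom_group_def)
  hence l: "?h (g x) = x" for x by (metis comp_apply id_apply)
  have s: "surj g" using assms(2) sub by (auto simp: isom_group_def)
  show ?thesis
  proof
    fix y
    have "?h y = ?h (g (ginv g y))" using surj_f_inv_f[OF s] by simp
    thus "?h y = ginv g y" using l by simp
  qed
qed

lemma isometry_action_subgroup:
  assumes sub: "subgroup \<Gamma> isom_group"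
  shows "isometry_action \<Gamma>"
proof -
  have G: "group (isom_group\<lparr>carrier := \<Gamma>\<rparr>)" by (rule subgroup.subgroup_is_group[OF sub group_isom_group])
  have c: "\<Gamma> \<subseteq> carrier isom_group" by (rule subgroup.subset[OF sub])
  show ?thesis
  proof
    show "id \<in> \<Gamma>" using subgroup.one_closed[OF sub] by (simp add: isom_group_def)
    show "g \<circ> h \<in> \<Gamma>" if "g \<in> \<Gamma>" "h \<in> \<Gamma>" for g h
      using subgroup.m_closed[OF sub that] by (simp add: isom_group_def)
    show "ginv g \<in> \<Gamma>" if "g \<in> \<Gamma>" for g
      using group.inv_closed[OF G, of g] that m_inv_isom_group[OF G that c] by simp
  qed (use c in \<open>auto simp: isom_group_def\<close>)
qed

text \<open>A basic neighbourhood of \<open>id\<close> in the topology of pointwise convergence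
  restricts the values at finitely many points only.\<close>

lemma discrete_separation:
  fixes \<Gamma> :: "('a::metric_space \<Rightarrow> 'a) set"
  assumes "discrete \<Gamma>" "id \<in> \<Gamma>"
  obtains J and e :: "'a \<Rightarrow> real" where "finite J" "\<And>i. i \<in> J \<Longrightarrow> e i > 0"
    "\<And>g. g \<in> \<Gamma> \<Longrightarrow> (\<And>i. i \<in> J \<Longrightarrow> dist (g i) i < e i) \<Longrightarrow> g = id"
proof -
  have "id isolated_in \<Gamma>" by (rule discreteD[OF assms])
  then obtain T where T: "open T" "T \<inter> \<Gamma> = {id}" by (auto simp: isolated_in_def)
  have "openin (product_topology (\<lambda>_. euclidean) UNIV) T" using T(1) by (simp add: open_fun_def)
  moreover have "id \<in> T" using T by blast
  ultimately obtain X where X: "id \<in> (\<Pi>\<^sub>E i\<in>UNIV. X i)" "\<And>i. openin euclidean (X i)"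
    "finite {i. X i \<noteq> topspace euclidean}" "(\<Pi>\<^sub>E i\<in>UNIV. X i) \<subseteq> T"
    using product_topology_open_contains_basis[of "\<lambda>_. euclidean" UNIV T id] by blast
  define J where "J = {i. X i \<noteq> UNIV}"
  have "\<exists>e>0. Elementary_Metric_Spaces.ball i e \<subseteq> X i" for i
  proof -
    have "open (X i)" "i \<in> X i" using X(1,2) by (auto simp: PiE_def Pi_def)
    thus ?thesis by (simp add: open_contains_ball)
  qed
  then obtain e where e: "\<And>i. e i > 0" "\<And>i. Elementary_Metric_Spaces.ball i (e i) \<subseteq> X i" by metis
  show ?thesis
  proof (rule that[of J e])
    show "finite J" using X(3) by (simp add: J_def)
    fix g assume g: "g \<in> \<Gamma>" "\<And>i. i \<in> J \<Longrightarrow> dist (g i) i < e i"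
    have "g i \<in> X i" for i
      using e(2)[of i] g(2)[of i] by (cases "i \<in> J") (auto simp: J_def dist_commute)
    hence "g \<in> T" using X(4) by (auto simp: PiE_def Pi_def)
    thus "g = id" using T(2) g(1) by blast
  qed (use e in auto)
qed

text \<open>The images of the finitely many test points stay in compact balls. Two elements that
  send each test point into the same small ball differ by an element close to \<open>id\<close>,
  hence agree, so the finite covers bound the number of elements.\<close>

lemma (in isometry_action) finite_ball_discrete:
  fixes p :: 'a
  assumes proper: "\<forall>(x::'a) r. compact (cball x r)" and disc: "discrete \<Gamma>"
  shows "finite {g\<in>\<Gamma>. dist p (g p) \<le> r}"
proof -
  obtain J and e :: "'a \<Rightarrow> real" where J: "finite J" "\<And>i. i \<in> J \<Longrightarrow> e i > 0"
    "\<And>g. g \<in> \<Gamma> \<Longrightarrow> (\<And>i. i \<in> J \<Longrightarrow> dist (g i) i < e i) \<Longrightarrow> g = id"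
    using discrete_separation[OF disc id_in] by blast
  define G where "G = {g\<in>\<Gamma>. dist p (g p) \<le> r}"
  have "\<exists>N. finite N \<and> cball p (r + dist p i) \<subseteq> (\<Union>x\<in>N. Elementary_Metric_Spaces.ball x (e i / 2))" if "i \<in> J" for i
    using proper J(2)[OF that] by (metis compact_eq_totally_bounded half_gt_zero)
  then obtain N where N: "\<And>i. i \<in> J \<Longrightarrow> finite (N i)"
    "\<And>i. i \<in> J \<Longrightarrow> cball p (r + dist p i) \<subseteq> (\<Union>x\<in>N i. Elementary_Metric_Spaces.ball x (e i / 2))" by metis
  have "\<exists>x\<in>N i. dist x (g i) < e i / 2" if gi: "g \<in> G" "i \<in> J" for g i
  proof -
    have "dist p (g i) \<le> dist p (g p) + dist (g p) (g i)" by (rule dist_triangle)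
    hence "g i \<in> cball p (r + dist p i)" using gi isom_in by (auto simp: G_def)
    then obtain w where "w \<in> N i" "g i \<in> Elementary_Metric_Spaces.ball w (e i / 2)"
      using N(2)[OF gi(2)] by blast
    thus ?thesis by (intro bexI[of _ w]) (simp_all only: mem_ball)
  qed
  then obtain x where x: "\<And>g i. g \<in> G \<Longrightarrow> i \<in> J \<Longrightarrow> x g i \<in> N i \<and> dist (x g i) (g i) < e i / 2" by metis
  have "inj_on (\<lambda>g. restrict (x g) J) G"
  proof (rule inj_onI)
    fix g h assume gh: "g \<in> G" "h \<in> G" "restrict (x g) J = restrict (x h) J"
    have G: "g \<in> \<Gamma>" "h \<in> \<Gamma>" using gh by (auto simp: G_def)
    have "ginv h \<circ> g = id"
    proof (rule J(3))
      show "ginv h \<circ> g \<in> \<Gamma>" by (rule comp_in[OF ginv_in[OF G(2)] G(1)])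
      fix i assume i: "i \<in> J"
      have "x g i = x h i" using fun_cong[OF gh(3), of i] i by simp
      hence "dist (g i) (h i) < e i"
        using x[OF gh(1) i] x[OF gh(2) i] dist_triangle3[of "g i" "h i" "x g i"] by auto
      thus "dist ((ginv h \<circ> g) i) i < e i" using dist_ginv[OF G(2)] by simp
    qed
    hence "h \<circ> (ginv h \<circ> g) = h" by simp
    thus "g = h" using ginv_comp(2)[OF G(2)] by (simp add: o_assoc)
  qed
  moreover have "(\<lambda>g. restrict (x g) J) ` G \<subseteq> (\<Pi>\<^sub>E i\<in>J. N i)" using x by auto
  moreover have "finite (\<Pi>\<^sub>E i\<in>J. N i)" using J(1) N(1) by (rule finite_PiE)
  ultimately have "finite G" by (meson finite_imageD finite_subset)
  thus ?thesis by (simp add: G_def)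
qed

text \<open>The elements that send \<open>p\<close> to a given orbit point are carried into the
  stabiliser by the inverse of one of them.\<close>

lemma (in isometry_action) card_ball_le_orbit:
  fixes p :: 'a
  assumes fin: "\<And>r. finite {g\<in>\<Gamma>. dist p (g p) \<le> r}"
  shows "card {g\<in>\<Gamma>. dist p (g p) \<le> real n} \<le> card (orbit_ball \<Gamma> p n) * card {g\<in>\<Gamma>. dist p (g p) \<le> 0}"
proof -
  let ?G = "{g\<in>\<Gamma>. dist p (g p) \<le> real n}" and ?S = "{g\<in>\<Gamma>. dist p (g p) \<le> 0}"
  have ob: "orbit_ball \<Gamma> p n = (\<lambda>g. g p) ` ?G" by (auto simp: orbit_ball_def)
  have fob: "finite (orbit_ball \<Gamma> p n)" unfolding ob using fin by simp
  have fiber: "card {g\<in>?G. g p = y} \<le> card ?S" if y: "y \<in> orbit_ball \<Gamma> p n" for y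
  proof -
    obtain h where h: "h \<in> \<Gamma>" "h p = y" using y unfolding ob by auto
    have "inj_on (\<lambda>g. ginv h \<circ> g) {g\<in>?G. g p = y}"
    proof (rule inj_onI)
      fix g g' :: "'a \<Rightarrow> 'a" assume "ginv h \<circ> g = ginv h \<circ> g'"
      hence "h \<circ> (ginv h \<circ> g) = h \<circ> (ginv h \<circ> g')" by simp
      thus "g = g'" using ginv_comp(2)[OF h(1)] by (simp add: o_assoc)
    qed
    moreover have "(\<lambda>g. ginv h \<circ> g) ` {g\<in>?G. g p = y} \<subseteq> ?S"
      using comp_in[OF ginv_in[OF h(1)]] ginv_simps(1)[OF h(1)] h(2) by auto
    ultimately show ?thesis using card_inj_on_le fin by blast
  qed
  have eq: "?G = (\<Union>y\<in>orbit_ball \<Gamma> p n. {g\<in>?G. g p = y})" unfolding ob by auto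
  have "card ?G = card (\<Union>y\<in>orbit_ball \<Gamma> p n. {g\<in>?G. g p = y})" by (rule arg_cong[OF eq])
  also have "\<dots> \<le> (\<Sum>y\<in>orbit_ball \<Gamma> p n. card {g\<in>?G. g p = y})" by (rule card_UN_le[OF fob])
  also have "\<dots> \<le> card (orbit_ball \<Gamma> p n) * card ?S" by (rule order_trans[OF sum_bounded_above[OF fiber]]) simp_all
  finally show ?thesis .
qed

lemma contracting_set_mono: "contracting_set C Z \<Longrightarrow> C \<le> C' \<Longrightarrow> contracting_set C' Z"
  unfolding contracting_set_def by (meson order_trans)

lemma bd_ext_extends:
  fixes \<iota> :: "'a::metric_space \<Rightarrow> 'b::metric_space"
  assumes "closure (range \<iota>) = UNIV" and "isom_invariant_partition \<iota> R" "g \<in> carrier isom_group"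
  shows "extends_isometry \<iota> g (bd_ext \<iota> g)"
proof -
  obtain \<phi> where p: "extends_isometry \<iota> g \<phi>"
    using assms(2,3) unfolding isom_invariant_partition_def by blast
  have "\<psi> = \<phi>" if "extends_isometry \<iota> g \<psi>" for \<psi>
    by (rule continuous_eq_on_dense[OF _ _ assms(1)]) (use that p in \<open>auto simp: extends_isometry_def\<close>)
  with p show ?thesis unfolding bd_ext_def by (rule theI)
qed

theorem theorem1p19:
  fixes p :: "'a::metric_space"
    and \<iota> :: "'a \<Rightarrow> 'b::metric_space"
    and R :: "'b rel"
    and \<Gamma> H :: "('a \<Rightarrow> 'a) set"
    and Chor :: "'b set"
    and B :: "'b \<Rightarrow> 'a \<Rightarrow> 'a \<Rightarrow> real"
    and \<mu> :: "'a \<Rightarrow> 'b measure"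
  assumes proper: "\<forall>(x::'a) r. compact (cball x r)"
    and geodesic: "\<forall>x y::'a. \<exists>S. geodesic_segment x y S"
    and conv_bd: "convergence_boundary p \<iota> R \<Gamma>"
    and busemann: "busemann_quasi_cocycle p \<iota> R Chor B"
    and discrete: "discrete_isometry_group \<Gamma>"
    and non_elem: "\<not> elementary_group (isom_group\<lparr>carrier := \<Gamma>\<rparr>)"
    and peg: "purely_exponential_growth \<Gamma> p"
    and contr: "\<exists>g\<in>\<Gamma>. contracting_isometry p g"
    and density: "quasi_conformal_density p \<iota> R Chor B \<Gamma> (growth_rate \<Gamma> p) \<mu>"
    and prob: "emeasure (\<mu> p) (space (\<mu> p)) = 1"
    and normal: "normal H (isom_group\<lparr>carrier := \<Gamma>\<rparr>)"
    and infinite: "infinite H"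
  shows "emeasure (completion (\<mu> p)) (small_horospheric_limit_set p \<iota> R Chor H) = 1 \<and>
         emeasure (completion (\<mu> p)) (big_horospheric_limit_set p \<iota> R Chor H) = 1"
proof -
  have sub: "subgroup \<Gamma> isom_group" and disc: "discrete \<Gamma>"
    using discrete by (auto simp: discrete_isometry_group_def)
  interpret iso: group "isom_group :: ('a \<Rightarrow> 'a) monoid" by (rule group_isom_group)
  interpret act: isometry_action \<Gamma> by (rule isometry_action_subgroup[OF sub])
  have car: "\<Gamma> \<subseteq> carrier isom_group" by (rule subgroup.subset[OF sub])
  have fin: "finite {g\<in>\<Gamma>. dist p (g p) \<le> r}" for r by (rule act.finite_ball_discrete[OF proper disc])
  obtain f k c C where f: "f \<in> \<Gamma>" "f \<in> carrier isom_group"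
    and qi: "qi_embedding_on k c \<int> (\<lambda>t. (f [^]\<^bsub>isom_group\<^esub> \<lfloor>t\<rfloor>) p)"
    and C: "contracting_set C (range (\<lambda>n::int. (f [^]\<^bsub>isom_group\<^esub> n) p))"
    using contr unfolding contracting_isometry_def by blast
  define shift where "shift = (\<lambda>i::int. f [^]\<^bsub>isom_group\<^esub> i)"
  define a where "a = (\<lambda>i. shift i p)"
  have shift0: "shift 0 = id" by (simp add: shift_def) (simp add: isom_group_def)
  have shift_add: "shift (i + j) x = shift i (shift j x)" for i j x
    using iso.int_pow_mult[OF f(2), of i j] by (simp add: shift_def isom_group_def)
  have a0: "a 0 = p" by (simp add: a_def shift0)
  have shift_in: "shift i \<in> \<Gamma>" for i
    unfolding shift_def by (rule iso.subgroup_int_pow_closed[OF sub f(1)])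
  have qia: "\<bar>real_of_int (i - j)\<bar> / k - c \<le> dist (a i) (a j)" "dist (a i) (a j) \<le> k * \<bar>real_of_int (i - j)\<bar> + c"
    for i j
  proof -
    have "dist (real_of_int i) (real_of_int j) / k - c \<le> dist (a i) (a j) \<and>
      dist (a i) (a j) \<le> k * dist (real_of_int i) (real_of_int j) + c"
      using qi Ints_of_int[of i] Ints_of_int[of j] unfolding qi_embedding_on_def a_def shift_def
      by (metis floor_of_int)
    thus "\<bar>real_of_int (i - j)\<bar> / k - c \<le> dist (a i) (a j)" "dist (a i) (a j) \<le> k * \<bar>real_of_int (i - j)\<bar> + c"
      by (simp_all add: dist_real_def)
  qed
  have kc: "k \<ge> 1" "c \<ge> 0" using qi by (auto simp: qi_embedding_on_def)
  define \<omega> where "\<omega> = growth_rate \<Gamma> p"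
  obtain d where d: "d \<ge> 1" "\<And>n. exp (real n * \<omega>) / d \<le> real (card (orbit_ball \<Gamma> p n))"
    "\<And>n. real (card (orbit_ball \<Gamma> p n)) \<le> d * exp (real n * \<omega>)"
    using peg unfolding purely_exponential_growth_def \<omega>_def by blast
  have ob: "orbit_ball \<Gamma> p n = (\<lambda>g. g p) ` {g\<in>\<Gamma>. dist p (g p) \<le> real n}" for n
    by (auto simp: orbit_ball_def)
  \<comment> \<open>Otherwise orbit balls of all radii would have at most \<open>d\<close> points,
    whereas the quasi-isometrically embedded axis is an infinite part of the orbit.\<close>
  have omega_pos: "\<omega> > 0"
  proof (rule ccontr)
    assume "\<not> \<omega> > 0"
    have le_d: "real (card (orbit_ball \<Gamma> p n)) \<le> d" for n
    proof -
      have "exp (real n * \<omega>) \<le> 1" using \<open>\<not> \<omega> > 0\<close> by (simp add: mult_nonneg_nonpos)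
      hence "d * exp (real n * \<omega>) \<le> d * 1" using d(1) by (intro mult_left_mono) auto
      thus ?thesis using d(3)[of n] by linarith
    qed
    have "\<not> finite (range a)"
    proof
      assume "finite (range a)"
      hence "bounded (range a)" by (rule finite_imp_bounded)
      then obtain e where e: "\<And>y. y \<in> range a \<Longrightarrow> dist (a 0) y \<le> e" by (metis bounded_any_center)
      obtain i :: nat where i: "k * (e + c) < real i" using reals_Archimedean2 by blast
      have "real i / k - c \<le> e" using qia(1)[of 0 "int i"] e[of "a (int i)"] by simp
      thus False using i kc by (simp add: field_simps)
    qed
    then obtain S where S: "S \<subseteq> range a" "finite S" "card S = nat \<lceil>d\<rceil> + 1"
      using infinite_arbitrarily_large by blast
    obtain e where e: "\<And>y. y \<in> S \<Longrightarrow> dist p y \<le> e"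
      using finite_imp_bounded[OF S(2)] by (metis bounded_any_center)
    obtain n :: nat where n: "e \<le> real n" using real_arch_simple by blast
    have "S \<subseteq> orbit_ball \<Gamma> p n"
    proof
      fix y assume y: "y \<in> S"
      then obtain i where "y = shift i p" using S(1) by (auto simp: a_def)
      thus "y \<in> orbit_ball \<Gamma> p n" using e[OF y] n shift_in[of i] by (auto simp: orbit_ball_def)
    qed
    moreover have "finite (orbit_ball \<Gamma> p n)" unfolding ob using fin by simp
    ultimately have "card S \<le> card (orbit_ball \<Gamma> p n)" by (simp add: card_mono)
    thus False using le_d[of n] S(3) by linarith
  qed
  have growth_lower: "1 / d * exp (\<omega> * real n) \<le> real (card {g\<in>\<Gamma>. dist (a 0) (g (a 0)) \<le> real n})" for n
  proof -
    have "card (orbit_ball \<Gamma> p n) \<le> card {g\<in>\<Gamma>. dist p (g p) \<le> real n}"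
      unfolding ob using fin by (rule card_image_le)
    thus ?thesis using d(2)[of n] by (simp add: a0 mult.commute)
  qed
  \<comment> \<open>The order of the stabiliser of \<open>p\<close>.\<close>
  define s where "s = card {g\<in>\<Gamma>. dist p (g p) \<le> 0}"
  have growth_upper: "real (card {g\<in>\<Gamma>. dist (a 0) (g (a 0)) \<le> real n}) \<le> real s * d * exp (\<omega> * real n)" for n
  proof -
    have "real (card {g\<in>\<Gamma>. dist p (g p) \<le> real n}) \<le> real (card (orbit_ball \<Gamma> p n) * s)"
      unfolding s_def using act.card_ball_le_orbit[OF fin] by (intro of_nat_mono)
    also have "\<dots> \<le> (d * exp (real n * \<omega>)) * real s" using d(3)[of n] by (simp add: mult_right_mono)
    finally show ?thesis by (simp add: a0 mult_ac)
  qed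
  have comp: "compactification \<iota>" and part: "isom_invariant_partition \<iota> R" and cones: "assumption_B p \<iota> R"
    using conv_bd by (auto simp: convergence_boundary_def)
  have dense: "closure (range \<iota>) = UNIV" and compact: "compact (UNIV :: 'b set)"
    using comp by (auto simp: compactification_def)
  have ext: "extends_isometry \<iota> g (bd_ext \<iota> g)" if "g \<in> \<Gamma>" for g
    by (rule bd_ext_extends[OF dense part]) (use that car in blast)
  obtain \<epsilon> where eps: "\<And>\<xi> x y. \<xi> \<in> Chor \<Longrightarrow> Limsup (toward_class \<iota> (R `` {\<xi>}))
          (\<lambda>z. ereal \<bar>B \<xi> x y - (dist x z - dist y z)\<bar>) \<le> ereal (\<epsilon> (R `` {\<xi>}))"
    and Chor: "Chor \<subseteq> non_pinched p \<iota> R"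
    using busemann unfolding busemann_quasi_cocycle_def by blast
  obtain l where l: "l \<ge> 1" "\<And>x y. absolutely_continuous (\<mu> y) (\<mu> x)"
      "\<And>x y. AE \<xi> in \<mu> y. \<xi> \<in> Chor \<and>
           ennreal (exp (- \<omega> * B \<xi> x y) / l) \<le> RN_deriv (\<mu> y) (\<mu> x) \<xi> \<and>
           RN_deriv (\<mu> y) (\<mu> x) \<xi> \<le> ennreal (l * exp (- \<omega> * B \<xi> x y))"
    using density unfolding quasi_conformal_density_def \<omega>_def by blast
  have mu: "\<And>x. finite_measure (\<mu> x)" "\<And>x. sets (\<mu> x) = sets (boundary_borel \<iota>)"
      "\<And>g x. g \<in> \<Gamma> \<Longrightarrow> distr (\<mu> x) (boundary_borel \<iota>) (bd_ext \<iota> g) = \<mu> (g x)"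
    using density unfolding quasi_conformal_density_def by blast+
  let ?G = "isom_group\<lparr>carrier := \<Gamma>\<rparr>"
  have G: "group ?G" by (rule subgroup.subgroup_is_group[OF sub group_isom_group])
  have H: "H \<subseteq> \<Gamma>" using subgroup.subset[OF normal_imp_subgroup[OF normal]] by simp
  have H_ginv: "ginv h \<in> H" if "h \<in> H" for h
    using subgroup.m_inv_closed[OF normal_imp_subgroup[OF normal] that] m_inv_isom_group[OF G _ car, of h] that H
    by auto
  have H_conj: "g \<circ> h \<circ> ginv g \<in> H" if "g \<in> \<Gamma>" "h \<in> H" for g h
    using normal.inv_op_closed2[OF normal, of g h] that m_inv_isom_group[OF G that(1) car]
    by (simp add: isom_group_def)
  interpret density_action a k c "max C 1" \<Gamma> shift \<omega> "1 / d" "real s * d" \<iota> R Chor B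
    "\<lambda>\<xi>. \<epsilon> (R `` {\<xi>})" "bd_ext \<iota>" \<mu> l H
  proof (intro density_action.intro boundary_action.intro axis_group.intro contracting_line.intro
      boundary_action_axioms.intro axis_group_axioms.intro density_action_axioms.intro)
    show "contracting_set (max C 1) (range a)"
      using contracting_set_mono[OF C] by (simp add: a_def shift_def)
    show "isometry_action \<Gamma>" by (rule act.isometry_action_axioms)
    show "shift i (a j) = a (i + j)" for i j by (simp add: a_def shift_add)
    show "shift i (shift (- i) x) = x" for i x using shift_add[of i "- i" x] by (simp add: shift0)
    show "equiv (boundary \<iota>) R" using part by (simp add: isom_invariant_partition_def)
    show "continuous_on UNIV (bd_ext \<iota> g)" if "g \<in> \<Gamma>" for g using ext[OF that] by (simp add: extends_isometry_def)
    show "bd_ext \<iota> g (\<iota> x) = \<iota> (g x)" if "g \<in> \<Gamma>" for g x using ext[OF that] by (simp add: extends_isometry_def)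
    show "finite {g \<in> \<Gamma>. dist (a 0) (g (a 0)) \<le> r}" for r unfolding a0 by (rule fin)
    show "\<exists>S. geodesic_segment x y S" for x y :: 'a using geodesic by blast
    show "Chor \<subseteq> non_pinched (a 0) \<iota> R" "assumption_B (a 0) \<iota> R" unfolding a0 by (rule Chor, rule cones)
    show "0 < 1 / d" using d(1) by simp
  qed (fact proper qia kc shift_in growth_lower growth_upper omega_pos dense eps mu l H infinite H_ginv H_conj | simp)+
  have sb: "small_horospheric_limit_set p \<iota> R Chor H \<subseteq> big_horospheric_limit_set p \<iota> R Chor H"
    by (auto simp: small_horospheric_limit_set_def big_horospheric_limit_set_def)
  have bb: "big_horospheric_limit_set p \<iota> R Chor H \<subseteq> boundary \<iota>"
    using Chor by (auto simp: big_horospheric_limit_set_def non_pinched_def)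
  show ?thesis
    using horospheric_limit_set_full[OF compact, unfolded a0, OF order_refl order_trans[OF sb bb]]
      horospheric_limit_set_full[OF compact, unfolded a0, OF sb bb] prob by simp
qed

end
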